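(* In an $N_K=N$ SUSY vertex algebra $V$ the following identities hold for all homogeneous $a,b\in V$, all $j\in\mathbb Z$, $J\subset\{1,\dots,N\}$ and $i=1,\dots,N$: (1) $Y(a_{(j|J)}b,Z)=\sigma(J)\,Y(a,Z)_{(j|J)}Y(b,Z)$; (2) $Y(a_{(-1|N)}b,Z)=\,:Y(a,Z)Y(b,Z):$; (3) $Y(S^ia,Z)=D^i_ZY(a,Z)$; (4) (OPE formula) $$[Y(a,Z),Y(b,W)]=\sum_{(j|J):\,j\ge0}\sigma(J)\bigl(D_W^{(j|J)}\delta(Z,W)\bigr)Y(a_{(j|J)}b,W).$$
   Context: Ground field $\mathbb C$; $N\ge1$ a fixed integer. $Z=(z,\theta^1,\dots,\theta^N)$, $W=(w,\zeta^1,\dots,\zeta^N)$, $z,w$ even, $\theta^i,\zeta^i$ odd; odd variables anticommute with each other and supercommute with elements of superspaces; $[\ ,\ ]$ is the supercommutator. In exponents of $-1$, $J$ means $\#J$. For $J=\{j_1<\dots<j_k\}\subset\{1,\dots,N\}$, $\theta^J=\theta^{j_1}\cdots\theta^{j_k}$, $Z^{j|J}=z^j\theta^J$; "$N$" as a set means $\{1,\dots,N\}$; $\sigma(J)=\pm1$ is defined by $\theta^J\theta^{N\setminus J}=\sigma(J)\theta^1\cdots\theta^N$. $(Z-W)^{j|J}=\bigl(z-w-\sum_i\theta^i\zeta^i\bigr)^j\prod_{i\in J}(\theta^i-\zeta^i)$ (increasing order; for $j<0$ expanded as a finite sum in powers of $\sum_i\theta^i\zeta^i$). $D^i_Z=\partial_{\theta^i}+\theta^i\partial_z$,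 $\overline D^{\,i}_Z=\partial_{\theta^i}-\theta^i\partial_z$, $D^i_W=\partial_{\zeta^i}+\zeta^i\partial_w$, $D_W^{(j|J)}=\frac{(-1)^{J(J+1)/2}}{j!}\partial_w^jD_W^{j_1}\cdots D_W^{j_k}$. $i_{z,w}$, $i_{w,z}$ are expansions in the domains $|z|>|w|$, $|w|>|z|$; $\delta(Z,W)=(i_{z,w}-i_{w,z})\frac{(\theta^1-\zeta^1)\cdots(\theta^N-\zeta^N)}{z-w}$. $\mathrm{res}_Z$ is the coefficient of $z^{-1}\theta^1\cdots\theta^N$ (written to the right of it). For $\mathrm{End}(V)$-valued fields (formal sums $a(Z)=\sum_{n\in\mathbb Z,I}Z^{n|I}a_{n|I}$ with $a(Z)v\in V((z))[\theta^1,\dots,\theta^N]$ for all $v\in V$) of parities $p(a),p(b)$, and all $(j|J)$, the $(j|J)$-product is $$a(W)_{(j|J)}b(W)=\mathrm{res}_Z\bigl(i_{z,w}(Z-W)^{j|J}a(Z)b(W)-(-1)^{p(a)p(b)}i_{w,z}(Z-W)^{j|J}b(W)a(Z)\bigr),$$ and the normally ordered product is $:a(Z)b(Z):\,=a_+(Z)b(Z)+(-1)^{p(a)p(b)}b(Z)a_-(Z)$, where $a_+(Z)=\sum_{n\ge0,I}Z^{n|I}a_{n|I}$, $a_-(Z)=a(Z)-a_+(Z)$. An $N_K=N$ SUSY vertex algebra is a vector superspace $V$ with an even vector $|0\rangle$, odd operators $S^1,\dots,S^N$, and a parity preserving linear map $Y$ sending $a\in V$ to an $\mathrm{End}(V)$-valued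 field $Y(a,Z)=\sum_{j\in\mathbb Z,J}Z^{-1-j|N\setminus J}a_{(j|J)}$, $a_{(j|J)}\in\mathrm{End}(V)$, such that: $Y(a,Z)|0\rangle\in V[[z]][\theta^1,\dots,\theta^N]$ has value $a$ at $Z=0$, $S^i|0\rangle=0$; $[S^i,Y(a,Z)]=\overline D^{\,i}_ZY(a,Z)$; for all $a,b$, $(z-w)^n[Y(a,Z),Y(b,W)]=0$ for some $n\ge0$. One writes $a_{(j|J)}b=a_{(j|J)}(b)$ for $a,b\in V$. *)

theory Defs
  imports Complex_Main "HOL-Library.Groups_Big_Fun" "HOL-Library.Z2"
begin

text \<open>
  The odd coordinates are indexed by a finite linearly ordered type 'n, so that \<open>N = card (UNIV :: 'n set)\<close>
  is an arbitrary integer \<open>\<ge> 1\<close> and the set \<open>{1,\<dots>,N}\<close> is \<^term>\<open>UNIV\<close>; the complement of \<open>J\<close>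
  is \<open>- J\<close>. Parities live in \<open>\<int>/2\<close>, the type \<^typ>\<open>bit\<close>.

  A series in \<open>Z = (z, \<theta>)\<close> is the family of its coefficients: \<open>X n I\<close> is the coefficient, written on the
  right, of \<open>z^n \<theta>^I\<close>. A series in \<open>Z\<close> and \<open>W = (w, \<zeta>)\<close> is handled likewise: \<open>X m I n K\<close> is the coefficient,
  written on the right, of \<open>z^m \<theta>^I w^n \<zeta>^K\<close>. Operator-valued coefficients take the
  vector on which they act as a last argument.
\<close>

type_synonym ('n, 'c) ser1 = "int \<Rightarrow> 'n set \<Rightarrow> 'c"
type_synonym ('n, 'c) ser2 = "int \<Rightarrow> 'n set \<Rightarrow> int \<Rightarrow> 'n set \<Rightarrow> 'c"

section \<open>Signs\<close>

text \<open>\<open>koszul p\<close> is \<open>(-1)^p\<close>.\<close>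

definition koszul :: "bit \<Rightarrow> complex" where
  "koszul p = (if p = 0 then 1 else - 1)"

abbreviation par :: "'n set \<Rightarrow> bit" where
  "par I \<equiv> of_nat (card I)"

text \<open>For disjoint \<open>I\<close> and \<open>J\<close>: \<open>\<theta>^I \<theta>^J = shuffle_sign I J * \<theta>^(I \<union> J)\<close>.\<close>

definition shuffle_sign :: "'n::{finite,linorder} set \<Rightarrow> 'n set \<Rightarrow> complex" where
  "shuffle_sign I J = (- 1) ^ card {(i, j). i \<in> I \<and> j \<in> J \<and> j < i}"

definition sigma :: "'n::{finite,linorder} set \<Rightarrow> complex" where
  "sigma J = shuffle_sign J (- J)"

section \<open>Superspaces and operators\<close>

locale vector_superspace = vector_space scale
  for scale :: "complex \<Rightarrow> 'v::ab_group_add \<Rightarrow> 'v" +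
  fixes V :: "bit \<Rightarrow> 'v set"
  assumes subspace_V: "subspace (V p)"
    and V_Int: "V 0 \<inter> V 1 = {0}"
    and V_sum: "\<exists>x\<in>V 0. \<exists>y\<in>V 1. v = x + y"

definition has_parity :: "(bit \<Rightarrow> 'v set) \<Rightarrow> bit \<Rightarrow> ('v \<Rightarrow> 'v) \<Rightarrow> bool" where
  "has_parity V p A \<longleftrightarrow> (\<forall>q. \<forall>v\<in>V q. A v \<in> V (p + q))"

text \<open>\<open>a(Z) v \<in> V((z))[\<theta>]\<close> for all \<open>v\<close>.\<close>

definition is_superfield ::
    "(complex \<Rightarrow> 'v::ab_group_add \<Rightarrow> 'v) \<Rightarrow> ('n::{finite,linorder}, 'v \<Rightarrow> 'v) ser1 \<Rightarrow> bool" where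
  "is_superfield scale a \<longleftrightarrow>
     (\<forall>n I. Vector_Spaces.linear scale scale (a n I)) \<and>
     (\<forall>v. \<exists>n0. \<forall>n<n0. \<forall>I. a n I v = 0)"

text \<open>As \<open>\<theta>^I\<close> has parity \<open>#I\<close>, the coefficients of a series of parity \<open>p\<close> have parity \<open>p + #I\<close>.\<close>

definition ser_has_parity ::
    "(bit \<Rightarrow> 'v set) \<Rightarrow> bit \<Rightarrow> ('n::{finite,linorder}, 'v \<Rightarrow> 'v) ser1 \<Rightarrow> bool" where
  "ser_has_parity V p a \<longleftrightarrow> (\<forall>n I. has_parity V (p + par I) (a n I))"

section \<open>Operations on operator-valued series in one variable\<close>

definition d_z ::
    "(complex \<Rightarrow> 'v::ab_group_add \<Rightarrow> 'v) \<Rightarrow> ('n::{finite,linorder}, 'v \<Rightarrow> 'v) ser1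
      \<Rightarrow> ('n, 'v \<Rightarrow> 'v) ser1" where
  "d_z scale a = (\<lambda>n I v. scale (of_int (n + 1)) (a (n + 1) I v))"

definition d_theta ::
    "(complex \<Rightarrow> 'v::ab_group_add \<Rightarrow> 'v) \<Rightarrow> 'n::{finite,linorder} \<Rightarrow> ('n, 'v \<Rightarrow> 'v) ser1
      \<Rightarrow> ('n, 'v \<Rightarrow> 'v) ser1" where
  "d_theta scale i a = (\<lambda>n I v.
     if i \<in> I then 0 else scale (shuffle_sign {i} I) (a n (insert i I) v))"

definition m_theta ::
    "(complex \<Rightarrow> 'v::ab_group_add \<Rightarrow> 'v) \<Rightarrow> 'n::{finite,linorder} \<Rightarrow> ('n, 'v \<Rightarrow> 'v) ser1
      \<Rightarrow> ('n, 'v \<Rightarrow> 'v) ser1" where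
  "m_theta scale i a = (\<lambda>n I v.
     if i \<in> I then scale (shuffle_sign {i} (I - {i})) (a n (I - {i}) v) else 0)"

definition D_Z ::
    "(complex \<Rightarrow> 'v::ab_group_add \<Rightarrow> 'v) \<Rightarrow> 'n::{finite,linorder} \<Rightarrow> ('n, 'v \<Rightarrow> 'v) ser1
      \<Rightarrow> ('n, 'v \<Rightarrow> 'v) ser1" where
  "D_Z scale i a = (\<lambda>n I v. d_theta scale i a n I v + m_theta scale i (d_z scale a) n I v)"

definition Dbar_Z ::
    "(complex \<Rightarrow> 'v::ab_group_add \<Rightarrow> 'v) \<Rightarrow> 'n::{finite,linorder} \<Rightarrow> ('n, 'v \<Rightarrow> 'v) ser1
      \<Rightarrow> ('n, 'v \<Rightarrow> 'v) ser1" where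
  "Dbar_Z scale i a = (\<lambda>n I v. d_theta scale i a n I v - m_theta scale i (d_z scale a) n I v)"

text \<open>\<open>[A, a(Z)]\<close> for an operator \<open>A\<close> of parity \<open>s\<close> and a series \<open>a(Z)\<close> of parity \<open>p\<close>; moving \<open>A\<close> to the right
  of \<open>\<theta>^I\<close> gives the sign in the first term.\<close>

definition op_supercomm ::
    "(complex \<Rightarrow> 'v::ab_group_add \<Rightarrow> 'v) \<Rightarrow> bit \<Rightarrow> bit \<Rightarrow> ('v \<Rightarrow> 'v)
      \<Rightarrow> ('n::{finite,linorder}, 'v \<Rightarrow> 'v) ser1 \<Rightarrow> ('n, 'v \<Rightarrow> 'v) ser1" where
  "op_supercomm scale s p A a = (\<lambda>n I v.
     scale (koszul (s * par I)) (A (a n I v)) - scale (koszul (s * p)) (a n I (A v)))"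

text \<open>The product \<open>a(Z) b(Z)\<close> in one variable, \<open>a(Z)\<close> being of parity \<open>p\<close>: the coefficient of \<open>z^m \<theta>^I'\<close> in
  \<open>a(Z)\<close> has parity \<open>p + #I'\<close> and moves past \<open>\<theta>^(I - I')\<close>. The product is defined when
  the sums over \<open>m\<close> are finite on every vector; \<^const>\<open>Sum_any\<close> is the sum over the support.\<close>

definition prod_ZZ ::
    "(complex \<Rightarrow> 'v::ab_group_add \<Rightarrow> 'v) \<Rightarrow> bit \<Rightarrow> ('n::{finite,linorder}, 'v \<Rightarrow> 'v) ser1
      \<Rightarrow> ('n, 'v \<Rightarrow> 'v) ser1 \<Rightarrow> ('n, 'v \<Rightarrow> 'v) ser1" where
  "prod_ZZ scale p a b = (\<lambda>n I v. \<Sum>I'\<in>Pow I.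
     scale (koszul ((p + par I') * par (I - I')) * shuffle_sign I' (I - I'))
       (Sum_any (\<lambda>m. a m I' (b (n - m) (I - I') v))))"

definition ser_plus :: "('n, 'v \<Rightarrow> 'v::ab_group_add) ser1 \<Rightarrow> ('n, 'v \<Rightarrow> 'v) ser1" where
  "ser_plus a = (\<lambda>n I v. if 0 \<le> n then a n I v else 0)"

definition ser_minus :: "('n, 'v \<Rightarrow> 'v::ab_group_add) ser1 \<Rightarrow> ('n, 'v \<Rightarrow> 'v) ser1" where
  "ser_minus a = (\<lambda>n I v. a n I v - ser_plus a n I v)"

text \<open>\<open>:a(Z) b(Z):\<close> for series of parities \<open>p\<close> and \<open>q\<close>.\<close>

definition normal_ordered ::
    "(complex \<Rightarrow> 'v::ab_group_add \<Rightarrow> 'v) \<Rightarrow> bit \<Rightarrow> bit \<Rightarrow> ('n::{finite,linorder}, 'v \<Rightarrow> 'v) ser1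
      \<Rightarrow> ('n, 'v \<Rightarrow> 'v) ser1 \<Rightarrow> ('n, 'v \<Rightarrow> 'v) ser1" where
  "normal_ordered scale p q a b = (\<lambda>n I v.
     prod_ZZ scale p (ser_plus a) b n I v
     + scale (koszul (p * q)) (prod_ZZ scale q b (ser_minus a) n I v))"

section \<open>Scalar series in two variables\<close>

text \<open>The product of a scalar series \<open>f\<close> and a vector-valued series \<open>X\<close>, via
  \<open>\<theta>^I' \<zeta>^K' \<theta>^I'' \<zeta>^K'' = (-1)^(#K' #I'') \<theta>^I' \<theta>^I'' \<zeta>^K' \<zeta>^K''\<close>; defined when the sums over the
  exponents \<open>(m', n')\<close> of \<open>z\<close> and \<open>w\<close> are finite.\<close>

definition mult2 ::
    "(complex \<Rightarrow> 'v::ab_group_add \<Rightarrow> 'v) \<Rightarrow> ('n::{finite,linorder}, complex) ser2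
      \<Rightarrow> ('n, 'v) ser2 \<Rightarrow> ('n, 'v) ser2" where
  "mult2 scale f X = (\<lambda>m I n K. \<Sum>I'\<in>Pow I. \<Sum>K'\<in>Pow K.
     scale (koszul (par K' * par (I - I')) * shuffle_sign I' (I - I') * shuffle_sign K' (K - K'))
       (Sum_any (\<lambda>(m', n'). scale (f m' I' n' K') (X (m - m') (I - I') (n - n') (K - K')))))"

abbreviation smult2 ::
    "('n::{finite,linorder}, complex) ser2 \<Rightarrow> ('n, complex) ser2 \<Rightarrow> ('n, complex) ser2" where
  "smult2 \<equiv> mult2 (*)"

definition one2 :: "('n, complex) ser2" where
  "one2 = (\<lambda>m I n K. if m = 0 \<and> I = {} \<and> n = 0 \<and> K = {} then 1 else 0)"

definition theta :: "'n \<Rightarrow> ('n, complex) ser2" where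
  "theta i = (\<lambda>m I n K. if m = 0 \<and> I = {i} \<and> n = 0 \<and> K = {} then 1 else 0)"

definition zeta :: "'n \<Rightarrow> ('n, complex) ser2" where
  "zeta i = (\<lambda>m I n K. if m = 0 \<and> I = {} \<and> n = 0 \<and> K = {i} then 1 else 0)"

definition diff_odd :: "'n \<Rightarrow> ('n, complex) ser2" where
  "diff_odd i = (\<lambda>m I n K. theta i m I n K - zeta i m I n K)"

text \<open>The product of the \<open>\<theta>^i - \<zeta>^i\<close> over \<open>i \<in> J\<close>, in increasing order.\<close>

definition diff_odd_prod :: "'n::{finite,linorder} set \<Rightarrow> ('n, complex) ser2" where
  "diff_odd_prod J = foldr (\<lambda>i f. smult2 (diff_odd i) f) (sorted_list_of_set J) one2"

text \<open>The sum of the \<open>\<theta>^i \<zeta>^i\<close> over all \<open>i\<close>.\<close>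

definition theta_zeta :: "('n::{finite,linorder}, complex) ser2" where
  "theta_zeta = (\<lambda>m I n K. \<Sum>i\<in>UNIV. smult2 (theta i) (zeta i) m I n K)"

text \<open>The expansions of \<open>(z - w)^e\<close>, \<open>e \<in> \<int>\<close>, in \<open>|z| > |w|\<close> and in \<open>|w| > |z|\<close>: the sums over \<open>l \<ge> 0\<close> of
  \<open>(e gchoose l) z^(e-l) (-w)^l\<close> and of \<open>(e gchoose l) z^l (-w)^(e-l)\<close>.\<close>

definition exp_zw :: "int \<Rightarrow> ('n, complex) ser2" where
  "exp_zw e = (\<lambda>m I n K.
     if I = {} \<and> K = {} \<and> m + n = e \<and> 0 \<le> n then (of_int e gchoose nat n) * (- 1) powi n else 0)"

definition exp_wz :: "int \<Rightarrow> ('n, complex) ser2" where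
  "exp_wz e = (\<lambda>m I n K.
     if I = {} \<and> K = {} \<and> m + n = e \<and> 0 \<le> m then (of_int e gchoose nat m) * (- 1) powi n else 0)"

text \<open>\<open>(Z - W)^(j|J)\<close>, where \<open>ex\<close> (one of \<^const>\<open>exp_zw\<close>, \<^const>\<open>exp_wz\<close>) expands the powers of \<open>z - w\<close>.
  The first factor is the binomial expansion of \<open>(z - w - x)^j\<close> in powers of \<open>x\<close>, the sum of the
  \<open>\<theta>^i \<zeta>^i\<close>; it stops at \<open>k = N\<close> because \<open>x^(N+1) = 0\<close>.\<close>

definition ZW_power ::
    "(int \<Rightarrow> ('n::{finite,linorder}, complex) ser2) \<Rightarrow> int \<Rightarrow> 'n set \<Rightarrow> ('n, complex) ser2" where
  "ZW_power ex j J = smult2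
     (\<lambda>m I n K. \<Sum>k\<le>card (UNIV :: 'n set). (of_int j gchoose k) * (- 1) ^ k
        * smult2 (ex (j - int k)) ((smult2 theta_zeta ^^ k) one2) m I n K)
     (diff_odd_prod J)"

definition delta :: "('n::{finite,linorder}, complex) ser2" where
  "delta = smult2 (\<lambda>m I n K. exp_zw (- 1) m I n K - exp_wz (- 1) m I n K) (diff_odd_prod UNIV)"

definition d_w :: "('n, complex) ser2 \<Rightarrow> ('n, complex) ser2" where
  "d_w f = (\<lambda>m I n K. of_int (n + 1) * f m I (n + 1) K)"

text \<open>\<open>\<partial>/\<partial>\<zeta>^i\<close> and \<open>\<zeta>^i\<close> act from the left, so they first move past \<open>\<theta>^I\<close>.\<close>

definition d_zeta :: "'n::{finite,linorder} \<Rightarrow> ('n, complex) ser2 \<Rightarrow> ('n, complex) ser2" where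
  "d_zeta i f = (\<lambda>m I n K.
     if i \<in> K then 0 else (- 1) ^ card I * shuffle_sign {i} K * f m I n (insert i K))"

definition D_W :: "'n::{finite,linorder} \<Rightarrow> ('n, complex) ser2 \<Rightarrow> ('n, complex) ser2" where
  "D_W i f = (\<lambda>m I n K. d_zeta i f m I n K + smult2 (zeta i) (d_w f) m I n K)"

definition D_W_div ::
    "nat \<Rightarrow> 'n::{finite,linorder} set \<Rightarrow> ('n, complex) ser2 \<Rightarrow> ('n, complex) ser2" where
  "D_W_div j J f = (\<lambda>m I n K. (- 1) ^ (card J * (card J + 1) div 2) / fact j
     * (d_w ^^ j) (foldr D_W (sorted_list_of_set J) f) m I n K)"

section \<open>Operator-valued series in two variables\<close>

definition op_mult2 ::
    "(complex \<Rightarrow> 'v::ab_group_add \<Rightarrow> 'v) \<Rightarrow> ('n::{finite,linorder}, complex) ser2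
      \<Rightarrow> ('n, 'v \<Rightarrow> 'v) ser2 \<Rightarrow> ('n, 'v \<Rightarrow> 'v) ser2" where
  "op_mult2 scale f A = (\<lambda>m I n K v. mult2 scale f (\<lambda>m I n K. A m I n K v) m I n K)"

text \<open>\<open>c(W)\<close> as a series in \<open>Z\<close> and \<open>W\<close>.\<close>

definition in_W :: "('n, 'v \<Rightarrow> 'v::ab_group_add) ser1 \<Rightarrow> ('n, 'v \<Rightarrow> 'v) ser2" where
  "in_W c = (\<lambda>m I n K v. if m = 0 \<and> I = {} then c n K v else 0)"

text \<open>\<open>a(Z) b(W)\<close> for \<open>a\<close> of parity \<open>p\<close>: the coefficient of \<open>\<theta>^I\<close> moves past \<open>\<zeta>^K\<close>.\<close>

definition prod_ZW ::
    "(complex \<Rightarrow> 'v::ab_group_add \<Rightarrow> 'v) \<Rightarrow> bit \<Rightarrow> ('n::{finite,linorder}, 'v \<Rightarrow> 'v) ser1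
      \<Rightarrow> ('n, 'v \<Rightarrow> 'v) ser1 \<Rightarrow> ('n, 'v \<Rightarrow> 'v) ser2" where
  "prod_ZW scale p a b = (\<lambda>m I n K v.
     scale (koszul ((p + par I) * par K)) (a m I (b n K v)))"

text \<open>\<open>b(W) a(Z)\<close> for \<open>b\<close> of parity \<open>q\<close>: the coefficient of \<open>\<zeta>^K\<close> moves past \<open>\<theta>^I\<close>, and \<open>\<zeta>^K \<theta>^I\<close> is
  brought to the order \<open>\<theta>^I \<zeta>^K\<close>.\<close>

definition prod_WZ ::
    "(complex \<Rightarrow> 'v::ab_group_add \<Rightarrow> 'v) \<Rightarrow> bit \<Rightarrow> ('n::{finite,linorder}, 'v \<Rightarrow> 'v) ser1
      \<Rightarrow> ('n, 'v \<Rightarrow> 'v) ser1 \<Rightarrow> ('n, 'v \<Rightarrow> 'v) ser2" where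
  "prod_WZ scale q b a = (\<lambda>m I n K v.
     scale (koszul ((q + par K) * par I + par K * par I)) (b n K (a m I v)))"

text \<open>\<open>[a(Z), b(W)]\<close> for series of parities \<open>p\<close> and \<open>q\<close>.\<close>

definition supercomm ::
    "(complex \<Rightarrow> 'v::ab_group_add \<Rightarrow> 'v) \<Rightarrow> bit \<Rightarrow> bit \<Rightarrow> ('n::{finite,linorder}, 'v \<Rightarrow> 'v) ser1
      \<Rightarrow> ('n, 'v \<Rightarrow> 'v) ser1 \<Rightarrow> ('n, 'v \<Rightarrow> 'v) ser2" where
  "supercomm scale p q a b = (\<lambda>m I n K v.
     prod_ZW scale p a b m I n K v - scale (koszul (p * q)) (prod_WZ scale q b a m I n K v))"

definition res_Z :: "('n, 'v \<Rightarrow> 'v) ser2 \<Rightarrow> ('n, 'v \<Rightarrow> 'v) ser1" where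
  "res_Z A = (\<lambda>n K v. A (- 1) UNIV n K v)"

text \<open>The \<open>(j|J)\<close>-product of series of parities \<open>p\<close> and \<open>q\<close>.\<close>

definition nth_product ::
    "(complex \<Rightarrow> 'v::ab_group_add \<Rightarrow> 'v) \<Rightarrow> bit \<Rightarrow> bit \<Rightarrow> int \<Rightarrow> 'n::{finite,linorder} set
      \<Rightarrow> ('n, 'v \<Rightarrow> 'v) ser1 \<Rightarrow> ('n, 'v \<Rightarrow> 'v) ser1 \<Rightarrow> ('n, 'v \<Rightarrow> 'v) ser1" where
  "nth_product scale p q j J a b = res_Z (\<lambda>m I n K v.
     op_mult2 scale (ZW_power exp_zw j J) (prod_ZW scale p a b) m I n K v
     - scale (koszul (p * q))
         (op_mult2 scale (ZW_power exp_wz j J) (prod_WZ scale q b a) m I n K v))"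

section \<open>SUSY vertex algebras\<close>

text \<open>\<open>a_(j|J)\<close> is the coefficient of \<open>Z^(-1-j | N - J)\<close> in \<open>Y(a, Z)\<close>.\<close>

definition fmode ::
    "('v \<Rightarrow> ('n, 'v \<Rightarrow> 'v) ser1) \<Rightarrow> 'v \<Rightarrow> int \<Rightarrow> 'n set \<Rightarrow> 'v \<Rightarrow> 'v" where
  "fmode Y a j J = Y a (- 1 - j) (- J)"

text \<open>The axioms that involve supercommutators are stated for homogeneous elements and extend to all
  elements by linearity. In \<open>locality\<close>, \<open>exp_zw (int n)\<close> is the polynomial \<open>(z - w)^n\<close>.\<close>

locale susy_vertex_algebra = vector_superspace scale V
  for scale :: "complex \<Rightarrow> 'v::ab_group_add \<Rightarrow> 'v"
    and V :: "bit \<Rightarrow> 'v set" +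
  fixes vac :: 'v
    and S :: "'n::{finite,linorder} \<Rightarrow> 'v \<Rightarrow> 'v"
    and Y :: "'v \<Rightarrow> ('n, 'v \<Rightarrow> 'v) ser1"
  assumes vac_even: "vac \<in> V 0"
    and S_linear: "Vector_Spaces.linear scale scale (S i)"
    and S_odd: "has_parity V 1 (S i)"
    and Y_linear: "Vector_Spaces.linear scale scale (\<lambda>a. Y a n I v)"
    and Y_field: "is_superfield scale (Y a)"
    and Y_parity: "a \<in> V p \<Longrightarrow> ser_has_parity V p (Y a)"
    and vac_regular: "n < 0 \<Longrightarrow> Y a n I vac = 0"
    and vac_value: "Y a 0 {} vac = a"
    and S_vac: "S i vac = 0"
    and translation: "a \<in> V p \<Longrightarrow> op_supercomm scale 1 p (S i) (Y a) = Dbar_Z scale i (Y a)"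
    and locality: "a \<in> V p \<Longrightarrow> b \<in> V q \<Longrightarrow>
      \<exists>n::nat. op_mult2 scale (exp_zw (int n)) (supercomm scale p q (Y a) (Y b))
        = (\<lambda>_ _ _ _ _. 0)"

end

theory Submission
  imports Defs "HOL-Library.Function_Algebras"
begin

text \<open>
  A field that is local with all the \<open>Y(c, Z)\<close> and kills the vacuum is zero, and a vector-valued series
  \<open>u(Z)\<close> with \<open>S^i u = Dbar^i u\<close> and regular at \<open>z = 0\<close> is determined by \<open>u(0)\<close>. Each side of (1) and (3)
  is local with all the \<open>Y(c, Z)\<close> and, applied to the vacuum, satisfies this equation; so it suffices to compare
  the values at \<open>Z = 0\<close>. For locality the fields are split into their components in the odd variables: a
  \<open>(j|J)\<close>-product is a linear combination of ordinary \<open>n\<close>-th products of components, to which Dong's lemma applies.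
  Covariance of the \<open>(j|J)\<close>-products holds because \<open>Dbar_Z + Dbar_W\<close> annihilates \<open>(Z - W)^(j|J)\<close>. Identity (2)
  is (1) for \<open>(-1|N)\<close>.

  For (4), \<open>D_W^(k|L) \<delta>\<close> is \<open>\<sigma>(L)\<close> times the difference of the two expansions of \<open>(Z - W)^(-1-k|N-L)\<close>. Hence by (1)
  the difference of the two sides of (4), multiplied by any \<open>(Z - W)^(j|J)\<close> with \<open>j \<ge> 0\<close>, has no residue.
  The \<open>(Z - W)^(j|J)\<close> generate all polynomials in \<open>z - w\<close> and \<open>\<theta>\<close> over those in \<open>\<zeta>\<close>, so the components of
  this difference have no residues either, and as they are killed by a power of \<open>z - w\<close> they vanish.
\<close>

section \<open>Signs\<close>

text \<open>Products of two-sided series are only partially defined and not associative, and this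
  shapes the development. The factors of (Z - W)^(j|J) and the derivatives are made into operators
  on a single series, and identities between products become commutation relations between
  operators. The Grassmann operators involve finite sums only and act on every series; the powers of
  z - w need summability, so the calculus takes the whole family (z - w)^e X, indexed by e, as its
  input. The expansion in |z| > |w|, the one in |w| > |z| and their difference obey the same three
  recursions, so each fact about powers is proved once for all three. Dong's lemma is proved for
  series in one even variable, with a constant sign in place of the Koszul sign. It is applied to
  components in the odd variables, because each of them has a definite parity; the price is a parity
  count showing that all terms of a (j|J)-product carry the same sign with respect to a third
  field.\<close>

lemma koszul_0 [simp]: "koszul 0 = 1" and koszul_1 [simp]: "koszul 1 = - 1"
  by (simp_all add: koszul_def)

lemma koszul_add: "koszul (p + q) = koszul p * koszul q"
  by (cases p; cases q) (simp_all add: koszul_def)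

lemma koszul_mult_self [simp]: "koszul p * koszul p = 1" "koszul p * (koszul p * c) = c"
  by (simp_all add: koszul_def)

lemma koszul_of_nat: "koszul (of_nat n) = (- 1) ^ n"
  proof (induction n)
  case (Suc n)
  then show ?case
    by (simp only: of_nat_Suc koszul_add koszul_1 power_Suc)
qed simp

lemma koszul_eq_iff: "koszul p = koszul q \<longleftrightarrow> p = q"
  by (cases p; cases q) (simp_all add: koszul_def)

lemma par_sub: "I' \<subseteq> I \<Longrightarrow> par (I :: 'n::finite set) = par I' + par (I - I')"
  by (metis card_Un_disjoint Diff_disjoint Un_Diff_cancel finite of_nat_add sup.absorb2)

definition set_sign :: "'n set \<Rightarrow> complex" where
  "set_sign I = (- 1) ^ card I"

text \<open>The sign of moving \<theta>^i from the front of \<theta>^I to its place. Counting only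
  strictly smaller indices lets one formula serve both multiplication by \<theta>^i, where i lies in
  the resulting set, and \<partial>/\<partial>\<theta>^i.\<close>

definition pos_sign :: "'n::{finite,linorder} \<Rightarrow> 'n set \<Rightarrow> complex" where
  "pos_sign i I = (- 1) ^ card {j \<in> I. j < i}"

lemma koszul_par: "koszul (par I) = set_sign I"
  by (simp add: koszul_of_nat set_sign_def)

lemma set_sign_empty [simp]: "set_sign {} = 1"
  by (simp add: set_sign_def)

lemma set_sign_insert [simp]:
  "set_sign (insert i (I::'n::finite set)) = (if i \<in> I then set_sign I else - set_sign I)"
  by (simp add: set_sign_def insert_absorb)

lemma set_sign_remove [simp]:
  "set_sign ((I::'n::finite set) - {i}) = (if i \<in> I then - set_sign I else set_sign I)"
  using set_sign_insert[of i "I - {i}"] by (auto simp: insert_absorb)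

lemma set_sign_mult_self [simp]: "set_sign I * set_sign I = 1" "set_sign I * (set_sign I * c) = c"
  by (simp_all add: set_sign_def flip: power_add mult.assoc)

lemma set_sign_ne_0 [simp]: "set_sign I \<noteq> 0"
  by (simp add: set_sign_def)

lemma pos_sign_empty [simp]: "pos_sign i {} = 1"
  by (simp add: pos_sign_def)

lemma pos_sign_insert [simp]:
  "pos_sign i (insert j I) = (if j < i \<and> j \<notin> I then - pos_sign i I else pos_sign i I)"
proof -
  have "{k \<in> insert j I. k < i} = (if j < i then insert j {k \<in> I. k < i} else {k \<in> I. k < i})"
    by auto
  then show ?thesis
    by (auto simp: pos_sign_def insert_absorb)
qed

lemma pos_sign_remove [simp]:
  "pos_sign i (I - {j}) = (if j < i \<and> j \<in> I then - pos_sign i I else pos_sign i I)"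
  using pos_sign_insert[of i j "I - {j}"] by (auto simp: insert_absorb)

lemma pos_sign_mult_self [simp]: "pos_sign i I * pos_sign i I = 1" "pos_sign i I * (pos_sign i I * c) = c"
  by (simp_all add: pos_sign_def flip: power_add mult.assoc)

lemma shuffle_sign_empty [simp]: "shuffle_sign {} J = 1" "shuffle_sign I {} = 1"
  by (simp_all add: shuffle_sign_def)

lemma shuffle_sign_Un_left:
  assumes "I \<inter> I' = {}"
  shows "shuffle_sign (I \<union> I') J = shuffle_sign I J * shuffle_sign I' J"
proof -
  have "{(i, j). i \<in> I \<union> I' \<and> j \<in> J \<and> j < i} =
      {(i, j). i \<in> I \<and> j \<in> J \<and> j < i} \<union> {(i, j). i \<in> I' \<and> j \<in> J \<and> j < i}"
    by auto
  then show ?thesis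
    using assms by (subst shuffle_sign_def) (auto simp: shuffle_sign_def card_Un_disjoint power_add disjoint_iff)
qed

lemma shuffle_sign_Un_right:
  assumes "J \<inter> J' = {}"
  shows "shuffle_sign I (J \<union> J') = shuffle_sign I J * shuffle_sign I J'"
proof -
  have "{(i, j). i \<in> I \<and> j \<in> J \<union> J' \<and> j < i} =
      {(i, j). i \<in> I \<and> j \<in> J \<and> j < i} \<union> {(i, j). i \<in> I \<and> j \<in> J' \<and> j < i}"
    by auto
  then show ?thesis
    using assms by (subst shuffle_sign_def) (auto simp: shuffle_sign_def card_Un_disjoint power_add disjoint_iff)
qed

lemma shuffle_sign_singleton_left: "shuffle_sign {i} I = pos_sign i I"
proof -
  have "card {(k, j). k \<in> {i} \<and> j \<in> I \<and> j < k} = card {j \<in> I. j < i}"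
    by (rule bij_betw_same_card[of snd]) (auto simp: bij_betw_def inj_on_def image_iff)
  then show ?thesis
    by (simp only: shuffle_sign_def pos_sign_def)
qed

lemma shuffle_sign_insert_left:
  "i \<notin> I \<Longrightarrow> shuffle_sign (insert i I) J = pos_sign i J * shuffle_sign I J"
  using shuffle_sign_Un_left[of "{i}" I J] by (simp add: shuffle_sign_singleton_left)

text \<open>The inversions of (I, J) and, read backwards, those of (J, I) partition I \<times>
  J.\<close>

lemma shuffle_sign_commute:
  fixes I J :: "'n::{finite,linorder} set"
  assumes "I \<inter> J = {}"
  shows "shuffle_sign I J * shuffle_sign J I = koszul (par I * par J)"
proof -
  let ?A = "{(i, j). i \<in> I \<and> j \<in> J \<and> j < i}" and ?B = "{(i, j). i \<in> I \<and> j \<in> J \<and> i < j}"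
  have B: "card {(i, j). i \<in> J \<and> j \<in> I \<and> j < i} = card ?B"
    by (rule bij_betw_same_card[of "\<lambda>(i, j). (j, i)"]) (auto simp: bij_betw_def inj_on_def)
  have "card ?A + card ?B = card (?A \<union> ?B)"
    by (rule card_Un_disjoint[symmetric]) auto
  also have "?A \<union> ?B = I \<times> J"
    using assms by auto
  finally have "card ?A + card ?B = card I * card J"
    by (simp only: card_cartesian_product)
  then show ?thesis
    by (simp only: shuffle_sign_def B koszul_of_nat flip: power_add of_nat_mult)
qed

lemma shuffle_sign_mult_self [simp]:
  "shuffle_sign I J * shuffle_sign I J = 1" "shuffle_sign I J * (shuffle_sign I J * c) = c"
  by (simp_all add: shuffle_sign_def flip: power_add mult.assoc)

lemma shuffle_sign_less:
  assumes "\<And>i j. i \<in> I \<Longrightarrow> j \<in> J \<Longrightarrow> i < j"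
  shows "shuffle_sign I J = 1"
proof -
  have "{(i, j). i \<in> I \<and> j \<in> J \<and> j < i} = {}"
    using assms by (auto dest: less_asym)
  then show ?thesis
    by (simp only: shuffle_sign_def card.empty power_0)
qed

lemma pos_sign_less: "(\<And>j. j \<in> J \<Longrightarrow> i < j) \<Longrightarrow> pos_sign i J = 1"
  using shuffle_sign_less[of "{i}" J] by (simp add: shuffle_sign_singleton_left)

section \<open>Operators on series in two variables\<close>

text \<open>Goals produced by \<open>induction\<close> are eta-expanded, so pointwise rules would unfold every equation between
  series.\<close>

declare plus_fun_apply [simp del] zero_fun_apply [simp del] minus_apply [simp del] uminus_apply [simp del]

lemmas pointwise = fun_eq_iff plus_fun_apply zero_fun_apply minus_apply uminus_apply

lemma sum_fun_apply: "sum f A x = (\<Sum>a\<in>A. f a x)"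
  by (induction A rule: infinite_finite_induct) (auto simp: pointwise)

lemma finite_min_induct [case_names empty insert]:
  fixes J :: "'n::{finite,linorder} set"
  assumes "P {}" "\<And>i J. (\<And>j. j \<in> J \<Longrightarrow> i < j) \<Longrightarrow> P J \<Longrightarrow> P (insert i J)"
  shows "P J"
  by (rule finite_linorder_min_induct[of J P]) (use assms in auto)

lemma sorted_list_of_set_insert_min:
  fixes J :: "'n::{finite,linorder} set"
  assumes "\<And>j. j \<in> J \<Longrightarrow> i < j"
  shows "sorted_list_of_set (insert i J) = i # sorted_list_of_set J"
proof -
  have "i \<notin> J"
    using assms by blast
  then show ?thesis
    using assms by (simp add: sorted_list_of_set_insert insort_is_Cons less_imp_le)
qed

locale complex_vector_space = vector_space scale
  for scale :: "complex \<Rightarrow> 'v::ab_group_add \<Rightarrow> 'v"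
begin

definition sc :: "complex \<Rightarrow> ('n, 'v) ser2 \<Rightarrow> ('n, 'v) ser2" where
  "sc c X = (\<lambda>m I n K. scale c (X m I n K))"

lemma sc_apply: "sc c X m I n K = scale c (X m I n K)"
  by (simp add: sc_def)

lemma sc_simps [simp]: "sc c 0 = 0" "sc 0 X = 0" "sc 1 X = X" "sc (- 1) X = - X"
  "sc c (sc d X) = sc (c * d) X"
  by (simp_all add: pointwise sc_apply)

lemma sc_add: "sc c (X + Y) = sc c X + sc c Y" "sc (c + d) X = sc c X + sc d X"
  and sc_minus: "sc c (- X) = - sc c X" "sc (- c) X = - sc c X"
  and sc_diff: "sc c (X - Y) = sc c X - sc c Y" "sc (c - d) X = sc c X - sc d X"
  by (simp_all add: pointwise sc_apply scale_right_distrib scale_left_distrib scale_right_diff_distrib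
      scale_left_diff_distrib)

lemma sc_sum: "sc c (sum f A) = (\<Sum>a\<in>A. sc c (f a))"
  by (induction A rule: infinite_finite_induct) (auto simp: sc_add)

definition lin :: "(('n, 'v) ser2 \<Rightarrow> ('n, 'v) ser2) \<Rightarrow> bool" where
  "lin T \<longleftrightarrow> (\<forall>X Y. T (X + Y) = T X + T Y) \<and> (\<forall>c X. T (sc c X) = sc c (T X))"

lemma linD: assumes "lin T" shows "T (X + Y) = T X + T Y" "T (sc c X) = sc c (T X)"
  "T 0 = 0" "T (- X) = - T X" "T (X - Y) = T X - T Y"
proof -
  show add: "T (X + Y) = T X + T Y" for X Y
    using assms by (auto simp: lin_def)
  show sc: "T (sc c X) = sc c (T X)" for c X
    using assms by (auto simp: lin_def)
  show "T 0 = 0"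
    using sc[of 0 0] by simp
  show minus: "T (- X) = - T X" for X
    using sc[of "- 1" X] by simp
  show "T (X - Y) = T X - T Y"
    using add[of X "- Y"] by (simp add: minus)
qed

lemma lin_sum: assumes "lin T" shows "T (sum f A) = (\<Sum>a\<in>A. T (f a))"
  by (induction A rule: infinite_finite_induct) (auto simp: linD[OF assms])

text \<open>\<open>L\<theta> i\<close>, \<open>L\<zeta> i\<close>, \<open>Lzw\<close>, \<open>H i\<close>, \<open>Q\<close> and \<open>HJ J\<close> are the left multiplications by \<open>\<theta>^i\<close>, \<open>\<zeta>^i\<close>, \<open>z - w\<close>,
  \<open>\<theta>^i - \<zeta>^i\<close>, \<open>\<Sum> \<theta>^i \<zeta>^i\<close> and \<open>(Z - W)^(0|J)\<close>.\<close>

definition L\<theta> :: "'n::{finite,linorder} \<Rightarrow> ('n, 'v) ser2 \<Rightarrow> ('n, 'v) ser2" where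
  "L\<theta> i X = (\<lambda>m I n K. if i \<in> I then scale (pos_sign i I) (X m (I - {i}) n K) else 0)"

definition L\<zeta> :: "'n::{finite,linorder} \<Rightarrow> ('n, 'v) ser2 \<Rightarrow> ('n, 'v) ser2" where
  "L\<zeta> i X = (\<lambda>m I n K. if i \<in> K then scale (set_sign I * pos_sign i K) (X m I n (K - {i})) else 0)"

definition D\<theta> :: "'n::{finite,linorder} \<Rightarrow> ('n, 'v) ser2 \<Rightarrow> ('n, 'v) ser2" where
  "D\<theta> i X = (\<lambda>m I n K. if i \<in> I then 0 else scale (pos_sign i I) (X m (insert i I) n K))"

definition D\<zeta> :: "'n::{finite,linorder} \<Rightarrow> ('n, 'v) ser2 \<Rightarrow> ('n, 'v) ser2" where
  "D\<zeta> i X = (\<lambda>m I n K. if i \<in> K then 0 else scale (set_sign I * pos_sign i K) (X m I n (insert i K)))"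

definition Dz :: "('n, 'v) ser2 \<Rightarrow> ('n, 'v) ser2" where
  "Dz X = (\<lambda>m I n K. scale (of_int (m + 1)) (X (m + 1) I n K))"

definition Dw :: "('n, 'v) ser2 \<Rightarrow> ('n, 'v) ser2" where
  "Dw X = (\<lambda>m I n K. scale (of_int (n + 1)) (X m I (n + 1) K))"

definition Lzw :: "('n, 'v) ser2 \<Rightarrow> ('n, 'v) ser2" where
  "Lzw X = (\<lambda>m I n K. X (m - 1) I n K - X m I (n - 1) K)"

definition H :: "'n::{finite,linorder} \<Rightarrow> ('n, 'v) ser2 \<Rightarrow> ('n, 'v) ser2" where
  "H i X = L\<theta> i X - L\<zeta> i X"

definition Q :: "('n::{finite,linorder}, 'v) ser2 \<Rightarrow> ('n, 'v) ser2" where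
  "Q X = (\<Sum>i\<in>UNIV. L\<theta> i (L\<zeta> i X))"

definition HJ :: "'n::{finite,linorder} set \<Rightarrow> ('n, 'v) ser2 \<Rightarrow> ('n, 'v) ser2" where
  "HJ J X = foldr H (sorted_list_of_set J) X"

lemma lin_L\<theta> [simp]: "lin (L\<theta> i)" and lin_L\<zeta> [simp]: "lin (L\<zeta> i)"
  and lin_D\<theta> [simp]: "lin (D\<theta> i)" and lin_D\<zeta> [simp]: "lin (D\<zeta> i)"
  and lin_Dz [simp]: "lin Dz" and lin_Dw [simp]: "lin Dw" and lin_Lzw [simp]: "lin Lzw"
  by (auto simp: lin_def pointwise sc_apply L\<theta>_def L\<zeta>_def D\<theta>_def D\<zeta>_def Dz_def Dw_def Lzw_def
      scale_right_distrib scale_right_diff_distrib scale_left_commute)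

lemma lin_comp: "lin T \<Longrightarrow> lin U \<Longrightarrow> lin (\<lambda>X. T (U X))"
  and lin_plus: "lin T \<Longrightarrow> lin U \<Longrightarrow> lin (\<lambda>X. T X + U X)"
  and lin_minus: "lin T \<Longrightarrow> lin U \<Longrightarrow> lin (\<lambda>X. T X - U X)"
  by (auto simp: lin_def sc_add sc_diff)

lemma lin_setsum: "(\<And>a. a \<in> A \<Longrightarrow> lin (T a)) \<Longrightarrow> lin (\<lambda>X. \<Sum>a\<in>A. T a X)"
  by (auto simp: lin_def sc_sum sum.distrib)

lemma lin_H [simp]: "lin (H i)"
  unfolding H_def[abs_def] by (rule lin_minus) simp_all

lemma lin_Q [simp]: "lin Q"
  unfolding Q_def[abs_def] by (rule lin_setsum, rule lin_comp) simp_all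

lemma lin_funpow: "lin T \<Longrightarrow> lin (T ^^ k)"
  by (induction k) (auto simp: lin_def)

lemma lin_foldr: "(\<And>a. lin (T a)) \<Longrightarrow> lin (foldr T xs)"
  by (induction xs) (auto simp: lin_def)

lemma lin_HJ [simp]: "lin (HJ J)"
  unfolding HJ_def[abs_def] by (rule lin_foldr) simp

lemmas lin_simps [simp] = linD[OF lin_L\<theta>] linD[OF lin_L\<zeta>] linD[OF lin_D\<theta>] linD[OF lin_D\<zeta>]
  linD[OF lin_Dz] linD[OF lin_Dw] linD[OF lin_Lzw] linD[OF lin_H] linD[OF lin_Q] linD[OF lin_HJ]

section \<open>Anticommutation relations of the odd multiplications and derivatives\<close>

lemma L\<theta>_L\<theta>: "L\<theta> i (L\<theta> j X) = - L\<theta> j (L\<theta> i X)"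
  by (auto simp: pointwise sc_apply L\<theta>_def Diff_insert2[symmetric] insert_commute)

lemma L\<zeta>_L\<zeta>: "L\<zeta> i (L\<zeta> j X) = - L\<zeta> j (L\<zeta> i X)"
  by (auto simp: pointwise sc_apply L\<zeta>_def Diff_insert2[symmetric] insert_commute)

lemma L\<theta>_L\<zeta>: "L\<zeta> i (L\<theta> j X) = - L\<theta> j (L\<zeta> i X)"
  by (auto simp: pointwise sc_apply L\<theta>_def L\<zeta>_def mult.commute)

lemma D\<theta>_L\<theta>: "D\<theta> i (L\<theta> j X) = (if i = j then X else 0) - L\<theta> j (D\<theta> i X)"
  by (auto simp: pointwise sc_apply L\<theta>_def D\<theta>_def insert_Diff_if insert_absorb mult.commute)

lemma D\<zeta>_L\<zeta>: "D\<zeta> i (L\<zeta> j X) = (if i = j then X else 0) - L\<zeta> j (D\<zeta> i X)"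
  by (auto simp: pointwise sc_apply L\<zeta>_def D\<zeta>_def insert_Diff_if insert_absorb mult_ac)

lemma D\<theta>_L\<zeta>: "D\<theta> i (L\<zeta> j X) = - L\<zeta> j (D\<theta> i X)"
  by (auto simp: pointwise sc_apply L\<zeta>_def D\<theta>_def mult_ac)

lemma D\<zeta>_L\<theta>: "D\<zeta> i (L\<theta> j X) = - L\<theta> j (D\<zeta> i X)"
  by (auto simp: pointwise sc_apply L\<theta>_def D\<zeta>_def mult_ac)

lemma D\<zeta>_D\<zeta>: "D\<zeta> i (D\<zeta> j X) = - D\<zeta> j (D\<zeta> i X)"
  by (auto simp: pointwise sc_apply D\<zeta>_def insert_commute mult_ac)

lemma L_square [simp]: "L\<theta> i (L\<theta> i X) = 0" "L\<zeta> i (L\<zeta> i X) = 0"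
  by (auto simp: pointwise sc_apply L\<theta>_def L\<zeta>_def)

lemma H_H: "H i (H j X) = - H j (H i X)"
  by (simp add: H_def L\<theta>_L\<theta>[of i j] L\<zeta>_L\<zeta>[of i j] L\<theta>_L\<zeta>)

lemma H_square [simp]: "H i (H i X) = 0"
  by (simp add: H_def L\<theta>_L\<zeta>)

lemma L\<zeta>_H: "L\<zeta> i (H j X) = - H j (L\<zeta> i X)" and L\<theta>_H: "L\<theta> i (H j X) = - H j (L\<theta> i X)"
  by (simp_all add: H_def L\<theta>_L\<theta>[of i j] L\<zeta>_L\<zeta>[of i j] L\<theta>_L\<zeta>)

lemma Lzw_commutes: "Lzw (L\<theta> i X) = L\<theta> i (Lzw X)" "Lzw (L\<zeta> i X) = L\<zeta> i (Lzw X)"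
  "Lzw (H i X) = H i (Lzw X)"
  by (auto simp: pointwise sc_apply H_def Lzw_def L\<theta>_def L\<zeta>_def scale_right_diff_distrib)

text \<open>Q is quadratic in the odd multiplications, so the two signs cancel.\<close>

lemma Q_comm_aux:
  assumes "lin T" "\<And>i X. T (L\<theta> i X) = - L\<theta> i (T X)" "\<And>i X. T (L\<zeta> i X) = - L\<zeta> i (T X)"
  shows "T (Q X) = Q (T X)"
  by (simp add: Q_def lin_sum[OF assms(1)] assms(2,3) )

lemma Q_L\<theta>: "L\<theta> i (Q X) = Q (L\<theta> i X)"
  by (rule Q_comm_aux) (simp_all add: L\<theta>_L\<theta>[of i] L\<theta>_L\<zeta>)

lemma Q_L\<zeta>: "L\<zeta> i (Q X) = Q (L\<zeta> i X)"
  by (rule Q_comm_aux) (simp_all add: L\<zeta>_L\<zeta>[of i] L\<theta>_L\<zeta>)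

lemma Q_H: "H i (Q X) = Q (H i X)"
  by (rule Q_comm_aux) (simp_all add: L\<theta>_H L\<zeta>_H)

lemma Q_Lzw: "Lzw (Q X) = Q (Lzw X)"
  by (simp add: Q_def lin_sum Lzw_commutes)

section \<open>Ordered products of the \<theta>^i - \<zeta>^i and nilpotency of Q\<close>

lemma HJ_empty [simp]: "HJ {} X = X"
  by (simp add: HJ_def)

lemma HJ_insert_min: "(\<And>j. j \<in> J \<Longrightarrow> i < j) \<Longrightarrow> HJ (insert i J) X = H i (HJ J X)"
  by (simp only: HJ_def sorted_list_of_set_insert_min foldr.simps o_apply)

lemma HJ_commute_even:
  assumes "\<And>i X. T (H i X) = H i (T X)"
  shows "T (HJ J X) = HJ J (T X)"
proof -
  have "T (foldr H xs X) = foldr H xs (T X)" for xs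
    by (induction xs) (simp_all add: assms)
  then show ?thesis
    by (simp add: HJ_def)
qed

lemma HJ_commute_odd:
  fixes J :: "'n::{finite,linorder} set"
  assumes "\<And>i X. T (H i X) = - H i (T X)"
  shows "T (HJ J X) = sc (set_sign J) (HJ J (T X))"
proof (induction J rule: finite_min_induct)
  case (insert i J)
  then have "i \<notin> J" by blast
  have HJ: "HJ (insert i J) X = H i (HJ J X)" for X
    using insert.hyps by (rule HJ_insert_min)
  show ?case
    using \<open>i \<notin> J\<close> unfolding HJ assms insert.IH by (simp add: sc_minus)
qed auto

text \<open>Square zero kills a repeated factor; a new one moves to its place past the smaller
  ones.\<close>

lemma H_HJ:
  fixes J :: "'n::{finite,linorder} set"
  shows "H i (HJ J X) = (if i \<in> J then 0 else sc (pos_sign i J) (HJ (insert i J) X))"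
proof (induction J arbitrary: i rule: finite_min_induct)
  case empty
  show ?case
    using HJ_insert_min[of "{}" i X] by simp
next
  case (insert j J)
  then have j: "j \<notin> J" by blast
  have HJ: "HJ (insert j J) X = H j (HJ J X)"
    using insert.hyps by (rule HJ_insert_min)
  consider "i < j" | "i = j" | "j < i" by (meson linorder_cases)
  then show ?case
  proof cases
    case 1
    then have less: "k \<in> insert j J \<Longrightarrow> i < k" for k
      using insert.hyps by (auto dest: less_trans)
    then have "i \<notin> insert j J"
      by blast
    moreover have "HJ (insert i (insert j J)) X = H i (HJ (insert j J) X)"
      using less by (rule HJ_insert_min)
    moreover have "pos_sign i (insert j J) = 1"
      using less by (rule pos_sign_less)
    ultimately show ?thesis
      by (simp del: pos_sign_insert)
  next
    case 2
    then show ?thesis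
      by (simp add: HJ)
  next
    case 3
    then have *: "HJ (insert i (insert j J)) X = H j (HJ (insert i J) X)"
      unfolding insert_commute[of i j] using insert.hyps by (auto intro: HJ_insert_min)
    have "H i (HJ (insert j J) X) = - H j (H i (HJ J X))"
      unfolding HJ by (rule H_H)
    with 3 j * show ?thesis
      by (auto simp: insert.IH sc_minus)
  qed
qed

lemma HJ_HJ:
  fixes J M :: "'n::{finite,linorder} set"
  shows "HJ J (HJ M X) = (if J \<inter> M = {} then sc (shuffle_sign J M) (HJ (J \<union> M) X) else 0)"
proof (induction J rule: finite_min_induct)
  case (insert i J)
  then have i: "i \<notin> J" by blast
  have HJ: "HJ (insert i J) (HJ M X) = H i (HJ J (HJ M X))"
    using insert.hyps by (rule HJ_insert_min)
  have "pos_sign i J = 1"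
    using insert.hyps by (rule pos_sign_less)
  then have "pos_sign i (J \<union> M) = pos_sign i M" if "J \<inter> M = {}"
    using shuffle_sign_Un_right[OF that, of "{i}"] by (simp add: shuffle_sign_singleton_left)
  then show ?case
    using i unfolding HJ insert.IH by (simp add: H_HJ shuffle_sign_insert_left mult.commute)
qed simp

lemma Q_HJ: "Q (HJ J X) = HJ J (Q X)"
  by (rule HJ_commute_even) (simp add: Q_H)

text \<open>\<theta>^i \<zeta>^i = (\<theta>^i - \<zeta>^i) \<zeta>^i, and \<theta>^i - \<zeta>^i
  already occurs in the full product. Hence (Z - W)^(j|N) has no correction terms beyond (z -
  w)^j.\<close>

lemma Q_HJ_UNIV: "Q (HJ UNIV X) = 0"
proof -
  have "L\<theta> i (L\<zeta> i (HJ UNIV X)) = 0" for i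
  proof -
    have "L\<theta> i (L\<zeta> i (HJ UNIV X)) = H i (L\<zeta> i (HJ UNIV X))"
      by (simp add: H_def)
    also have "\<dots> = - L\<zeta> i (H i (HJ UNIV X))"
      by (simp add: L\<zeta>_H)
    finally show ?thesis
      by (simp add: H_HJ )
  qed
  then show ?thesis
    by (simp add: Q_def)
qed

text \<open>Each factor \<theta>^i \<zeta>^i uses up one \<theta> and one \<zeta>, so Q^k reaches
  only coefficients with at least k of either kind.\<close>

lemma Q_power_support:
  fixes X :: "('n::{finite,linorder}, 'v) ser2"
  shows "card I < k \<or> card K < k \<Longrightarrow> (Q ^^ k) X m I n K = 0"
proof (induction k arbitrary: I K)
  case (Suc k)
  have "L\<theta> i (L\<zeta> i ((Q ^^ k) X)) m I n K = 0" for i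
  proof -
    have "card (I - {i}) < k \<or> card (K - {i}) < k" if "i \<in> I" "i \<in> K"
      using Suc.prems card.remove[OF finite that(1)] card.remove[OF finite that(2)] by linarith
    then show ?thesis
      using Suc.IH by (auto simp: L\<theta>_def L\<zeta>_def)
  qed
  then show ?case
    by (simp add: Q_def[of "(Q ^^ k) X"] sum_fun_apply)
qed simp

text \<open>Q^N already fills the top degree in \<theta> and in \<zeta>. This disposes of the
  boundary term in the chain rule \<open>D_ZWs\<close>.\<close>

lemma L_Q_power:
  fixes X :: "('n::{finite,linorder}, 'v) ser2"
  shows "L\<theta> i ((Q ^^ card (UNIV :: 'n set)) X) = 0" "L\<zeta> i ((Q ^^ card (UNIV :: 'n set)) X) = 0"
proof -
  have "card (I - {i}) < card (UNIV :: 'n set)" if "i \<in> I" for I :: "'n set"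
    using that by (intro psubset_card_mono) auto
  then show "L\<theta> i ((Q ^^ card (UNIV :: 'n set)) X) = 0" "L\<zeta> i ((Q ^^ card (UNIV :: 'n set)) X) = 0"
    by (auto simp: pointwise sc_apply L\<theta>_def L\<zeta>_def Q_power_support)
qed

lemma Q_nilpotent: "(Q ^^ Suc (card (UNIV :: 'n set))) (X :: ('n::{finite,linorder}, 'v) ser2) = 0"
proof -
  have "L\<theta> i (L\<zeta> i ((Q ^^ card (UNIV :: 'n set)) X)) = 0" for i
    by (simp only: L_Q_power lin_simps)
  then show ?thesis
    by (simp add: Q_def[of "(Q ^^ _) X"])
qed

end

section \<open>Powers of \<open>Z - W\<close>\<close>

text \<open>The coefficient of \<open>u^(j-k) x^k\<close> in \<open>(u - x)^j\<close>.\<close>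

definition neg_binom :: "int \<Rightarrow> nat \<Rightarrow> complex" where
  "neg_binom j k = (of_int j gchoose k) * (- 1) ^ k"

lemma neg_binom_0 [simp]: "neg_binom j 0 = 1"
  by (simp add: neg_binom_def)

lemma neg_binom_0_left: "neg_binom 0 k = (if k = 0 then 1 else 0)"
  by (cases k) (simp_all add: neg_binom_def)

lemma neg_binom_eq_0: "0 \<le> j \<Longrightarrow> j < int k \<Longrightarrow> neg_binom j k = 0"
  by (cases j) (simp_all add: neg_binom_def binomial_gbinomial[symmetric] binomial_eq_0)

text \<open>Pascal's rule and the two absorption identities below are multiplication by u - x,
  \<partial>/\<partial>u and \<partial>/\<partial>x, read on the coefficients of (u - x)^j.\<close>

lemma neg_binom_Suc: "neg_binom (j + 1) (Suc k) = neg_binom j (Suc k) - neg_binom j k"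
  using gbinomial_Suc_Suc[of "of_int j :: complex" k] by (simp add: neg_binom_def algebra_simps)

lemma neg_binom_absorb_comp: "neg_binom j k * of_int (j - int k) = of_int j * neg_binom (j - 1) k"
  using arg_cong[OF gbinomial_absorb_comp[of "of_int j :: complex" k], of "\<lambda>x. (- 1) ^ k * x"] by (simp add: neg_binom_def algebra_simps)

lemma neg_binom_absorb: "neg_binom j (Suc k) * of_nat (Suc k) = - of_int j * neg_binom (j - 1) k"
  using arg_cong[OF gbinomial_absorption[of k "of_int j :: complex"], of "\<lambda>x. (- 1) ^ k * x"] by (simp add: neg_binom_def algebra_simps)

context complex_vector_space
begin

text \<open>\<open>(Z - W)^(j|J)\<close> applied to a series, when \<open>\<Phi> e\<close> is \<open>(z - w)^e\<close> applied to it.\<close>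

definition ZWs :: "(int \<Rightarrow> ('n::{finite,linorder}, 'v) ser2) \<Rightarrow> int \<Rightarrow> 'n set \<Rightarrow> ('n, 'v) ser2" where
  "ZWs \<Phi> j J = (\<Sum>k\<le>card (UNIV :: 'n set). sc (neg_binom j k) ((Q ^^ k) (HJ J (\<Phi> (j - int k)))))"

text \<open>Left multiplication by (Z - W)^(1|{}), the even factor that raises j in (Z -
  W)^(j|J).\<close>

definition LZW :: "('n::{finite,linorder}, 'v) ser2 \<Rightarrow> ('n, 'v) ser2" where
  "LZW X = Lzw X - Q X"

lemma lin_Q_power [simp]: "lin (Q ^^ k)"
  by (rule lin_funpow) simp

lemma lin_LZW [simp]: "lin LZW"
  unfolding LZW_def[abs_def] by (rule lin_minus) simp_all

lemmas lin_simps' [simp] = linD[OF lin_Q_power] linD[OF lin_LZW]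

lemma Q_power_comm:
  assumes "\<And>X. T (Q X) = Q (T X)"
  shows "T ((Q ^^ k) X) = (Q ^^ k) (T X)"
  by (induction k) (simp_all add: assms)

lemma H_ZWs: "H i (ZWs \<Phi> j M) = (if i \<in> M then 0 else sc (pos_sign i M) (ZWs \<Phi> j (insert i M)))"
  by (auto simp: ZWs_def lin_sum[OF lin_H] Q_power_comm[of "H i"] Q_H H_HJ sc_sum mult.commute)

lemma HJ_ZWs:
  "HJ J (ZWs \<Phi> j M) = (if J \<inter> M = {} then sc (shuffle_sign J M) (ZWs \<Phi> j (J \<union> M)) else 0)"
  by (auto simp: ZWs_def lin_sum[OF lin_HJ] Q_power_comm[of "HJ J"] Q_HJ HJ_HJ sc_sum mult.commute)

lemma LZW_H: "LZW (H i X) = H i (LZW X)"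
  by (simp add: LZW_def Lzw_commutes Q_H)

lemma LZW_L\<zeta>: "LZW (L\<zeta> i X) = L\<zeta> i (LZW X)"
  by (simp add: LZW_def Lzw_commutes Q_L\<zeta>)

lemma LZW_HJ: "LZW (HJ J X) = HJ J (LZW X)"
  by (rule HJ_commute_even) (simp add: LZW_H)

lemma LZW_ZWs:
  fixes \<Phi> :: "int \<Rightarrow> ('n::{finite,linorder}, 'v) ser2"
  assumes "\<And>e. Lzw (\<Phi> e) = \<Phi> (e + 1)"
  shows "LZW (ZWs \<Phi> j M) = ZWs \<Phi> (j + 1) M"
proof -
  let ?N = "card (UNIV :: 'n set)"
  let ?B = "\<lambda>k. (Q ^^ k) (HJ M (\<Phi> (j + 1 - int k)))"
  have Q: "Q ((Q ^^ k) (HJ M (\<Phi> (j - int k)))) = ?B (Suc k)" for k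
    by simp
  have "Lzw (ZWs \<Phi> j M) = (\<Sum>k\<le>?N. sc (neg_binom j k) (?B k))"
    by (simp add: ZWs_def lin_sum Q_power_comm[of Lzw] Q_Lzw HJ_commute_even[of Lzw]
        Lzw_commutes assms algebra_simps)
  also have "\<dots> = ?B 0 + (\<Sum>k<?N. sc (neg_binom j (Suc k)) (?B (Suc k)))"
    by (subst sum.atMost_shift) simp
  finally have 1: "Lzw (ZWs \<Phi> j M) = ?B 0 + (\<Sum>k<?N. sc (neg_binom j (Suc k)) (?B (Suc k)))" .
  have "Q (ZWs \<Phi> j M) = (\<Sum>k\<le>?N. sc (neg_binom j k) (?B (Suc k)))"
    unfolding ZWs_def by (simp only: lin_sum[OF lin_Q] linD[OF lin_Q] Q)
  \<comment> \<open>The term k = N drops out because Q^(N+1) = 0; Pascal's rule can then join this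
    sum to the previous one.\<close>
  also have "\<dots> = (\<Sum>k<?N. sc (neg_binom j k) (?B (Suc k)))"
    by (subst lessThan_Suc_atMost[symmetric], subst sum.lessThan_Suc) (simp only: Q_nilpotent sc_simps add_0_right)
  finally have 2: "Q (ZWs \<Phi> j M) = (\<Sum>k<?N. sc (neg_binom j k) (?B (Suc k)))" .
  have "ZWs \<Phi> (j + 1) M = ?B 0 + (\<Sum>k<?N. sc (neg_binom (j + 1) (Suc k)) (?B (Suc k)))"
    unfolding ZWs_def by (subst sum.atMost_shift) simp
  then show ?thesis
    unfolding LZW_def 1 2 by (simp only: neg_binom_Suc sc_diff sum_subtractf add_diff_eq)
qed

lemma LZW_power_ZWs:
  assumes "\<And>e. Lzw (\<Phi> e) = \<Phi> (e + 1)"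
  shows "(LZW ^^ k) (ZWs \<Phi> j M) = ZWs \<Phi> (j + int k) M"
  by (induction k) (simp_all add: LZW_ZWs[of \<Phi>, OF assms] add.assoc add.commute[of 1])

lemma ZWs_0: "ZWs \<Phi> 0 M = HJ M (\<Phi> 0)"
  unfolding ZWs_def by (subst sum.atMost_shift) (simp add: neg_binom_0_left)

lemma ZWs_of_nat:
  assumes "\<And>e. Lzw (\<Phi> e) = \<Phi> (e + 1)"
  shows "ZWs \<Phi> (int k) M = (LZW ^^ k) (HJ M (\<Phi> 0))"
  using LZW_power_ZWs[of \<Phi> k 0 M, OF assms] by (simp add: ZWs_0)

lemma ZWs_UNIV: "ZWs \<Phi> j UNIV = HJ UNIV (\<Phi> j)"
proof -
  have "(Q ^^ Suc k) (HJ UNIV X) = 0" for k and X :: "('a::{finite,linorder}, 'v) ser2"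
    by (simp add: Q_HJ_UNIV del: funpow.simps add: funpow_Suc_right)
  then show ?thesis
    unfolding ZWs_def by (subst sum.atMost_shift) (simp del: funpow.simps)
qed

lemma Dw_comm: "Dw (Q X) = Q (Dw X)" "Dw (H i X) = H i (Dw X)"
proof -
  have "Dw (L\<theta> i X) = L\<theta> i (Dw X)" "Dw (L\<zeta> i X) = L\<zeta> i (Dw X)" for i and X :: "('a::{finite,linorder}, 'v) ser2"
    by (auto simp: pointwise Dw_def L\<theta>_def L\<zeta>_def scale_left_commute mult_ac)
  then show "Dw (Q X) = Q (Dw X)" "Dw (H i X) = H i (Dw X)"
    by (simp_all add: Q_def H_def lin_sum)
qed

lemma Dw_ZWs:
  assumes "\<And>e. Dw (\<Phi> e) = sc (- of_int e) (\<Phi> (e - 1))"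
  shows "Dw (ZWs \<Phi> j M) = sc (- of_int j) (ZWs \<Phi> (j - 1) M)"
proof -
  have "Dw ((Q ^^ k) (HJ M (\<Phi> (j - int k)))) = sc (- of_int (j - int k)) ((Q ^^ k) (HJ M (\<Phi> (j - 1 - int k))))" for k
    by (simp add: Q_power_comm[of Dw] HJ_commute_even[of Dw] Dw_comm assms algebra_simps)
  then show ?thesis
    by (simp add: ZWs_def lin_sum[OF lin_Dw] sc_sum neg_binom_absorb_comp[symmetric] mult.commute
        minus_mult_right del: mult_minus_right of_int_diff)
qed

text \<open>The odd Leibniz rule: D passes the factors before \<theta>^i - \<zeta>^i, which gives
  \<open>pos_sign i M\<close>, and replaces that factor by the constant - c.\<close>

lemma D_HJ:
  fixes M :: "'n::{finite,linorder} set"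
  assumes D: "lin D" and DH: "\<And>j X. D (H j X) = - H j (D X) - (if j = i then sc c X else 0)"
  shows "D (HJ M X) = sc (set_sign M) (HJ M (D X))
    - (if i \<in> M then sc (c * pos_sign i M) (HJ (M - {i}) X) else 0)"
proof (induction M rule: finite_min_induct)
  case empty
  then show ?case by simp
next
  case (insert j J)
  then have j: "j \<notin> J" by blast
  have HJ: "HJ (insert j J) X = H j (HJ J X)" for X
    using insert.hyps by (rule HJ_insert_min)
  have IH: "D (HJ (insert j J) X) = - H j (sc (set_sign J) (HJ J (D X))
      - (if i \<in> J then sc (c * pos_sign i J) (HJ (J - {i}) X) else 0)) - (if j = i then sc c (HJ J X) else 0)"
    by (simp only: HJ DH insert.IH)
  consider "i = j" | "i \<noteq> j" "i \<in> J" | "i \<noteq> j" "i \<notin> J" by blast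
  then show ?case
  proof cases
    case 1
    have "pos_sign j J = 1"
      using insert.hyps by (rule pos_sign_less)
    then show ?thesis
      using 1 j unfolding IH by (simp add: HJ sc_minus)
  next
    case 2
    have "HJ (insert j (J - {i})) X = H j (HJ (J - {i}) X)"
      using insert.hyps by (auto intro: HJ_insert_min)
    moreover have "j < i"
      using 2 insert.hyps by blast
    moreover have "insert j J - {i} = insert j (J - {i})"
      using 2 by auto
    ultimately show ?thesis
      using 2 j unfolding IH by (simp add: HJ sc_minus)
  next
    case 3
    then show ?thesis
      using j unfolding IH by (simp add: HJ sc_minus)
  qed
qed

text \<open>A' commutes with Q, so each of the k factors contributes the same term; at k = 0 the
  truncated exponent k - 1 comes with the coefficient 0.\<close>

lemma D_Q_power:
  assumes D: "lin D" and DQ: "\<And>X. D (Q X) = Q (D X) + A' X" and A'Q: "\<And>X. A' (Q X) = Q (A' X)"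
  shows "D ((Q ^^ k) X) = (Q ^^ k) (D X) + sc (of_nat k) (A' ((Q ^^ (k - 1)) X))"
proof (induction k)
  case (Suc k)
  have *: "sc (of_nat k) (Q (A' ((Q ^^ (k - Suc 0)) X))) = sc (of_nat k) (A' ((Q ^^ k) X))"
    by (cases k) (simp_all add: A'Q)
  show ?case
    by (simp add: DQ Suc * sc_add add_ac)
qed simp

text \<open>An odd derivation \<open>D\<close> acts on \<open>(Z - W)^(j|M)\<close> by the chain rule: \<open>A\<close>, \<open>- A'\<close> and \<open>- c\<close> are the derivatives of
  \<open>z - w\<close>, of \<open>- \<Sum> \<theta>^i \<zeta>^i\<close> and of \<open>\<theta>^i - \<zeta>^i\<close>.\<close>

lemma D_ZWs:
  fixes \<Phi> :: "int \<Rightarrow> ('n::{finite,linorder}, 'v) ser2"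
  assumes D: "lin D" and A: "lin A" and A': "lin A'"
    and AQ: "\<And>X. A (Q X) = Q (A X)" and A'Q: "\<And>X. A' (Q X) = Q (A' X)"
    and AH: "\<And>j X. A (H j X) = - H j (A X)"
    and A'0: "\<And>X. A' ((Q ^^ card (UNIV :: 'n set)) X) = 0"
    and DQ: "\<And>X. D (Q X) = Q (D X) + A' X"
    and DH: "\<And>j X. D (H j X) = - H j (D X) - (if j = i then sc c X else 0)"
    and D\<Phi>: "\<And>e. D (\<Phi> e) = sc (of_int e) (A (\<Phi> (e - 1)))"
  shows "D (ZWs \<Phi> j M) = sc (of_int j) (A (ZWs \<Phi> (j - 1) M) - A' (ZWs \<Phi> (j - 1) M))
    - (if i \<in> M then sc (c * pos_sign i M) (ZWs \<Phi> j (M - {i})) else 0)"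
proof -
  let ?N = "card (UNIV :: 'n set)"
  let ?B = "\<lambda>k. (Q ^^ k) (HJ M (\<Phi> (j - 1 - int k)))"
  let ?C = "\<lambda>k. if i \<in> M then sc (c * pos_sign i M) ((Q ^^ k) (HJ (M - {i}) (\<Phi> (j - int k)))) else 0"
  let ?E = "\<lambda>k. sc (neg_binom j k * of_nat k) (A' ((Q ^^ (k - 1)) (HJ M (\<Phi> (j - int k)))))"
  have HJ_A: "HJ M (A X) = sc (set_sign M) (A (HJ M X))" for X
    by (simp add: HJ_commute_odd[of A, OF AH])
  have DHJ: "D (HJ M (\<Phi> (j - int k))) = sc (of_int (j - int k)) (A (HJ M (\<Phi> (j - 1 - int k))))
      - (if i \<in> M then sc (c * pos_sign i M) (HJ (M - {i}) (\<Phi> (j - int k))) else 0)" for k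
  proof -
    have "j - int k - 1 = j - 1 - int k" by simp
    then show ?thesis
      by (simp only: D_HJ[OF D DH] D\<Phi> linD[OF lin_HJ] HJ_A sc_simps) (simp add: mult_ac)
  qed
  have step: "D (sc (neg_binom j k) ((Q ^^ k) (HJ M (\<Phi> (j - int k))))) =
      sc (of_int j) (sc (neg_binom (j - 1) k) (A (?B k))) - sc (neg_binom j k) (?C k) + ?E k" for k
  proof -
    have "D ((Q ^^ k) (HJ M (\<Phi> (j - int k)))) = sc (of_int (j - int k)) (A (?B k)) - ?C k
       + sc (of_nat k) (A' ((Q ^^ (k - 1)) (HJ M (\<Phi> (j - int k)))))"
      unfolding D_Q_power[OF D DQ A'Q] DHJ
      by (simp add: Q_power_comm[of A, OF AQ] del: of_int_diff)
    then show ?thesis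
      by (simp add: linD[OF D] sc_add sc_diff neg_binom_absorb_comp[symmetric] del: of_int_diff)
  qed
  \<comment> \<open>Shifting k by one and absorbing the factor k into the binomial coefficient gives
    back the expansion of (Z - W)^(j-1|M). The shift loses its term k = N, which is restored for
    free because A' Q^N = 0.\<close>
  have "(\<Sum>k\<le>?N. ?E k) = (\<Sum>k<?N. ?E (Suc k))"
    by (subst sum.atMost_shift) simp
  also have "\<dots> = (\<Sum>k<?N. sc (- of_int j * neg_binom (j - 1) k) (A' (?B k)))"
  proof (rule sum.cong)
    fix k
    have "j - int (Suc k) = j - 1 - int k" by simp
    then show "?E (Suc k) = sc (- of_int j * neg_binom (j - 1) k) (A' (?B k))"
      by (simp only: neg_binom_absorb diff_Suc_1)
  qed simp
  also have "\<dots> = (\<Sum>k\<le>?N. sc (- of_int j * neg_binom (j - 1) k) (A' (?B k)))"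
    unfolding lessThan_Suc_atMost[of ?N, symmetric] sum.lessThan_Suc by (simp add: A'0)
  also have "\<dots> = - sc (of_int j) (A' (ZWs \<Phi> (j - 1) M))"
    by (simp add: ZWs_def lin_sum[OF A'] linD[OF A'] sc_sum sc_minus sum_negf)
  finally have E: "(\<Sum>k\<le>?N. ?E k) = - sc (of_int j) (A' (ZWs \<Phi> (j - 1) M))" .
  have C: "(\<Sum>k\<le>?N. sc (neg_binom j k) (?C k)) =
      (if i \<in> M then sc (c * pos_sign i M) (ZWs \<Phi> j (M - {i})) else 0)"
    by (simp add: ZWs_def sc_sum mult_ac)
  have "D (ZWs \<Phi> j M) = (\<Sum>k\<le>?N. sc (of_int j) (sc (neg_binom (j - 1) k) (A (?B k)))
      - sc (neg_binom j k) (?C k) + ?E k)"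
    unfolding ZWs_def[of \<Phi> j] lin_sum[OF D] step ..
  also have "\<dots> = sc (of_int j) (A (ZWs \<Phi> (j - 1) M)) - (\<Sum>k\<le>?N. sc (neg_binom j k) (?C k))
      + (\<Sum>k\<le>?N. ?E k)"
    unfolding sum.distrib sum_subtractf ZWs_def
    by (simp only: lin_sum[OF A] linD[OF A] sc_sum)
  finally show ?thesis
    unfolding E C by (simp add: sc_diff algebra_simps)
qed

end

section \<open>Multiplication by scalar series\<close>

interpretation C: complex_vector_space "(*) :: complex \<Rightarrow> complex \<Rightarrow> complex"
  by standard (simp_all add: algebra_simps)

declare C.scale_scale [simp del]

lemma pos_sign_split: "I' \<subseteq> I \<Longrightarrow> pos_sign i I = pos_sign i I' * pos_sign i (I - I')"
  using shuffle_sign_Un_right[of I' "I - I'" "{i}"] by (simp add: shuffle_sign_singleton_left Un_absorb1)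

lemma set_sign_split: "I' \<subseteq> I \<Longrightarrow> set_sign (I::'n::finite set) = set_sign I' * set_sign (I - I')"
  by (simp add: set_sign_def card_Diff_subset card_mono flip: power_add)

lemma sum_Pow_mem:
  fixes I :: "'n::finite set"
  assumes "i \<in> I"
  shows "(\<Sum>I'\<in>Pow I. if i \<in> I' then f I' else 0) = (\<Sum>I'\<in>Pow (I - {i}). f (insert i I'))"
proof -
  have "(\<Sum>I'\<in>Pow I. if i \<in> I' then f I' else 0) = (\<Sum>I'\<in>{I' \<in> Pow I. i \<in> I'}. f I')"
    by (rule sum.inter_filter[symmetric]) simp
  also have "\<dots> = (\<Sum>I'\<in>Pow (I - {i}). f (insert i I'))"
    by (rule sum.reindex_bij_witness[of _ "insert i" "\<lambda>I. I - {i}"]) (use assms in \<open>auto simp: insert_absorb\<close>)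
  finally show ?thesis .
qed

text \<open>\<open>tensor h Y X\<close>: the series \<open>Y\<close> is \<open>h(z, w)\<close> times the element \<open>X 0 \<cdot> 0 \<cdot>\<close> of the Grassmann algebra.\<close>

definition tensor :: "(int \<Rightarrow> int \<Rightarrow> complex) \<Rightarrow> ('n, complex) ser2 \<Rightarrow> ('n, complex) ser2 \<Rightarrow> bool" where
  "tensor h Y X \<longleftrightarrow> (\<forall>m I n K. Y m I n K = h m n * X 0 I 0 K)"

lemma tensorD: "tensor h Y X \<Longrightarrow> Y m I n K = h m n * X 0 I 0 K"
  by (simp add: tensor_def)

lemma tensor_L: "tensor h Y X \<Longrightarrow> tensor h (C.L\<theta> i Y) (C.L\<theta> i X)"
  "tensor h Y X \<Longrightarrow> tensor h (C.L\<zeta> i Y) (C.L\<zeta> i X)"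
  by (auto simp: tensor_def C.L\<theta>_def C.L\<zeta>_def)

lemma tensor_diff: "tensor h Y X \<Longrightarrow> tensor h Y' X' \<Longrightarrow> tensor h (Y - Y') (X - X')"
  by (simp add: tensor_def pointwise algebra_simps)

lemma tensor_sum: "(\<And>a. a \<in> A \<Longrightarrow> tensor h (Y a) (X a)) \<Longrightarrow> tensor h (sum Y A) (sum X A)"
  by (simp add: tensor_def sum_fun_apply sum_distrib_left)

lemma tensor_H: "tensor h Y X \<Longrightarrow> tensor h (C.H i Y) (C.H i X)"
  by (simp add: C.H_def tensor_diff tensor_L)

lemma tensor_HJ: "tensor h Y X \<Longrightarrow> tensor h (C.HJ J Y) (C.HJ J X)"
proof -
  assume *: "tensor h Y X"
  have "tensor h (foldr C.H xs Y) (foldr C.H xs X)" for xs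
    by (induction xs) (simp_all add: * tensor_H)
  then show ?thesis
    by (simp add: C.HJ_def)
qed

lemma tensor_Q_power: "tensor h Y X \<Longrightarrow> tensor h ((C.Q ^^ k) Y) ((C.Q ^^ k) X)"
proof (induction k)
  case (Suc k)
  have "tensor h (C.Q ((C.Q ^^ k) Y)) (C.Q ((C.Q ^^ k) X))"
    unfolding C.Q_def[of "(C.Q ^^ k) Y"] C.Q_def[of "(C.Q ^^ k) X"]
    by (intro tensor_sum tensor_L Suc)
  then show ?case
    by simp
qed simp

definition hmono :: "(int \<Rightarrow> int \<Rightarrow> complex) \<Rightarrow> int \<Rightarrow> int \<Rightarrow> int \<Rightarrow> complex" where
  "hmono c e m n = (if m + n = e then c e n else 0)"

text \<open>The homogeneous series of degree \<open>e\<close> in \<open>z\<close>, \<open>w\<close> whose coefficient of \<open>z^(e-l) w^l\<close> is \<open>c e l\<close>.\<close>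

definition hom2 :: "(int \<Rightarrow> int \<Rightarrow> complex) \<Rightarrow> int \<Rightarrow> ('n, complex) ser2" where
  "hom2 c e = (\<lambda>m I n K. if I = {} \<and> K = {} then hmono c e m n else 0)"

abbreviation \<delta>0 :: "int \<Rightarrow> int \<Rightarrow> complex" where
  "\<delta>0 \<equiv> \<lambda>m n. if m = 0 \<and> n = 0 then 1 else 0"

lemma tensor_hom2: "tensor (hmono c e) (hom2 c e) one2"
  by (simp add: tensor_def hom2_def one2_def)

lemma tensor_one2: "tensor \<delta>0 one2 one2"
  by (simp add: tensor_def one2_def)

section \<open>The action of Grassmann elements on vector-valued series\<close>

context complex_vector_space
begin

text \<open>The Grassmann part of \<open>mult2\<close>: only the coefficients of G at z^0 w^0 enter,
  all sums are finite, and so the product is defined for every X.\<close>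

definition gm :: "('n::{finite,linorder}, complex) ser2 \<Rightarrow> ('n, 'v) ser2 \<Rightarrow> ('n, 'v) ser2" where
  "gm G X = (\<lambda>m I n K. \<Sum>I'\<in>Pow I. \<Sum>K'\<in>Pow K.
     scale (koszul (par K' * par (I - I')) * shuffle_sign I' (I - I') * shuffle_sign K' (K - K') * G 0 I' 0 K')
       (X m (I - I') n (K - K')))"

lemma gm_diff: "gm (F - G) X = gm F X - gm G X"
  by (simp add: gm_def pointwise right_diff_distrib scale_left_diff_distrib sum_subtractf)

lemma gm_add: "gm (F + G) X = gm F X + gm G X"
  by (simp add: gm_def pointwise distrib_left scale_left_distrib sum.distrib)

lemma gm_0: "gm 0 X = 0"
  by (simp add: gm_def pointwise)

lemma gm_sum: "gm (sum f A) X = (\<Sum>a\<in>A. gm (f a) X)"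
  using sum_comp_morphism[of "\<lambda>F. gm F X" f A] by (simp add: gm_add gm_0 o_def)

lemma gm_sc: "gm (C.sc c F) X = sc c (gm F X)"
  by (simp add: gm_def pointwise sc_apply C.sc_apply scale_sum_right mult_ac)

lemma gm_one2: "gm one2 X = X"
proof -
  have "(\<Sum>I'\<in>Pow I. \<Sum>K'\<in>Pow K.
     scale (koszul (par K' * par (I - I')) * shuffle_sign I' (I - I') * shuffle_sign K' (K - K') * one2 0 I' 0 K')
       (X m (I - I') n (K - K'))) = X m I n K" for m I n K
  proof -
    have "(\<Sum>K'\<in>Pow K. scale (koszul (par K' * par (I - I')) * shuffle_sign I' (I - I') * shuffle_sign K' (K - K') * one2 0 I' 0 K')
       (X m (I - I') n (K - K'))) = (if I' = {} then X m I n K else 0)" for I'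
    proof -
      have "(\<Sum>K'\<in>Pow K. scale (koszul (par K' * par (I - I')) * shuffle_sign I' (I - I') * shuffle_sign K' (K - K') * one2 0 I' 0 K')
        (X m (I - I') n (K - K'))) = (\<Sum>K'\<in>Pow K. if K' = {} then if I' = {} then X m I n K else 0 else 0)"
        by (rule sum.cong) (auto simp: one2_def)
      then show ?thesis
        by (simp add: sum.delta)
    qed
    then show ?thesis
      by (simp add: sum.delta)
  qed
  then show ?thesis
    by (simp add: gm_def)
qed

text \<open>Associativity, one generator at a time: the subsets of I that contain i correspond to
  the subsets of I - {i}. With \<open>gm_L\<zeta>\<close> and \<open>gm_one2\<close> this computes
  the action of every element built from \<open>one2\<close>.\<close>

lemma gm_L\<theta>: "gm (C.L\<theta> i F) X = L\<theta> i (gm F X)"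
proof (intro ext)
  fix m I n K
  let ?f = "\<lambda>I'. \<Sum>K'\<in>Pow K. scale (koszul (par K' * par (I - I')) * shuffle_sign I' (I - I')
    * shuffle_sign K' (K - K') * (pos_sign i I' * F 0 (I' - {i}) 0 K')) (X m (I - I') n (K - K'))"
  have 1: "gm (C.L\<theta> i F) X m I n K = (\<Sum>I'\<in>Pow I. if i \<in> I' then ?f I' else 0)"
    by (auto simp: gm_def C.L\<theta>_def intro!: sum.cong)
  show "gm (C.L\<theta> i F) X m I n K = L\<theta> i (gm F X) m I n K"
  proof (cases "i \<in> I")
    case True
    have "?f (insert i I') = scale (pos_sign i I) (\<Sum>K'\<in>Pow K. scale (koszul (par K' * par (I - {i} - I'))
        * shuffle_sign I' (I - {i} - I') * shuffle_sign K' (K - K') * F 0 I' 0 K') (X m (I - {i} - I') n (K - K')))"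
      if "I' \<subseteq> I - {i}" for I'
    proof -
      have *: "i \<notin> I'" "I - insert i I' = I - {i} - I'" "insert i I' - {i} = I'"
        using that by auto
      have "pos_sign i I = pos_sign i I' * pos_sign i (I - {i} - I')"
        using pos_sign_split[OF that, of i] True by simp
      then show ?thesis
        unfolding * by (auto simp: scale_sum_right shuffle_sign_insert_left * mult_ac intro!: sum.cong)
    qed
    then show ?thesis
      unfolding 1 sum_Pow_mem[OF True] by (simp add: L\<theta>_def True gm_def scale_sum_right)
  next
    case False
    then show ?thesis
      unfolding 1 by (auto simp: L\<theta>_def intro!: sum.neutral)
  qed
qed

lemma gm_L\<zeta>: "gm (C.L\<zeta> i F) X = L\<zeta> i (gm F X)"
proof (intro ext)
  fix m I n K
  let ?f = "\<lambda>I' K'. scale (koszul (par K' * par (I - I')) * shuffle_sign I' (I - I')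
    * shuffle_sign K' (K - K') * (set_sign I' * pos_sign i K' * F 0 I' 0 (K' - {i}))) (X m (I - I') n (K - K'))"
  have 1: "gm (C.L\<zeta> i F) X m I n K = (\<Sum>I'\<in>Pow I. \<Sum>K'\<in>Pow K. if i \<in> K' then ?f I' K' else 0)"
    by (auto simp: gm_def C.L\<zeta>_def intro!: sum.cong)
  show "gm (C.L\<zeta> i F) X m I n K = L\<zeta> i (gm F X) m I n K"
  proof (cases "i \<in> K")
    case True
    have "?f I' (insert i K') = scale (set_sign I * pos_sign i K) (scale (koszul (par K' * par (I - I'))
        * shuffle_sign I' (I - I') * shuffle_sign K' (K - {i} - K') * F 0 I' 0 K') (X m (I - I') n (K - {i} - K')))"
      if "I' \<subseteq> I" "K' \<subseteq> K - {i}" for I' K'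
    proof -
      have *: "i \<notin> K'" "K - insert i K' = K - {i} - K'" "insert i K' - {i} = K'"
        using that by auto
      have "pos_sign i K = pos_sign i K' * pos_sign i (K - {i} - K')"
        using pos_sign_split[OF that(2), of i] True by simp
      moreover have "koszul (par (insert i K') * par (I - I')) = set_sign (I - I') * koszul (par K' * par (I - I'))"
        by (simp only: card_insert_disjoint[OF finite *(1)] of_nat_Suc distrib_right koszul_add mult_1_left koszul_par)
      ultimately show ?thesis
        unfolding * using set_sign_split[OF that(1)]
        by (simp add: shuffle_sign_insert_left * mult_ac del: of_nat_mult)
    qed
    then show ?thesis
      unfolding 1 sum_Pow_mem[OF True] by (simp add: L\<zeta>_def True gm_def scale_sum_right)
  next
    case False
    then show ?thesis
      unfolding 1 by (auto simp: L\<zeta>_def intro!: sum.neutral)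
  qed
qed

lemma gm_H: "gm (C.H i F) X = H i (gm F X)"
  by (simp add: C.H_def H_def gm_diff gm_L\<theta> gm_L\<zeta>)

lemma gm_HJ: "gm (C.HJ J F) X = HJ J (gm F X)"
proof -
  have "gm (foldr C.H xs F) X = foldr H xs (gm F X)" for xs
    by (induction xs) (simp_all add: gm_H)
  then show ?thesis
    by (simp add: C.HJ_def HJ_def)
qed

lemma gm_Q: "gm (C.Q F) X = Q (gm F X)"
  by (simp add: C.Q_def Q_def gm_sum gm_L\<theta> gm_L\<zeta>)

lemma gm_Q_power: "gm ((C.Q ^^ k) F) X = (Q ^^ k) (gm F X)"
  by (induction k) (simp_all add: gm_Q)

section \<open>Convolution with homogeneous series in z and w\<close>

text \<open>Multiplication by the series \<open>hom2 c e\<close>.\<close>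

definition conv :: "(int \<Rightarrow> int \<Rightarrow> complex) \<Rightarrow> int \<Rightarrow> ('n, 'v) ser2 \<Rightarrow> ('n, 'v) ser2" where
  "conv c e X = (\<lambda>m I n K. Sum_any (\<lambda>l. scale (c e l) (X (m - e + l) I (n - l) K)))"

text \<open>Summability is asked for all e at once, since multiplication by z - w and the
  derivatives move e by one.\<close>

definition convable :: "(int \<Rightarrow> int \<Rightarrow> complex) \<Rightarrow> ('n, 'v) ser2 \<Rightarrow> bool" where
  "convable c X \<longleftrightarrow> (\<forall>e m I n K. finite {l. c e l \<noteq> 0 \<and> X (m - e + l) I (n - l) K \<noteq> 0})"

text \<open>Homogeneity confines the k-th summand to the line m + n = e k, parametrised by the
  exponent l of w. Finiteness along these lines keeps \<open>Sum_any\<close> away from its default 0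
  on infinite supports.\<close>

lemma Sum_any_hmono:
  assumes A: "finite A" and fin: "\<And>k. k \<in> A \<Longrightarrow> finite {l. c (e k) l \<noteq> 0 \<and> x (e k - l) l \<noteq> 0}"
  shows "Sum_any (\<lambda>(m, n). scale (\<Sum>k\<in>A. hmono c (e k) m n * g k) (x m n)) =
    (\<Sum>k\<in>A. scale (g k) (Sum_any (\<lambda>l. scale (c (e k) l) (x (e k - l) l))))"
proof -
  define L where "L = (\<lambda>k. {l. c (e k) l \<noteq> 0 \<and> x (e k - l) l \<noteq> 0})"
  define P where "P = (\<lambda>k. (\<lambda>l. (e k - l, l)) ` L k)"
  have fL: "k \<in> A \<Longrightarrow> finite (L k)" for k
    using fin by (simp add: L_def)
  have fP: "finite (\<Union>k\<in>A. P k)"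
    using A fL by (auto simp: P_def)
  have zero: "scale (hmono c (e k) (fst p) (snd p) * g k) (x (fst p) (snd p)) = 0"
    if "p \<notin> P k" for p k
  proof (rule ccontr)
    assume "\<not> ?thesis"
    then have p: "fst p + snd p = e k" "c (e k) (snd p) \<noteq> 0" "x (fst p) (snd p) \<noteq> 0"
      by (auto simp: hmono_def split: if_splits)
    then have "fst p = e k - snd p"
      by simp
    with p have "snd p \<in> L k" "p = (e k - snd p, snd p)"
      by (simp_all add: L_def prod_eq_iff)
    then show False
      using that unfolding P_def by blast
  qed
  have "Sum_any (\<lambda>(m, n). scale (\<Sum>k\<in>A. hmono c (e k) m n * g k) (x m n)) =
      (\<Sum>p\<in>(\<Union>k\<in>A. P k). case p of (m, n) \<Rightarrow> scale (\<Sum>k\<in>A. hmono c (e k) m n * g k) (x m n))"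
  proof (rule Sum_any.expand_superset[OF fP], rule subsetI, rule ccontr)
    fix p
    assume p: "p \<in> {a. (case a of (m, n) \<Rightarrow> scale (\<Sum>k\<in>A. hmono c (e k) m n * g k) (x m n)) \<noteq> 0}"
      and "p \<notin> (\<Union>k\<in>A. P k)"
    then have "(\<Sum>k\<in>A. scale (hmono c (e k) (fst p) (snd p) * g k) (x (fst p) (snd p))) = 0"
      by (intro sum.neutral ballI zero) auto
    then show False
      using p by (simp add: split_beta scale_sum_left)
  qed
  also have "\<dots> = (\<Sum>k\<in>A. \<Sum>p\<in>(\<Union>k\<in>A. P k). scale (hmono c (e k) (fst p) (snd p) * g k) (x (fst p) (snd p)))"
    by (simp add: split_beta scale_sum_left sum.swap[of _ A])
  also have "\<dots> = (\<Sum>k\<in>A. scale (g k) (Sum_any (\<lambda>l. scale (c (e k) l) (x (e k - l) l))))"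
  proof (rule sum.cong[OF refl])
    fix k assume k: "k \<in> A"
    have "(\<Sum>p\<in>(\<Union>k\<in>A. P k). scale (hmono c (e k) (fst p) (snd p) * g k) (x (fst p) (snd p))) =
        (\<Sum>p\<in>P k. scale (hmono c (e k) (fst p) (snd p) * g k) (x (fst p) (snd p)))"
      using k zero fP by (intro sum.mono_neutral_right) auto
    also have "\<dots> = (\<Sum>l\<in>L k. scale (g k) (scale (c (e k) l) (x (e k - l) l)))"
    proof -
      have "inj_on (\<lambda>l. (e k - l, l)) (L k)"
        by (simp add: inj_on_def)
      then show ?thesis
        unfolding P_def by (simp add: sum.reindex hmono_def mult.commute[of _ "g k"])
    qed
    also have "\<dots> = scale (g k) (Sum_any (\<lambda>l. scale (c (e k) l) (x (e k - l) l)))"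
      unfolding scale_sum_right[symmetric]
      by (subst Sum_any.expand_superset[OF fL[OF k]]) (auto simp: L_def)
    finally show "(\<Sum>p\<in>(\<Union>k\<in>A. P k). scale (hmono c (e k) (fst p) (snd p) * g k) (x (fst p) (snd p))) = \<dots>" .
  qed
  finally show ?thesis .
qed

text \<open>The bridge from \<open>mult2\<close> to operators: even and odd variables separate, so a
  sum of terms h_k(z, w) G_k with G_k in the Grassmann algebra acts by convolving with h_k and then
  applying G_k.\<close>

lemma mult2_hmono:
  assumes A: "finite A" and X: "convable c X"
    and F: "\<And>m I n K. F m I n K = (\<Sum>k\<in>A. hmono c (e k) m n * G k 0 I 0 K)"
  shows "mult2 scale F X = (\<Sum>k\<in>A. gm (G k) (conv c (e k) X))"
proof -
  have *: "Sum_any (\<lambda>(m', n'). scale (F m' I' n' K') (X (m - m') I (n - n') K)) =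
     (\<Sum>k\<in>A. scale (G k 0 I' 0 K') (conv c (e k) X m I n K))" for m I n K I' K'
  proof -
    have *: "m - (a - l) = m - a + l" for a l :: int
      by simp
    show ?thesis
      unfolding F conv_def
      by (subst Sum_any_hmono[OF A]) (use X in \<open>simp_all only: convable_def *\<close>)
  qed
  show ?thesis
    unfolding mult2_def * gm_def
    by (simp add: fun_eq_iff sum_fun_apply scale_sum_right sum.swap[of _ A])
qed

lemma mult2_Grassmann:
  assumes "tensor \<delta>0 F F"
  shows "mult2 scale F X = gm F X"
proof -
  \<comment> \<open>The hypothesis says that F is free of z and w. It is presented as F times the
    constant 1, the member e = 0 of a family whose convolutions are one-term sums.\<close>
  define c :: "int \<Rightarrow> int \<Rightarrow> complex" where "c = (\<lambda>e l. if l = 0 then 1 else 0)"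
  have F: "F m I n K = (\<Sum>k\<in>{()}. hmono c 0 m n * F 0 I 0 K)" for m I n K
    by (subst tensorD[OF assms]) (simp add: hmono_def c_def)
  have "finite {l. c e l \<noteq> 0 \<and> X (m - e + l) I (n - l) K \<noteq> 0}" for e m I n K
    by (rule finite_subset[of _ "{0}"]) (auto simp: c_def)
  then have X: "convable c X"
    by (simp add: convable_def)
  have conv: "conv c 0 X = X"
  proof -
    have "scale (c 0 l) (X (m - 0 + l) I (n - l) K) = (if l = 0 then X m I n K else 0)" for m I n K l
      by (simp add: c_def)
    then show ?thesis
      by (simp add: conv_def fun_eq_iff)
  qed
  have "mult2 scale F X = (\<Sum>k\<in>{()}. gm F (conv c 0 X))"
    by (rule mult2_hmono[where A = "{()}" and c = c and e = "\<lambda>_. 0" and G = "\<lambda>_. F"], simp, rule X, rule F)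
  then show ?thesis
    by (simp add: conv)
qed

end

section \<open>The scalar series of the definitions as operators\<close>

lemma theta_eq: "theta i = C.L\<theta> i one2"
  by (auto simp: fun_eq_iff theta_def C.L\<theta>_def one2_def)

lemma zeta_eq: "zeta i = C.L\<zeta> i one2"
  by (auto simp: fun_eq_iff zeta_def C.L\<zeta>_def one2_def)

lemma diff_odd_eq: "diff_odd i = C.H i one2"
  by (simp add: fun_eq_iff diff_odd_def C.H_def theta_eq zeta_eq minus_apply)

context complex_vector_space
begin

lemma mult2_theta: "mult2 scale (theta i) X = L\<theta> i X"
  unfolding theta_eq by (simp add: mult2_Grassmann tensor_L tensor_one2 gm_L\<theta> gm_one2)

lemma mult2_zeta: "mult2 scale (zeta i) X = L\<zeta> i X"
  unfolding zeta_eq by (simp add: mult2_Grassmann tensor_L tensor_one2 gm_L\<zeta> gm_one2)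

lemma mult2_diff_odd: "mult2 scale (diff_odd i) X = H i X"
  unfolding diff_odd_eq by (simp add: mult2_Grassmann tensor_H tensor_one2 gm_H gm_one2)

end

lemma theta_zeta_eq: "theta_zeta = C.Q one2"
  by (simp add: fun_eq_iff theta_zeta_def C.mult2_theta C.Q_def sum_fun_apply zeta_eq)

lemma (in complex_vector_space) mult2_theta_zeta: "mult2 scale theta_zeta X = Q X"
  unfolding theta_zeta_eq
  using mult2_Grassmann[OF tensor_Q_power[OF tensor_one2, of 1], of X] by (simp add: gm_Q gm_one2)

lemma theta_zeta_power: "(smult2 theta_zeta ^^ k) one2 = (C.Q ^^ k) one2"
  by (induction k) (simp_all add: C.mult2_theta_zeta)

lemma diff_odd_prod_eq: "diff_odd_prod J = C.HJ J one2"
proof -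
  have "smult2 (diff_odd i) = C.H i" for i :: 'a
    by (simp add: fun_eq_iff C.mult2_diff_odd)
  then show ?thesis
    by (simp add: diff_odd_prod_def C.HJ_def)
qed

lemma C_conv_Grassmann:
  assumes "tensor \<delta>0 f f"
  shows "C.convable c f" "tensor (hmono c e) (C.conv c e f) f"
proof -
  have *: "c e l * f (m - e + l) I (n - l) K = (if l = n then hmono c e m n * f 0 I 0 K else 0)" for e l m I n K
    by (subst tensorD[OF assms]) (auto simp: hmono_def)
  have "finite {l. c e l \<noteq> 0 \<and> f (m - e + l) I (n - l) K \<noteq> 0}" for e m I n K
  proof (rule finite_subset[of _ "{n}"], rule subsetI)
    fix l
    assume "l \<in> {l. c e l \<noteq> 0 \<and> f (m - e + l) I (n - l) K \<noteq> 0}"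
    then have "c e l * f (m - e + l) I (n - l) K \<noteq> 0"
      by simp
    then show "l \<in> {n}"
      unfolding * by (simp split: if_splits)
  qed simp
  then show "C.convable c f"
    by (simp add: C.convable_def)
  show "tensor (hmono c e) (C.conv c e f) f"
    by (simp add: tensor_def C.conv_def *)
qed

lemma tensor_unique: "tensor h Y X \<Longrightarrow> tensor h Y' X \<Longrightarrow> Y = Y'"
  by (simp add: tensor_def fun_eq_iff)

lemma C_conv_HJ: "C.conv c e (C.HJ J one2) = C.HJ J (hom2 c e)"
  by (rule tensor_unique[OF C_conv_Grassmann(2) tensor_HJ[OF tensor_hom2]]) (rule tensor_HJ[OF tensor_one2])

lemma smult2_hom2: 
  assumes "C.convable c X"
  shows "smult2 (hom2 c e) X = C.conv c e X"
proof -
  have "hom2 c e m I n K = (\<Sum>k\<in>{()}. hmono c e m n * one2 0 I 0 K)" for m I n K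
    by (simp add: hom2_def one2_def)
  then have "smult2 (hom2 c e) X = (\<Sum>k\<in>{()}. C.gm one2 (C.conv c e X))"
    by (intro C.mult2_hmono assms) simp_all
  then show ?thesis
    by (simp add: C.gm_one2)
qed

text \<open>(Z - W)^(j|J) in the shape that \<open>mult2_hmono\<close> accepts: the k-th term is
  homogeneous of degree j - k times a Grassmann element.\<close>

lemma ZWs_hom2:
  "C.ZWs (hom2 c) j J m I n K = (\<Sum>k\<le>card (UNIV :: 'n::{finite,linorder} set).
     hmono c (j - int k) m n * C.sc (neg_binom j k) ((C.Q ^^ k) (C.HJ (J :: 'n set) one2)) 0 I 0 K)"
proof -
  have "tensor (hmono c e) ((C.Q ^^ k) (C.HJ J (hom2 c e))) ((C.Q ^^ k) (C.HJ J one2))" for k e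
    by (intro tensor_Q_power tensor_HJ tensor_hom2)
  then show ?thesis
    by (simp add: C.ZWs_def sum_fun_apply C.sc_apply tensor_def mult_ac)
qed

lemma ZW_power_eq:
  fixes J :: "'n::{finite,linorder} set"
  assumes "\<And>e. ex e = hom2 c e"
  shows "ZW_power ex j J = C.ZWs (hom2 c) j J"
proof -
  have Q: "smult2 (hom2 c e) ((C.Q ^^ k) one2) m I n K = hmono c e m n * (C.Q ^^ k) one2 0 I 0 K"
    for e k m n and I K :: "'n set"
    by (simp add: smult2_hom2 C_conv_Grassmann(1)[OF tensor_Q_power[OF tensor_one2]]
        tensorD[OF C_conv_Grassmann(2)[OF tensor_Q_power[OF tensor_one2]]])
  have H: "C.convable c (C.HJ J one2)"
    by (rule C_conv_Grassmann) (rule tensor_HJ[OF tensor_one2])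
  have "ZW_power ex j J = (\<Sum>k\<le>card (UNIV :: 'n set). C.gm (C.sc (neg_binom j k) ((C.Q ^^ k) one2))
      (C.conv c (j - int k) (C.HJ J one2)))"
    unfolding ZW_power_def theta_zeta_power diff_odd_prod_eq assms
    by (rule C.mult2_hmono[OF _ H]) (simp_all add: Q C.sc_apply neg_binom_def mult_ac)
  then show ?thesis
    by (simp add: C.gm_sc C.gm_Q_power C.gm_one2 C_conv_HJ C.ZWs_def)
qed

lemma (in complex_vector_space) mult2_ZWs:
  fixes J :: "'n::{finite,linorder} set"
  assumes "convable c X"
  shows "mult2 scale (C.ZWs (hom2 c) j J) X = ZWs (\<lambda>e. conv c e X) j J"
  by (subst mult2_hmono[where A = "{..card (UNIV :: 'n set)}" and c = c and e = "\<lambda>k. j - int k"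
        and G = "\<lambda>k. C.sc (neg_binom j k) ((C.Q ^^ k) (C.HJ J one2))"])
    (simp_all add: assms ZWs_hom2 gm_sc gm_Q_power gm_HJ gm_one2 ZWs_def)

section \<open>Expansions of powers of \<open>z - w\<close>\<close>

text \<open>With c e l as coefficient of z^(e-l) w^l in (z - w)^e, the three recursions express
  multiplication by z - w, \<partial>/\<partial>z and \<partial>/\<partial>w. They are linear in c,
  hence inherited by the difference of two expansions.\<close>

definition binomial_family :: "(int \<Rightarrow> int \<Rightarrow> complex) \<Rightarrow> bool" where
  "binomial_family c \<longleftrightarrow>
     (\<forall>e l. c (e + 1) l = c e l - c e (l - 1)) \<and>
     (\<forall>e l. of_int (e - l) * c e l = of_int e * c (e - 1) l) \<and>
     (\<forall>e l. of_int l * c e l = - of_int e * c (e - 1) (l - 1))"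

lemma binomial_familyD:
  assumes "binomial_family c"
  shows "c (e + 1) l = c e l - c e (l - 1)" "of_int (e - l) * c e l = of_int e * c (e - 1) l"
    "of_int l * c e l = - of_int e * c (e - 1) (l - 1)"
  using assms unfolding binomial_family_def by blast+

definition c_zw :: "int \<Rightarrow> int \<Rightarrow> complex" where
  "c_zw e l = (if 0 \<le> l then neg_binom e (nat l) else 0)"

text \<open>(z - w)^e = (-1)^e (w - z)^e: the other expansion with the exponents of z and w
  exchanged.\<close>

definition c_wz :: "int \<Rightarrow> int \<Rightarrow> complex" where
  "c_wz e l = (if even e then 1 else - 1) * c_zw e (e - l)"

definition c_delta :: "int \<Rightarrow> int \<Rightarrow> complex" where
  "c_delta e l = c_zw e l - c_wz e l"

lemma binomial_family_zw: "binomial_family c_zw"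
proof -
  have "c_zw (e + 1) l = c_zw e l - c_zw e (l - 1)" for e l
  proof (cases "1 \<le> l")
    case True
    then have "l = int (Suc (nat (l - 1)))"
      by simp
    then obtain k where "l = int (Suc k)" ..
    then show ?thesis
      by (simp add: c_zw_def neg_binom_Suc nat_add_distrib)
  next
    case False
    then show ?thesis
      by (cases "l = 0") (auto simp: c_zw_def)
  qed
  moreover have "of_int (e - l) * c_zw e l = of_int e * c_zw (e - 1) l" for e l
    using neg_binom_absorb_comp[of e "nat l"] by (auto simp: c_zw_def mult.commute)
  moreover have "of_int l * c_zw e l = - of_int e * c_zw (e - 1) (l - 1)" for e l
  proof (cases "1 \<le> l")
    case True
    then have "l = int (Suc (nat (l - 1)))"
      by simp
    then obtain k where "l = int (Suc k)" ..
    then show ?thesis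
      using neg_binom_absorb[of e k] by (simp add: c_zw_def nat_add_distrib mult.commute)
  next
    case False
    then show ?thesis
      by (cases "l = 0") (auto simp: c_zw_def)
  qed
  ultimately show ?thesis
    by (simp add: binomial_family_def)
qed

lemma binomial_family_wz: "binomial_family c_wz"
proof -
  note zw = binomial_familyD[OF binomial_family_zw]
  have "c_wz (e + 1) l = c_wz e l - c_wz e (l - 1)" for e l
    using zw(1)[of e "e + 1 - l"] by (simp add: c_wz_def algebra_simps)
  moreover have "of_int (e - l) * c_wz e l = of_int e * c_wz (e - 1) l" for e l
    using zw(3)[of "e - l" e] by (auto simp: c_wz_def algebra_simps)
  moreover have "of_int l * c_wz e l = - of_int e * c_wz (e - 1) (l - 1)" for e l
    using zw(2)[of e "e - l"] by (auto simp: c_wz_def algebra_simps)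
  ultimately show ?thesis
    by (simp add: binomial_family_def)
qed

lemma binomial_family_delta: "binomial_family c_delta"
  using binomial_familyD[OF binomial_family_zw] binomial_familyD[OF binomial_family_wz]
  unfolding binomial_family_def c_delta_def by (simp add: right_diff_distrib)

lemma c_zw_0: "c_zw 0 l = (if l = 0 then 1 else 0)" and c_wz_0: "c_wz 0 l = (if l = 0 then 1 else 0)"
  by (auto simp: c_zw_def c_wz_def neg_binom_0_left)

text \<open>The two expansions agree at e = 0, and the recursion multiplies both by z - w.\<close>

lemma c_delta_nonneg: "c_delta (int k) l = 0"
proof (induction k arbitrary: l)
  case 0
  then show ?case
    by (simp add: c_delta_def c_zw_0 c_wz_0)
next
  case (Suc k)
  show ?case
    using binomial_familyD(1)[OF binomial_family_delta, of "int k" l] Suc by (simp add: add.commute)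
qed

lemma exp_zw_eq: "exp_zw e = hom2 c_zw e"
  by (auto simp: fun_eq_iff exp_zw_def hom2_def hmono_def c_zw_def neg_binom_def power_int_def)

lemma exp_wz_eq: "exp_wz e = hom2 c_wz e"
proof -
  have powi: "(- 1 :: complex) powi n = (if even n then 1 else - 1)" for n
    by (auto simp: power_int_def minus_one_power_iff even_nat_iff)
  have "(- 1 :: complex) powi n = (if even (m + n) then 1 else - 1) * (- 1) ^ nat m" if "0 \<le> m" for m n :: int
    unfolding powi using that by (auto simp: minus_one_power_iff even_nat_iff)
  then show ?thesis
    by (auto simp: fun_eq_iff exp_wz_def hom2_def hmono_def c_wz_def c_zw_def neg_binom_def)
qed

lemma exp_diff_eq: "(\<lambda>m I n K. exp_zw e m I n K - exp_wz e m I n K) = hom2 c_delta e"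
  by (auto simp: fun_eq_iff exp_zw_eq exp_wz_eq hom2_def hmono_def c_delta_def)

lemma Sum_any_diff:
  fixes f g :: "'a \<Rightarrow> 'b::ab_group_add"
  assumes "finite {a. f a \<noteq> 0}" "finite {a. g a \<noteq> 0}"
  shows "Sum_any (\<lambda>a. f a - g a) = Sum_any f - Sum_any g"
proof -
  let ?A = "{a. f a \<noteq> 0} \<union> {a. g a \<noteq> 0}"
  have A: "finite ?A"
    using assms by simp
  have "Sum_any (\<lambda>a. f a - g a) = (\<Sum>a\<in>?A. f a - g a)"
    by (rule Sum_any.expand_superset[OF A]) auto
  moreover have "Sum_any f = sum f ?A" "Sum_any g = sum g ?A"
    by (rule Sum_any.expand_superset[OF A], auto)+
  ultimately show ?thesis
    by (simp only: sum_subtractf)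
qed

lemma Sum_any_shift: "Sum_any (\<lambda>l::int. f (l - 1)) = Sum_any f"
proof (rule Sum_any.reindex_cong[of "\<lambda>l. l + 1"])
  show "bij (\<lambda>l::int. l + 1)"
    by (rule bij_betw_byWitness[of _ "\<lambda>l. l - 1"]) auto
qed (simp add: fun_eq_iff)

lemma finite_shift: "finite {l. P l} \<Longrightarrow> finite {l::int. P (l - 1)}"
proof -
  have "{l. P (l - 1)} = (\<lambda>l. l + 1) ` {l. P l}"
    by (auto intro: image_eqI[of _ _ "_ - 1"])
  then show "finite {l. P l} \<Longrightarrow> ?thesis"
    by simp
qed

lemma additive_Sum_any:
  fixes T :: "'b::ab_group_add \<Rightarrow> 'c::ab_group_add"
  assumes add: "\<And>x y. T (x + y) = T x + T y" and fin: "finite {a. f a \<noteq> 0}"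
  shows "T (Sum_any f) = Sum_any (\<lambda>a. T (f a))"
proof -
  have 0: "T 0 = 0"
    using add[of 0 0] by simp
  have "T (Sum_any f) = (\<Sum>a\<in>{a. f a \<noteq> 0}. T (f a))"
    unfolding Sum_any.expand_set using sum_comp_morphism[of T f] 0 add by (simp add: o_def)
  also have "\<dots> = Sum_any (\<lambda>a. T (f a))"
    using 0 by (intro Sum_any.expand_superset[symmetric] fin) auto
  finally show ?thesis .
qed

section \<open>Convolution in a single component\<close>

context complex_vector_space
begin

definition conv0 :: "(int \<Rightarrow> int \<Rightarrow> complex) \<Rightarrow> int \<Rightarrow> (int \<Rightarrow> int \<Rightarrow> 'v) \<Rightarrow> int \<Rightarrow> int \<Rightarrow> 'v" where
  "conv0 c e x = (\<lambda>m n. Sum_any (\<lambda>l. scale (c e l) (x (m - e + l) (n - l))))"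

definition convable0 :: "(int \<Rightarrow> int \<Rightarrow> complex) \<Rightarrow> (int \<Rightarrow> int \<Rightarrow> 'v) \<Rightarrow> bool" where
  "convable0 c x \<longleftrightarrow> (\<forall>e s t. finite {l. c e l \<noteq> 0 \<and> x (s + l) (t - l) \<noteq> 0})"

lemma conv_conv0: "conv c e X m I n K = conv0 c e (\<lambda>m n. X m I n K) m n"
  by (simp add: conv_def conv0_def)

lemma convable_convable0: "convable c X \<longleftrightarrow> (\<forall>I K. convable0 c (\<lambda>m n. X m I n K))"
proof
  assume *: "convable c X"
  have "finite {l. c e l \<noteq> 0 \<and> X (s + l) I (t - l) K \<noteq> 0}" for e s I t K
    using *[unfolded convable_def, rule_format, of e "s + e" I t K] by simp
  then show "\<forall>I K. convable0 c (\<lambda>m n. X m I n K)"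
    by (simp add: convable0_def)
qed (simp add: convable_def convable0_def)

lemma convable0D: "convable0 c x \<Longrightarrow> finite {l. scale (c e l) (x (s + l) (t - l)) \<noteq> 0}"
  by (auto simp: convable0_def)

lemma convable0_subset:
  assumes "convable0 c x" "\<And>e l s t. c e l \<noteq> 0 \<Longrightarrow> y (s + l) (t - l) \<noteq> 0 \<Longrightarrow> x (s + a + l) (t + b - l) \<noteq> 0"
  shows "convable0 c y"
  unfolding convable0_def
proof (intro allI)
  fix e s t
  have "finite {l. c e l \<noteq> 0 \<and> x (s + a + l) (t + b - l) \<noteq> 0}"
    using assms(1) by (simp add: convable0_def)
  then show "finite {l. c e l \<noteq> 0 \<and> y (s + l) (t - l) \<noteq> 0}"
    by (rule rev_finite_subset) (auto dest: assms(2))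
qed

lemma convable0_diff:
  assumes "convable0 c x" "convable0 c y"
  shows "convable0 c (\<lambda>m n. x m n - y m n)"
  unfolding convable0_def
proof (intro allI)
  fix e s t
  have "finite ({l. c e l \<noteq> 0 \<and> x (s + l) (t - l) \<noteq> 0} \<union> {l. c e l \<noteq> 0 \<and> y (s + l) (t - l) \<noteq> 0})"
    using assms by (simp add: convable0_def)
  then show "finite {l. c e l \<noteq> 0 \<and> x (s + l) (t - l) - y (s + l) (t - l) \<noteq> 0}"
    by (rule rev_finite_subset) auto
qed

lemma convable0_additive:
  assumes "convable0 c x" "T 0 = 0"
  shows "convable0 c (\<lambda>m n. T (x m n))"
  by (rule convable0_subset[OF assms(1), of _ 0 0]) (use assms(2) in auto)

text \<open>On each line m + n = s the exponent of w is bounded below, while this expansion has only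
  terms l \<ge> 0, which lower that exponent; finitely many l survive.\<close>

lemma convable0_zw:
  assumes "\<And>s. \<exists>n0. \<forall>n<n0. x (s - n) n = 0"
  shows "convable0 c_zw x"
  unfolding convable0_def
proof (intro allI)
  fix e s t :: int
  obtain n0 where n0: "x (s + t - n) n = 0" if "n < n0" for n
    using assms[of "s + t"] by auto
  have "{l. c_zw e l \<noteq> 0 \<and> x (s + l) (t - l) \<noteq> 0} \<subseteq> {0..t - n0}"
    using n0[of "t - l" for l] by (auto simp: c_zw_def not_less[symmetric])
  then show "finite {l. c_zw e l \<noteq> 0 \<and> x (s + l) (t - l) \<noteq> 0}"
    by (rule finite_subset) simp
qed

lemma convable0_wz:
  assumes "\<And>s. \<exists>m0. \<forall>m<m0. x m (s - m) = 0"
  shows "convable0 c_wz x"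
  unfolding convable0_def
proof (intro allI)
  fix e s t :: int
  obtain m0 where m0: "x m (s + t - m) = 0" if "m < m0" for m
    using assms[of "s + t"] by auto
  have "{l. c_wz e l \<noteq> 0 \<and> x (s + l) (t - l) \<noteq> 0} \<subseteq> {m0 - s..e}"
    using m0[of "s + l" for l] by (auto simp: c_wz_def c_zw_def not_less[symmetric] split: if_splits)
  then show "finite {l. c_wz e l \<noteq> 0 \<and> x (s + l) (t - l) \<noteq> 0}"
    by (rule finite_subset) simp
qed

lemma conv0_additive:
  assumes "convable0 c x" and T: "\<And>x y. T (x + y) = T x + T y" "\<And>c x. T (scale c x) = scale c (T x)"
  shows "conv0 c e (\<lambda>m n. T (x m n)) m n = T (conv0 c e x m n)"
  unfolding conv0_def
  by (subst additive_Sum_any[of T, OF T(1)]) (use convable0D[OF assms(1)] in \<open>simp_all add: T(2)\<close>)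

lemma conv0_scale: "convable0 c x \<Longrightarrow> conv0 c e (\<lambda>m n. scale a (x m n)) m n = scale a (conv0 c e x m n)"
  by (rule conv0_additive) (simp_all add: scale_right_distrib mult.commute)

lemma conv0_diff:
  assumes "convable0 c x" "convable0 c y"
  shows "conv0 c e (\<lambda>m n. x m n - y m n) m n = conv0 c e x m n - conv0 c e y m n"
  unfolding conv0_def
  unfolding scale_right_diff_distrib by (rule Sum_any_diff; rule convable0D; fact)

definition diff2 :: "(int \<Rightarrow> int \<Rightarrow> 'v) \<Rightarrow> int \<Rightarrow> int \<Rightarrow> 'v" where
  "diff2 x = (\<lambda>m n. x (m - 1) n - x m (n - 1))"

text \<open>Finiteness is assumed at this e only: for \<open>c_zw\<close> with e \<ge> 0 it holds
  for every x, even where negative powers of z - w cannot be applied.\<close>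

lemma diff2_conv0_finite:
  assumes c: "binomial_family c" and x: "\<And>s t. finite {l. c e l \<noteq> 0 \<and> x (s + l) (t - l) \<noteq> 0}"
  shows "diff2 (conv0 c e x) = conv0 c (e + 1) x"
proof (intro ext)
  fix m n
  let ?f = "\<lambda>l. scale (c e l) (x (m - 1 - e + l) (n - l))"
  let ?g = "\<lambda>l. scale (c e l) (x (m - e + l) (n - 1 - l))"
  have "conv0 c (e + 1) x m n = Sum_any (\<lambda>l. ?f l - ?g (l - 1))"
    unfolding conv0_def binomial_familyD(1)[OF c] by (simp add: scale_left_diff_distrib algebra_simps)
  also have "\<dots> = Sum_any ?f - Sum_any (\<lambda>l. ?g (l - 1))"
  proof (rule Sum_any_diff)
    show "finite {l. ?f l \<noteq> 0}"
      by (rule finite_subset[OF _ x]) auto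
    show "finite {l. ?g (l - 1) \<noteq> 0}"
      by (rule finite_shift, rule finite_subset[OF _ x]) auto
  qed
  also have "\<dots> = diff2 (conv0 c e x) m n"
    unfolding Sum_any_shift[of ?g] by (simp add: conv0_def diff2_def)
  finally show "diff2 (conv0 c e x) m n = conv0 c (e + 1) x m n" ..
qed

lemma diff2_conv0: "binomial_family c \<Longrightarrow> convable0 c x \<Longrightarrow> diff2 (conv0 c e x) = conv0 c (e + 1) x"
  by (rule diff2_conv0_finite) (simp_all add: convable0_def)

lemma diff2_power_conv0:
  assumes "binomial_family c" "convable0 c x"
  shows "(diff2 ^^ k) (conv0 c e x) = conv0 c (e + int k) x"
  by (induction k) (simp_all add: diff2_conv0[OF assms] add.assoc add.commute[of 1])

lemma conv0_0:
  assumes "\<And>l. c 0 l = (if l = 0 then 1 else 0)"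
  shows "conv0 c 0 x = x"
proof -
  have "scale (c 0 l) (x (m - 0 + l) (n - l)) = (if l = 0 then x m n else 0)" for m n l
    by (simp add: assms)
  then show ?thesis
    by (simp add: conv0_def fun_eq_iff)
qed

lemma conv0_of_nat:
  assumes "binomial_family c" "convable0 c x" "\<And>l. c 0 l = (if l = 0 then 1 else 0)"
  shows "conv0 c (int k) x = (diff2 ^^ k) x"
  using diff2_power_conv0[OF assms(1,2), of k 0] by (simp add: conv0_0[of c, OF assms(3)])

lemma conv0_Dz:
  assumes c: "binomial_family c" and x: "convable0 c x"
  shows "scale (of_int (m + 1)) (conv0 c e x (m + 1) n) = scale (of_int e) (conv0 c (e - 1) x m n)
    + conv0 c e (\<lambda>m n. scale (of_int (m + 1)) (x (m + 1) n)) m n"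
proof -
  let ?x = "\<lambda>l. x (m + 1 - e + l) (n - l)"
  let ?f = "\<lambda>l. scale (of_int e * c (e - 1) l) (?x l)"
  let ?g = "\<lambda>l. scale (c e l) (scale (of_int (m - e + l + 1)) (?x l))"
  have fin: "finite {l. scale (c e l) (?x l) \<noteq> 0}" for e
    using convable0D[OF x, of e "m + 1 - e'" n for e'] by (auto simp: convable0_def)
  have 1: "finite {l. c e l \<noteq> 0 \<and> ?x l \<noteq> 0}" for e
    using fin[of e] by simp
  have "scale (of_int (m + 1)) (conv0 c e x (m + 1) n) = Sum_any (\<lambda>l. scale (of_int (m + 1)) (scale (c e l) (?x l)))"
    unfolding conv0_def by (rule additive_Sum_any[OF scale_right_distrib fin])
  also have "\<dots> = Sum_any (\<lambda>l. ?f l + ?g l)"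
  proof (rule Sum_any.cong)
    fix l
    \<comment> \<open>The Leibniz rule on exponents: m + 1 is the exponent e - l of z in the power
      of z - w plus the exponent m - e + l + 1 of z in x.\<close>
    have "of_int (m + 1) = of_int (e - l) + (of_int (m - e + l + 1) :: complex)"
      by simp
    then show "scale (of_int (m + 1)) (scale (c e l) (?x l)) = ?f l + ?g l"
      by (simp only: binomial_familyD(2)[OF c, symmetric] scale_scale distrib_right scale_left_distrib mult.commute[of "c e l"])
  qed
  also have "\<dots> = Sum_any ?f + Sum_any ?g"
    by (rule Sum_any.distrib; rule finite_subset[OF _ 1]) auto
  also have "Sum_any ?f = scale (of_int e) (conv0 c (e - 1) x m n)"
    unfolding conv0_def
    by (subst additive_Sum_any[OF scale_right_distrib]) (use fin[of "e - 1"] in \<open>simp_all add: algebra_simps\<close>)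
  finally show ?thesis
    by (simp add: conv0_def algebra_simps)
qed

lemma conv0_Dw:
  assumes c: "binomial_family c" and x: "convable0 c x"
  shows "scale (of_int (n + 1)) (conv0 c e x m (n + 1)) = scale (- of_int e) (conv0 c (e - 1) x m n)
    + conv0 c e (\<lambda>m n. scale (of_int (n + 1)) (x m (n + 1))) m n"
proof -
  let ?x = "\<lambda>l. x (m - e + l) (n + 1 - l)"
  let ?h = "\<lambda>l. scale (- of_int e * c (e - 1) l) (x (m - e + 1 + l) (n - l))"
  let ?f = "\<lambda>l. scale (- of_int e * c (e - 1) (l - 1)) (?x l)"
  let ?g = "\<lambda>l. scale (c e l) (scale (of_int (n - l + 1)) (?x l))"
  have fin: "finite {l. c e l \<noteq> 0 \<and> ?x l \<noteq> 0}"
    using x by (simp add: convable0_def)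
  have fin': "finite {l. c (e - 1) l \<noteq> 0 \<and> x (m - e + 1 + l) (n - l) \<noteq> 0}"
    using x by (simp add: convable0_def)
  have fh: "?f l = ?h (l - 1)" for l
    by (simp add: algebra_simps)
  have "scale (of_int (n + 1)) (conv0 c e x m (n + 1)) = Sum_any (\<lambda>l. scale (of_int (n + 1)) (scale (c e l) (?x l)))"
    unfolding conv0_def by (rule additive_Sum_any[OF scale_right_distrib]) (use fin in simp)
  also have "\<dots> = Sum_any (\<lambda>l. ?f l + ?g l)"
  proof (rule Sum_any.cong)
    fix l
    have "of_int (n + 1) = of_int l + (of_int (n - l + 1) :: complex)"
      by simp
    then show "scale (of_int (n + 1)) (scale (c e l) (?x l)) = ?f l + ?g l"
      by (simp only: binomial_familyD(3)[OF c, symmetric] scale_scale distrib_right scale_left_distrib mult.commute[of "c e l"])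
  qed
  also have "\<dots> = Sum_any ?f + Sum_any ?g"
  proof (rule Sum_any.distrib)
    show "finite {l. ?f l \<noteq> 0}"
      unfolding fh by (rule finite_shift, rule finite_subset[OF _ fin']) auto
    show "finite {l. ?g l \<noteq> 0}"
      by (rule finite_subset[OF _ fin]) auto
  qed
  also have "Sum_any ?f = Sum_any ?h"
    unfolding fh by (rule Sum_any_shift)
  also have "Sum_any ?h = scale (- of_int e) (conv0 c (e - 1) x m n)"
    unfolding conv0_def
    by (subst additive_Sum_any[OF scale_right_distrib]) (use fin' in \<open>simp_all add: algebra_simps\<close>)
  finally show ?thesis
    by (simp add: conv0_def algebra_simps)
qed

lemma Lzw_conv: "binomial_family c \<Longrightarrow> convable c X \<Longrightarrow> Lzw (conv c e X) = conv c (e + 1) X"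
  by (simp add: fun_eq_iff Lzw_def conv_conv0 convable_convable0 diff2_conv0[symmetric]) (simp add: diff2_def)

lemma Dz_conv: "binomial_family c \<Longrightarrow> convable c X \<Longrightarrow>
    Dz (conv c e X) = sc (of_int e) (conv c (e - 1) X) + conv c e (Dz X)"
  by (simp add: pointwise Dz_def sc_apply conv_conv0 convable_convable0 conv0_Dz del: of_int_add)

lemma Dw_conv: "binomial_family c \<Longrightarrow> convable c X \<Longrightarrow>
    Dw (conv c e X) = sc (- of_int e) (conv c (e - 1) X) + conv c e (Dw X)"
  by (simp add: pointwise Dw_def sc_apply conv_conv0 convable_convable0 conv0_Dw del: of_int_add)

lemma conv_0: "conv c e 0 = 0"
  by (simp add: conv_def pointwise)

end

section \<open>Locality and Dong's lemma\<close>

lemma funpow_commute_apply: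
  assumes "\<And>x. T (U x) = U (T x)"
  shows "(T ^^ a) ((U ^^ b) x) = (U ^^ b) ((T ^^ a) x)"
proof -
  have 1: "T ((U ^^ b) x) = (U ^^ b) (T x)" for x
    by (induction b) (simp_all add: assms)
  show ?thesis
    by (induction a) (simp_all add: 1)
qed

text \<open>Every term of the binomial expansion of (T - U)^(a+b) contains T^a or U^b. The induction
  avoids the expansion: T x and U x each need one factor less.\<close>

lemma nilpotent_diff:
  fixes T U :: "'a::ab_group_add \<Rightarrow> 'a"
  assumes T: "\<And>x y. T (x - y) = T x - T y" and U: "\<And>x y. U (x - y) = U x - U y"
    and comm: "\<And>x. T (U x) = U (T x)"
  shows "(T ^^ a) x = 0 \<Longrightarrow> (U ^^ b) x = 0 \<Longrightarrow> ((\<lambda>x. T x - U x) ^^ (a + b)) x = 0"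
proof (induction "a + b" arbitrary: a b x)
  case 0
  then show ?case by simp
next
  case (Suc n)
  let ?D = "\<lambda>x. T x - U x"
  have T0: "T 0 = 0" and U0: "U 0 = 0"
    using T[of 0 0] U[of 0 0] by simp_all
  have D0: "(?D ^^ k) 0 = 0" for k
    by (induction k) (simp_all add: T0 U0)
  have D_diff: "(?D ^^ k) (x - y) = (?D ^^ k) x - (?D ^^ k) y" for k x y
  proof (induction k)
    case (Suc k)
    show ?case
      by (simp add: Suc T U)
  qed simp
  show ?case
  proof (cases "a = 0 \<or> b = 0")
    case True
    then have "x = 0"
      using Suc.prems by auto
    then show ?thesis
      by (simp add: D0)
  next
    case False
    then obtain a' b' where ab: "a = Suc a'" "b = Suc b'"
      by (meson not0_implies_Suc)
    have "(?D ^^ (a' + b)) (T x) = 0"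
    proof (rule Suc.hyps(1))
      show "(T ^^ a') (T x) = 0"
        using Suc.prems(1) by (simp add: ab funpow_swap1)
      show "(U ^^ b) (T x) = 0"
        using funpow_commute_apply[of T U 1 b x, OF comm] Suc.prems(2) by (simp add: T0)
    qed (use Suc.hyps(2) ab in simp)
    moreover have "(?D ^^ (a + b')) (U x) = 0"
    proof (rule Suc.hyps(1))
      show "(U ^^ b') (U x) = 0"
        using Suc.prems(2) by (simp add: ab funpow_swap1)
      show "(T ^^ a) (U x) = 0"
        using funpow_commute_apply[of T U a 1 x, OF comm] Suc.prems(1) by (simp add: U0)
    qed (use Suc.hyps(2) ab in simp)
    moreover have "(?D ^^ (a + b)) x = (?D ^^ (a' + b)) (T x) - (?D ^^ (a + b')) (U x)"
    proof -
      have "a + b = Suc (a' + b)" and *: "a + b' = a' + b"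
        by (simp_all add: ab)
      then have "(?D ^^ (a + b)) x = (?D ^^ (a' + b)) (?D x)"
        by (simp only: funpow_Suc_right o_apply)
      then show ?thesis
        by (simp only: D_diff *)
    qed
    ultimately show ?thesis
      by simp
  qed
qed

section \<open>Mutual locality of operator-valued series in one even variable\<close>

context complex_vector_space
begin

definition lop :: "('v \<Rightarrow> 'v) \<Rightarrow> bool" where
  "lop T \<longleftrightarrow> (\<forall>x y. T (x + y) = T x + T y) \<and> (\<forall>c x. T (scale c x) = scale c (T x))"

lemma lopD:
  assumes "lop T"
  shows "T (x + y) = T x + T y" "T (scale c x) = scale c (T x)" "T 0 = 0" "T (x - y) = T x - T y"
proof -
  show add: "T (x + y) = T x + T y" for x y
    using assms by (auto simp: lop_def)
  show sc: "T (scale c x) = scale c (T x)" for c x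
    using assms by (auto simp: lop_def)
  show "T 0 = 0"
    using sc[of 0 0] by simp
  show "T (x - y) = T x - T y"
    using add[of x "- y"] sc[of "- 1" y] by simp
qed

lemma linear_lop: "Vector_Spaces.linear scale scale T \<Longrightarrow> lop T"
  by (simp add: lop_def Vector_Spaces.linear_def module_hom_def module_hom_axioms_def)

definition field :: "(int \<Rightarrow> 'v \<Rightarrow> 'v) \<Rightarrow> bool" where
  "field f \<longleftrightarrow> (\<forall>n. lop (f n)) \<and> (\<forall>v. \<exists>n0. \<forall>n<n0. f n v = 0)"

lemma diff2_diff: "diff2 (x - y) = diff2 x - diff2 y"
  by (simp add: pointwise diff2_def)

lemma diff2_power_0: "(diff2 ^^ k) 0 = 0"
  by (induction k) (simp_all add: diff2_def pointwise)

lemma diff2_power_mono: "(diff2 ^^ r) x = 0 \<Longrightarrow> r \<le> k \<Longrightarrow> (diff2 ^^ k) x = 0"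
  using diff2_power_0 by (metis comp_apply funpow_add le_add_diff_inverse2)

lemma diff2_power_lop:
  assumes "lop T"
  shows "(diff2 ^^ k) (\<lambda>m n. T (x m n)) = (\<lambda>m n. T ((diff2 ^^ k) x m n))"
  by (induction k) (simp_all add: diff2_def lopD[OF assms])

lemma diff2_power_add: "(diff2 ^^ k) (x + y) = (diff2 ^^ k) x + (diff2 ^^ k) y"
  by (induction k) (simp_all add: diff2_def pointwise)

text \<open>The sign \<epsilon> is a parameter because the components of one superfield have
  different parities.\<close>

definition loc_upto :: "nat \<Rightarrow> complex \<Rightarrow> (int \<Rightarrow> 'v \<Rightarrow> 'v) \<Rightarrow> (int \<Rightarrow> 'v \<Rightarrow> 'v) \<Rightarrow> bool" where
  "loc_upto r \<epsilon> f g \<longleftrightarrow> (\<forall>v. (diff2 ^^ r) (\<lambda>m n. f m (g n v) - scale \<epsilon> (g n (f m v))) = 0)"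

definition loc :: "complex \<Rightarrow> (int \<Rightarrow> 'v \<Rightarrow> 'v) \<Rightarrow> (int \<Rightarrow> 'v \<Rightarrow> 'v) \<Rightarrow> bool" where
  "loc \<epsilon> f g \<longleftrightarrow> (\<exists>r. loc_upto r \<epsilon> f g)"

lemma loc_upto_mono: "loc_upto r \<epsilon> f g \<Longrightarrow> r \<le> k \<Longrightarrow> loc_upto k \<epsilon> f g"
  by (auto simp: loc_upto_def intro: diff2_power_mono)

text \<open>The ordinary e-th product of fields in one even variable; the index - 1 is the residue
  in z.\<close>

definition nprod :: "complex \<Rightarrow> int \<Rightarrow> (int \<Rightarrow> 'v \<Rightarrow> 'v) \<Rightarrow> (int \<Rightarrow> 'v \<Rightarrow> 'v) \<Rightarrow> int \<Rightarrow> 'v \<Rightarrow> 'v" where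
  "nprod \<epsilon> e f g n v = conv0 c_zw e (\<lambda>m n. f m (g n v)) (- 1) n
     - scale \<epsilon> (conv0 c_wz e (\<lambda>m n. g n (f m v)) (- 1) n)"

lemma convable0_field_zw:
  assumes "field g" "\<And>m. T m 0 = 0"
  shows "convable0 c_zw (\<lambda>m n. T m (g n v))"
proof (rule convable0_zw)
  fix s
  obtain n0 where "\<forall>n<n0. g n v = 0"
    using assms(1) unfolding field_def by blast
  then show "\<exists>n0. \<forall>n<n0. T (s - n) (g n v) = 0"
    by (intro exI[of _ n0]) (simp add: assms(2))
qed

lemma convable0_field_wz:
  assumes "field f" "\<And>n. T n 0 = 0"
  shows "convable0 c_wz (\<lambda>m n. T n (f m v))"
proof (rule convable0_wz)
  fix s
  obtain m0 where "\<forall>m<m0. f m v = 0"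
    using assms(1) unfolding field_def by blast
  then show "\<exists>m0. \<forall>m<m0. T (s - m) (f m v) = 0"
    by (intro exI[of _ m0]) (simp add: assms(2))
qed

lemma field_lop: "field f \<Longrightarrow> lop (f n)"
  by (simp add: field_def)

lemma field_0 [simp]: "field f \<Longrightarrow> f n 0 = 0"
  by (simp add: field_lop lopD)

lemma nprod_lop:
  assumes f: "field f" and g: "field g"
  shows "lop (nprod \<epsilon> e f g n)"
proof -
  have fg: "convable0 c_zw (\<lambda>m n. f m (g n v))" and gf: "convable0 c_wz (\<lambda>m n. g n (f m v))" for v
    using f g by (auto intro!: convable0_field_zw convable0_field_wz)
  note lf = lopD[OF field_lop[OF f]] and lg = lopD[OF field_lop[OF g]]
  have "nprod \<epsilon> e f g n (x - y) = nprod \<epsilon> e f g n x - nprod \<epsilon> e f g n y" for x y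
    by (simp add: nprod_def lf lg conv0_diff[OF fg fg] conv0_diff[OF gf gf] scale_right_diff_distrib)
  note diff = this
  have sc: "nprod \<epsilon> e f g n (scale c x) = scale c (nprod \<epsilon> e f g n x)" for c x
    by (simp add: nprod_def lf lg conv0_scale[OF fg] conv0_scale[OF gf] scale_right_diff_distrib mult.commute)
  have "nprod \<epsilon> e f g n (x + y) = nprod \<epsilon> e f g n x + nprod \<epsilon> e f g n y" for x y
    using diff[of x "- y"] sc[of "- 1" y] by simp
  with sc show ?thesis
    by (simp add: lop_def)
qed

section \<open>Series in three even variables and Dong's lemma\<close>

definition d12 :: "(int \<Rightarrow> int \<Rightarrow> int \<Rightarrow> 'v) \<Rightarrow> int \<Rightarrow> int \<Rightarrow> int \<Rightarrow> 'v" where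
  "d12 F = (\<lambda>m n l. F (m - 1) n l - F m (n - 1) l)"

definition d13 :: "(int \<Rightarrow> int \<Rightarrow> int \<Rightarrow> 'v) \<Rightarrow> int \<Rightarrow> int \<Rightarrow> int \<Rightarrow> 'v" where
  "d13 F = (\<lambda>m n l. F (m - 1) n l - F m n (l - 1))"

definition d23 :: "(int \<Rightarrow> int \<Rightarrow> int \<Rightarrow> 'v) \<Rightarrow> int \<Rightarrow> int \<Rightarrow> int \<Rightarrow> 'v" where
  "d23 F = (\<lambda>m n l. F m (n - 1) l - F m n (l - 1))"

lemma d_diff: "d12 (F - G) = d12 F - d12 G" "d13 (F - G) = d13 F - d13 G" "d23 (F - G) = d23 F - d23 G"
  by (simp_all add: pointwise d12_def d13_def d23_def)

lemma d_commute: "d12 (d13 F) = d13 (d12 F)" "d12 (d23 F) = d23 (d12 F)" "d13 (d23 F) = d23 (d13 F)"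
  by (simp_all add: pointwise d12_def d13_def d23_def)

lemma d23_eq: "d23 = (\<lambda>F. d13 F - d12 F)"
  by (simp add: pointwise d12_def d13_def d23_def)

lemma d12_power: "(d12 ^^ k) F m n l = (diff2 ^^ k) (\<lambda>m n. F m n l) m n"
  by (induction k arbitrary: m n l) (simp_all add: d12_def diff2_def)

lemma d13_power: "(d13 ^^ k) F m n l = (diff2 ^^ k) (\<lambda>m l. F m n l) m l"
  by (induction k arbitrary: m n l) (simp_all add: d13_def diff2_def)

lemma d23_power: "(d23 ^^ k) F m n l = (diff2 ^^ k) (\<lambda>n l. F m n l) n l"
  by (induction k arbitrary: m n l) (simp_all add: d23_def diff2_def)

lemma d_power_0: "(d13 ^^ k) 0 = 0" "(d23 ^^ k) 0 = 0" "(d12 ^^ k) 0 = 0"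
  by (induction k) (simp_all add: d13_def d23_def d12_def pointwise)

lemma d_power_diff: "(d13 ^^ k) (F - G) = (d13 ^^ k) F - (d13 ^^ k) G"
  "(d23 ^^ k) (F - G) = (d23 ^^ k) F - (d23 ^^ k) G"
  "(d12 ^^ k) (F - G) = (d12 ^^ k) F - (d12 ^^ k) G"
  by (induction k) (simp_all add: d_diff)

definition conv12 :: "(int \<Rightarrow> int \<Rightarrow> complex) \<Rightarrow> int \<Rightarrow> (int \<Rightarrow> int \<Rightarrow> int \<Rightarrow> 'v) \<Rightarrow> int \<Rightarrow> int \<Rightarrow> int \<Rightarrow> 'v" where
  "conv12 c e F = (\<lambda>m n l. conv0 c e (\<lambda>m n. F m n l) m n)"

definition convable12 :: "(int \<Rightarrow> int \<Rightarrow> complex) \<Rightarrow> (int \<Rightarrow> int \<Rightarrow> int \<Rightarrow> 'v) \<Rightarrow> bool" where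
  "convable12 c F \<longleftrightarrow> (\<forall>l. convable0 c (\<lambda>m n. F m n l))"

lemma convable12_shift:
  "convable12 c F \<Longrightarrow> convable12 c (\<lambda>m n l. F (m - 1) n l)"
  "convable12 c F \<Longrightarrow> convable12 c (\<lambda>m n l. F m (n - 1) l)"
  "convable12 c F \<Longrightarrow> convable12 c (\<lambda>m n l. F m n (l - 1))"
proof -
  assume F: "convable12 c F"
  then have *: "convable0 c (\<lambda>m n. F m n l)" for l
    by (simp add: convable12_def)
  show "convable12 c (\<lambda>m n l. F (m - 1) n l)"
    unfolding convable12_def
    by (intro allI, rule convable0_subset[OF *, of _ "- 1" 0]) (simp add: algebra_simps)
  show "convable12 c (\<lambda>m n l. F m (n - 1) l)"
    unfolding convable12_def
    by (intro allI, rule convable0_subset[OF *, of _ 0 "- 1"]) (simp add: algebra_simps)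
  show "convable12 c (\<lambda>m n l. F m n (l - 1))"
    using F by (simp add: convable12_def)
qed

lemma conv12_diff: "convable12 c F \<Longrightarrow> convable12 c G \<Longrightarrow> conv12 c e (F - G) = conv12 c e F - conv12 c e G"
  by (simp add: pointwise conv12_def convable12_def conv0_diff)

lemma convable12_diff: "convable12 c F \<Longrightarrow> convable12 c G \<Longrightarrow> convable12 c (F - G)"
  by (simp add: convable12_def convable0_diff minus_apply)

lemma d13_conv12: "convable12 c F \<Longrightarrow> d13 (conv12 c e F) = conv12 c e (d13 F) \<and> convable12 c (d13 F)"
proof -
  assume F: "convable12 c F"
  have *: "d13 F = (\<lambda>m n l. F (m - 1) n l) - (\<lambda>m n l. F m n (l - 1))" for F :: "int \<Rightarrow> int \<Rightarrow> int \<Rightarrow> 'v"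
    by (simp add: pointwise d13_def)
  show ?thesis
    unfolding * conv12_diff[OF convable12_shift(1)[OF F] convable12_shift(3)[OF F]]
    using convable12_diff[OF convable12_shift(1)[OF F] convable12_shift(3)[OF F]]
    by (simp add: pointwise conv12_def conv0_def algebra_simps)
qed

lemma d23_conv12: "convable12 c F \<Longrightarrow> d23 (conv12 c e F) = conv12 c e (d23 F) \<and> convable12 c (d23 F)"
proof -
  assume F: "convable12 c F"
  have *: "d23 F = (\<lambda>m n l. F m (n - 1) l) - (\<lambda>m n l. F m n (l - 1))" for F :: "int \<Rightarrow> int \<Rightarrow> int \<Rightarrow> 'v"
    by (simp add: pointwise d23_def)
  show ?thesis
    unfolding * conv12_diff[OF convable12_shift(2)[OF F] convable12_shift(3)[OF F]]
    using convable12_diff[OF convable12_shift(2)[OF F] convable12_shift(3)[OF F]]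
    by (simp add: pointwise conv12_def conv0_def algebra_simps)
qed

lemma d13_power_conv12:
  "convable12 c F \<Longrightarrow> (d13 ^^ k) (conv12 c e F) = conv12 c e ((d13 ^^ k) F) \<and> convable12 c ((d13 ^^ k) F)"
  by (induction k) (simp_all add: d13_conv12)

lemma d23_power_conv12:
  "convable12 c F \<Longrightarrow> (d23 ^^ k) (conv12 c e F) = conv12 c e ((d23 ^^ k) F) \<and> convable12 c ((d23 ^^ k) F)"
  by (induction k) (simp_all add: d23_conv12)

lemma d12_power_conv12:
  assumes "binomial_family c" "\<And>l. c 0 l = (if l = 0 then 1 else 0)" "convable12 c F" "e + int s = int t"
  shows "(d12 ^^ s) (conv12 c e F) = (d12 ^^ t) F"
proof (intro ext)
  fix m n l
  have F: "convable0 c (\<lambda>m n. F m n l)"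
    using assms(3) by (simp add: convable12_def)
  show "(d12 ^^ s) (conv12 c e F) m n l = (d12 ^^ t) F m n l"
    unfolding d12_power conv12_def
    using diff2_power_conv0[OF assms(1) F, of s e] conv0_of_nat[OF assms(1) F assms(2), of t] assms(4)
    by simp
qed

definition sc3 :: "complex \<Rightarrow> (int \<Rightarrow> int \<Rightarrow> int \<Rightarrow> 'v) \<Rightarrow> int \<Rightarrow> int \<Rightarrow> int \<Rightarrow> 'v" where
  "sc3 a F = (\<lambda>m n l. scale a (F m n l))"

lemma d_power_sc3: "(d13 ^^ k) (sc3 a F) = sc3 a ((d13 ^^ k) F)" "(d23 ^^ k) (sc3 a F) = sc3 a ((d23 ^^ k) F)"
   "(d12 ^^ k) (sc3 a F) = sc3 a ((d12 ^^ k) F)"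
  by (induction k) (simp_all add: sc3_def d13_def d23_def d12_def fun_eq_iff scale_right_diff_distrib)

lemma sc3_simps: "sc3 a 0 = 0" "sc3 a (sc3 b F) = sc3 (a * b) F" "sc3 a (F - G) = sc3 a F - sc3 a G"
  by (simp_all add: sc3_def pointwise scale_right_diff_distrib)

lemma conv12_sc3: "convable12 c F \<Longrightarrow> conv12 c e (sc3 a F) = sc3 a (conv12 c e F)"
  by (simp add: conv12_def sc3_def fun_eq_iff convable12_def conv0_scale)

text \<open>\<open>(z\<^sub>1 - z\<^sub>2)^s\<close> kills the commutator with \<open>h\<close> for large \<open>s\<close>, as it turns both expansions of \<open>(z\<^sub>1 - z\<^sub>2)^e\<close> into
  the same polynomial and \<open>f\<close> and \<open>g\<close> are mutually local; \<open>(z\<^sub>1 - z\<^sub>3)^r (z\<^sub>2 - z\<^sub>3)^r\<close> kills it because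
  \<open>h\<close> is local with \<open>f\<close> and \<open>g\<close>. Hence so does a power of \<open>z\<^sub>2 - z\<^sub>3 = (z\<^sub>1 - z\<^sub>3) - (z\<^sub>1 - z\<^sub>2)\<close>.\<close>

lemma Dong:
  assumes f: "field f" and g: "field g" and h: "field h"
    and fg: "loc \<epsilon>1 f g" and fh: "loc \<epsilon>2 f h" and gh: "loc \<epsilon>3 g h"
  shows "loc (\<epsilon>2 * \<epsilon>3) (nprod \<epsilon>1 e f g) h"
proof -
  obtain r where fg: "loc_upto r \<epsilon>1 f g"
    using fg by (auto simp: loc_def)
  obtain a where fh: "loc_upto a \<epsilon>2 f h"
    using fh by (auto simp: loc_def)
  obtain b where gh: "loc_upto b \<epsilon>3 g h"
    using gh by (auto simp: loc_def)
  \<comment> \<open>Chosen so that t = e + s is nonnegative and at least r: then (z - w)^s times (z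
    - w)^e is a polynomial that kills the commutator of f and g.\<close>
  define s where "s = nat (int r - e)"
  define t where "t = nat (e + int s)"
  have st: "e + int s = int t" "r \<le> t"
    unfolding s_def t_def by auto
  note fg = loc_upto_mono[OF fg st(2)]
  note lf = lopD[OF field_lop[OF f]] and lg = lopD[OF field_lop[OF g]] and lh = lopD[OF field_lop[OF h]]
  have "loc_upto (s + a + b) (\<epsilon>2 * \<epsilon>3) (nprod \<epsilon>1 e f g) h"
    unfolding loc_upto_def
  proof
    fix v
    \<comment> \<open>h moves left past one field at a time: it is innermost in F, in the middle in
      M, outermost in G. Index 1 is the order f, g and index 2 the order g, f.\<close>
    define F1 F2 G1 G2 M1 M2 where
      "F1 = (\<lambda>m n l. f m (g n (h l v)))" and "F2 = (\<lambda>m n l. g n (f m (h l v)))" and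
      "G1 = (\<lambda>m n l. h l (f m (g n v)))" and "G2 = (\<lambda>m n l. h l (g n (f m v)))" and
      "M1 = (\<lambda>m n l. f m (h l (g n v)))" and "M2 = (\<lambda>m n l. g n (h l (f m v)))"
    note defs = F1_def F2_def G1_def G2_def M1_def M2_def
    define A where "A = conv12 c_zw e F1 - sc3 \<epsilon>1 (conv12 c_wz e F2)"
    define B where "B = conv12 c_zw e G1 - sc3 \<epsilon>1 (conv12 c_wz e G2)"
    define C where "C = A - sc3 (\<epsilon>2 * \<epsilon>3) B"
    have cF1: "convable12 c_zw F1" and cG1: "convable12 c_zw G1"
      unfolding convable12_def defs using f g h
      by (auto intro!: convable0_field_zw[where T = "\<lambda>m x. f m x"] convable0_field_zw[where T = "\<lambda>m x. h _ (f m x)"])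
    have cF2: "convable12 c_wz F2" and cG2: "convable12 c_wz G2"
      unfolding convable12_def defs using f g h
      by (auto intro!: convable0_field_wz[where T = "\<lambda>m x. g m x"] convable0_field_wz[where T = "\<lambda>m x. h _ (g m x)"])
    have dF: "(d12 ^^ t) (F1 - sc3 \<epsilon>1 F2) = 0"
      using fg by (simp add: pointwise d12_power defs sc3_def loc_upto_def)
    have dG: "(d12 ^^ t) (G1 - sc3 \<epsilon>1 G2) = 0"
    proof -
      have "G1 - sc3 \<epsilon>1 G2 = (\<lambda>m n l. h l (f m (g n v) - scale \<epsilon>1 (g n (f m v))))"
        by (simp add: pointwise defs sc3_def lh)
      then show ?thesis
        using fg by (intro ext) (simp only: d12_power diff2_power_lop[OF field_lop[OF h]] loc_upto_def zero_fun_apply lh(3))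
    qed
    have dA: "(d12 ^^ s) A = 0"
      using dF unfolding A_def d_power_diff d_power_sc3
      by (simp add: d12_power_conv12[OF binomial_family_zw c_zw_0 cF1 st(1)]
          d12_power_conv12[OF binomial_family_wz c_wz_0 cF2 st(1)])
    have dB: "(d12 ^^ s) B = 0"
      using dG unfolding B_def d_power_diff d_power_sc3
      by (simp add: d12_power_conv12[OF binomial_family_zw c_zw_0 cG1 st(1)]
          d12_power_conv12[OF binomial_family_wz c_wz_0 cG2 st(1)])
    have dC: "(d12 ^^ s) C = 0"
      unfolding C_def d_power_diff d_power_sc3 dA dB by (simp add: sc3_simps)
    have FM1: "(d23 ^^ b) (F1 - sc3 \<epsilon>3 M1) = 0"
    proof -
      have "F1 - sc3 \<epsilon>3 M1 = (\<lambda>m n l. f m (g n (h l v) - scale \<epsilon>3 (h l (g n v))))"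
        by (simp add: pointwise defs sc3_def lf)
      then show ?thesis
        using gh by (intro ext) (simp only: d23_power diff2_power_lop[OF field_lop[OF f]] loc_upto_def zero_fun_apply lf(3))
    qed
    have MG1: "(d13 ^^ a) (M1 - sc3 \<epsilon>2 G1) = 0"
      using fh by (simp add: pointwise d13_power defs sc3_def loc_upto_def)
    have FM2: "(d13 ^^ a) (F2 - sc3 \<epsilon>2 M2) = 0"
    proof -
      have "F2 - sc3 \<epsilon>2 M2 = (\<lambda>m n l. g n (f m (h l v) - scale \<epsilon>2 (h l (f m v))))"
        by (simp add: pointwise defs sc3_def lg)
      then show ?thesis
        using fh by (intro ext) (simp only: d13_power diff2_power_lop[OF field_lop[OF g]] loc_upto_def zero_fun_apply lg(3))
    qed
    have MG2: "(d23 ^^ b) (M2 - sc3 \<epsilon>3 G2) = 0"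
      using gh by (simp add: pointwise d23_power defs sc3_def loc_upto_def)
    let ?P = "\<lambda>F. (d13 ^^ a) ((d23 ^^ b) F)"
    have P_diff: "?P (F - G) = ?P F - ?P G" and P_sc3: "?P (sc3 x F) = sc3 x (?P F)" for F G x
      by (simp_all add: d_power_diff d_power_sc3)
    have comm: "?P F = (d23 ^^ b) ((d13 ^^ a) F)" for F
      by (rule funpow_commute_apply) (rule d_commute)
    have P1: "?P F1 = sc3 (\<epsilon>2 * \<epsilon>3) (?P G1)"
    proof -
      have "?P (F1 - sc3 \<epsilon>3 M1) = 0"
        by (simp add: FM1 d_power_0)
      moreover have "?P (M1 - sc3 \<epsilon>2 G1) = 0"
        by (simp add: comm MG1 d_power_0)
      ultimately show ?thesis
        by (simp add: P_diff P_sc3 sc3_simps mult.commute)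
    qed
    have P2: "?P F2 = sc3 (\<epsilon>2 * \<epsilon>3) (?P G2)"
    proof -
      have "?P (F2 - sc3 \<epsilon>2 M2) = 0"
        by (simp add: comm FM2 d_power_0)
      moreover have "?P (M2 - sc3 \<epsilon>3 G2) = 0"
        by (simp add: MG2 d_power_0)
      ultimately show ?thesis
        by (simp add: P_diff P_sc3 sc3_simps mult.commute)
    qed
    have P_conv: "?P (conv12 c e F) = conv12 c e (?P F) \<and> convable12 c (?P F)" if "convable12 c F" for c F
      using d23_power_conv12[OF that, of b e] d13_power_conv12[of c "(d23 ^^ b) F" a e] by simp
    have "?P A = sc3 (\<epsilon>2 * \<epsilon>3) (?P B)"
      unfolding A_def B_def P_diff P_sc3
      using P_conv[OF cF1] P_conv[OF cF2] P_conv[OF cG1] P_conv[OF cG2]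
      by (simp add: P1 P2 conv12_sc3 sc3_simps mult.commute)
    then have PC: "?P C = 0"
      unfolding C_def P_diff P_sc3 by simp
    have d12C: "(d12 ^^ s) ((d23 ^^ b) C) = 0"
      using funpow_commute_apply[of d12 d23 s b C, OF d_commute(2)] dC by (simp add: d_power_0)
    have "((\<lambda>F. d13 F - d12 F) ^^ (a + s)) ((d23 ^^ b) C) = 0"
      using nilpotent_diff[OF d_diff(2) d_diff(1) d_commute(1)[symmetric] PC d12C] .
    then have "(d23 ^^ (a + s + b)) C = 0"
      unfolding d23_eq[symmetric] by (simp add: funpow_add)
    then have 0: "(d23 ^^ (s + a + b)) C = 0"
      by (simp add: add_ac)
    have hG: "h l (conv0 c_zw e (\<lambda>m n. f m (g n v)) m n) = conv0 c_zw e (\<lambda>m n. G1 m n l) m n"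
      "h l (conv0 c_wz e (\<lambda>m n. g n (f m v)) m n) = conv0 c_wz e (\<lambda>m n. G2 m n l) m n" for l m n
      unfolding defs
      by (subst conv0_additive[where T = "h l"];
          use f g in \<open>auto intro!: convable0_field_zw convable0_field_wz simp: lh\<close>)+
    have "nprod \<epsilon>1 e f g n (h l v) - scale (\<epsilon>2 * \<epsilon>3) (h l (nprod \<epsilon>1 e f g n v)) = C (- 1) n l" for n l
      unfolding nprod_def C_def A_def B_def by (simp add: minus_apply sc3_def conv12_def lh hG) (simp add: defs)
    then have "(\<lambda>n l. nprod \<epsilon>1 e f g n (h l v) - scale (\<epsilon>2 * \<epsilon>3) (h l (nprod \<epsilon>1 e f g n v))) = C (- 1)"
      by (simp add: fun_eq_iff)
    moreover have "(diff2 ^^ k) (C (- 1)) n l = (d23 ^^ k) C (- 1) n l" for k n l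
      by (simp add: d23_power)
    ultimately show "(diff2 ^^ (s + a + b)) (\<lambda>n l. nprod \<epsilon>1 e f g n (h l v)
        - scale (\<epsilon>2 * \<epsilon>3) (h l (nprod \<epsilon>1 e f g n v))) = 0"
      using 0 by (simp add: fun_eq_iff zero_fun_apply)
  qed
  then show ?thesis
    by (auto simp: loc_def)
qed

section \<open>Closure properties of locality and the uniqueness argument\<close>

lemma loc_scale: "field h \<Longrightarrow> loc \<epsilon> f h \<Longrightarrow> loc \<epsilon> (\<lambda>n v. scale c (f n v)) h"
proof -
  assume h: "field h" and "loc \<epsilon> f h"
  then obtain r where r: "\<And>v. (diff2 ^^ r) (\<lambda>m n. f m (h n v) - scale \<epsilon> (h n (f m v))) = 0"
    by (auto simp: loc_def loc_upto_def)
  have "lop (scale c)"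
    by (simp add: lop_def scale_right_distrib mult.commute)
  moreover have "(\<lambda>m n. scale c (f m (h n v)) - scale \<epsilon> (h n (scale c (f m v)))) =
      (\<lambda>m n. scale c (f m (h n v) - scale \<epsilon> (h n (f m v))))" for v
    by (simp add: fun_eq_iff lopD[OF field_lop[OF h]] scale_right_diff_distrib mult.commute)
  moreover have "(diff2 ^^ r) (\<lambda>m n. scale c (f m (h n v) - scale \<epsilon> (h n (f m v)))) = 0" for v
    unfolding diff2_power_lop[OF \<open>lop (scale c)\<close>] r by (simp add: pointwise)
  ultimately have "loc_upto r \<epsilon> (\<lambda>n v. scale c (f n v)) h"
    by (simp add: loc_upto_def)
  then show ?thesis
    by (auto simp: loc_def)
qed

lemma loc_add: "field h \<Longrightarrow> loc \<epsilon> f h \<Longrightarrow> loc \<epsilon> g h \<Longrightarrow> loc \<epsilon> (\<lambda>n v. f n v + g n v) h"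
proof -
  assume h: "field h" and "loc \<epsilon> f h" "loc \<epsilon> g h"
  then obtain r s where "loc_upto r \<epsilon> f h" "loc_upto s \<epsilon> g h"
    by (auto simp: loc_def)
  then have "loc_upto (max r s) \<epsilon> f h" "loc_upto (max r s) \<epsilon> g h"
    by (auto intro: loc_upto_mono)
  moreover have "(\<lambda>m n. f m (h n v) + g m (h n v) - scale \<epsilon> (h n (f m v + g m v))) =
      (\<lambda>m n. f m (h n v) - scale \<epsilon> (h n (f m v))) + (\<lambda>m n. g m (h n v) - scale \<epsilon> (h n (g m v)))" for v
    by (simp add: pointwise lopD[OF field_lop[OF h]] scale_right_distrib)
  ultimately have "loc_upto (max r s) \<epsilon> (\<lambda>n v. f n v + g n v) h"
    by (simp add: loc_upto_def diff2_power_add)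
  then show ?thesis
    by (auto simp: loc_def)
qed

lemma loc_0: "field h \<Longrightarrow> loc \<epsilon> (\<lambda>n v. 0) h"
  unfolding loc_def loc_upto_def by (intro exI[of _ 0]) (simp add: pointwise)

lemma loc_diff: "field h \<Longrightarrow> loc \<epsilon> f h \<Longrightarrow> loc \<epsilon> g h \<Longrightarrow> loc \<epsilon> (\<lambda>n v. f n v - g n v) h"
  using loc_add[of h \<epsilon> f "\<lambda>n v. scale (- 1) (g n v)"] loc_scale[of h \<epsilon> g "- 1"] by simp

lemma loc_sum:
  assumes "field h"
  shows "(\<And>a. a \<in> A \<Longrightarrow> loc \<epsilon> (f a) h) \<Longrightarrow> loc \<epsilon> (\<lambda>n v. \<Sum>a\<in>A. f a n v) h"
proof (induction A rule: infinite_finite_induct)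
  case (insert a A)
  then show ?case
    using loc_add[OF assms, of \<epsilon> "f a"] by simp
qed (simp_all add: loc_0 assms)

text \<open>One more power suffices, because (z - w)^k \<partial>/\<partial>z =
  \<partial>/\<partial>z (z - w)^k - k (z - w)^(k-1).\<close>

lemma loc_deriv:
  assumes h: "field h" and "loc \<epsilon> f h"
  shows "loc \<epsilon> (\<lambda>n v. scale (of_int (n + 1)) (f (n + 1) v)) h"
proof -
  define D where "D = (\<lambda>x (m::int) (n::int). scale (of_int (m + 1)) (x (m + 1) n :: 'v))"
  have D: "(diff2 ^^ k) (D x) = D ((diff2 ^^ k) x) - (\<lambda>m n. scale (of_nat k) ((diff2 ^^ (k - 1)) x m n))" for k x
  proof (induction k)
    case (Suc k)
    have 1: "diff2 (D y) = D (diff2 y) - y" for y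
      by (simp add: pointwise D_def diff2_def algebra_simps)
    have 2: "diff2 (\<lambda>m n. scale (of_nat k) ((diff2 ^^ (k - Suc 0)) x m n)) = (\<lambda>m n. scale (of_nat k) ((diff2 ^^ k) x m n))"
      by (cases k) (simp_all add: diff2_def fun_eq_iff scale_right_diff_distrib)
    have "(diff2 ^^ Suc k) (D x) = D ((diff2 ^^ Suc k) x) - (diff2 ^^ k) x - (\<lambda>m n. scale (of_nat k) ((diff2 ^^ k) x m n))"
      using Suc by (simp add: diff2_diff 1 2)
    then show ?case
      by (simp add: pointwise scale_left_distrib)
  qed (simp add: pointwise)
  obtain r where r: "\<And>v. (diff2 ^^ r) (\<lambda>m n. f m (h n v) - scale \<epsilon> (h n (f m v))) = 0"
    using assms(2) by (auto simp: loc_def loc_upto_def)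
  have "(\<lambda>m n. scale (of_int (m + 1)) (f (m + 1) (h n v)) - scale \<epsilon> (h n (scale (of_int (m + 1)) (f (m + 1) v)))) =
      D (\<lambda>m n. f m (h n v) - scale \<epsilon> (h n (f m v)))" for v
    by (simp add: fun_eq_iff D_def lopD[OF field_lop[OF h]] scale_right_diff_distrib mult.commute)
  moreover have "(diff2 ^^ Suc r) (D x) = 0" if "(diff2 ^^ r) x = 0" for x
    using that by (simp add: D del: funpow.simps) (simp add: pointwise D_def diff2_def)
  ultimately have "loc_upto (Suc r) \<epsilon> (\<lambda>n v. scale (of_int (n + 1)) (f (n + 1) v)) h"
    unfolding loc_upto_def using r by simp
  then show ?thesis
    by (auto simp: loc_def)
qed

text \<open>D(z) kills v, so locality reads (z - w)^r D(z) h(w) v = 0. As h(w) v has no negative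
  powers of w, one may set w = 0 and cancel z^r.\<close>

lemma loc_unique:
  assumes h: "field h" and D: "lop (D m)" and loc: "loc \<epsilon> D h"
    and "\<And>m. D m v = 0" and hv: "\<And>n. n < 0 \<Longrightarrow> h n v = 0" and D0: "\<And>m. D m 0 = 0"
  shows "D m (h 0 v) = 0"
proof -
  define x where "x = (\<lambda>m n. D m (h n v))"
  obtain r where "(diff2 ^^ r) (\<lambda>m n. D m (h n v) - scale \<epsilon> (h n (D m v))) = 0"
    using loc unfolding loc_def loc_upto_def by blast
  then have r: "(diff2 ^^ r) x = 0"
    using assms(4) h by (simp add: x_def)
  have "(\<forall>m n. n < 0 \<longrightarrow> (diff2 ^^ k) x m n = 0) \<and> (\<forall>m. (diff2 ^^ k) x m 0 = x (m - int k) 0)" for k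
    by (induction k) (auto simp: x_def hv D0 diff2_def algebra_simps)
  from this[of r] have "x (m + int r - int r) 0 = 0"
    using r by (metis zero_fun_apply)
  then show ?thesis
    by (simp add: x_def)
qed

end

section \<open>The derivatives of the delta function\<close>

lemma bit_add_self [simp]: "x + x = (0::bit)"
  by (cases x) simp_all

lemma shuffle_sign_to_singleton:
  fixes J :: "'n::{finite,linorder} set"
  assumes "\<And>j. j \<in> J \<Longrightarrow> i < j"
  shows "shuffle_sign J {i} = set_sign J"
proof -
  have "i \<notin> J"
    using assms by blast
  then have "shuffle_sign {i} J * shuffle_sign J {i} = koszul (par {i} * par J)"
    by (intro shuffle_sign_commute) auto
  moreover have "shuffle_sign {i} J = 1"
    unfolding shuffle_sign_singleton_left using assms by (rule pos_sign_less)
  moreover have "par {i} = 1"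
    by simp
  ultimately show ?thesis
    by (simp only: mult_1_left koszul_par)
qed

text \<open>The plain z - w in \<open>delta\<close> may be replaced by z - w - \<Sum> \<theta>^i
  \<zeta>^i, since the full odd product kills the correction.\<close>

lemma delta_eq: "delta = C.ZWs (hom2 c_delta) (- 1) UNIV"
  unfolding delta_def exp_diff_eq diff_odd_prod_eq C.ZWs_UNIV C_conv_HJ[symmetric]
  by (rule smult2_hom2, rule C_conv_Grassmann(1), rule tensor_HJ, rule tensor_one2)

lemma d_w_eq: "d_w = C.Dw"
  by (simp add: fun_eq_iff d_w_def C.Dw_def)

lemma D_W_eq: "D_W i X = C.D\<zeta> i X + C.L\<zeta> i (C.Dw X)"
  by (simp add: pointwise D_W_def C.mult2_zeta d_w_eq d_zeta_def C.D\<zeta>_def set_sign_def shuffle_sign_singleton_left)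

context complex_vector_space
begin

lemma D\<zeta>_Q: "D\<zeta> i (Q X) = Q (D\<zeta> i X) - L\<theta> i X"
proof -
  have "D\<zeta> i (L\<theta> j (L\<zeta> j X)) = L\<theta> j (L\<zeta> j (D\<zeta> i X)) - (if i = j then L\<theta> i X else 0)" for j
    by (simp add: D\<zeta>_L\<theta> D\<zeta>_L\<zeta>)
  then show ?thesis
    by (simp add: Q_def lin_sum sum_subtractf)
qed

lemma D\<theta>_Q: "D\<theta> i (Q X) = Q (D\<theta> i X) + L\<zeta> i X"
proof -
  have "D\<theta> i (L\<theta> j (L\<zeta> j X)) = L\<theta> j (L\<zeta> j (D\<theta> i X)) + (if i = j then L\<zeta> i X else 0)" for j
    by (simp add: D\<theta>_L\<theta> D\<theta>_L\<zeta>)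
  then show ?thesis
    by (simp add: Q_def lin_sum sum.distrib)
qed

lemma D\<zeta>_H: "D\<zeta> i (H j X) = - H j (D\<zeta> i X) - (if j = i then X else 0)"
  by (simp add: H_def D\<zeta>_L\<theta> D\<zeta>_L\<zeta>)

lemma D\<theta>_H: "D\<theta> i (H j X) = - H j (D\<theta> i X) + (if j = i then X else 0)"
  by (simp add: H_def D\<theta>_L\<theta> D\<theta>_L\<zeta>)

lemma DL_commute: "Dw (L\<zeta> i X) = L\<zeta> i (Dw X)" "Dz (L\<theta> i X) = L\<theta> i (Dz X)" "Dw (D\<zeta> i X) = D\<zeta> i (Dw X)"
  "Dz (L\<zeta> i X) = L\<zeta> i (Dz X)"
  by (auto simp: pointwise Dw_def Dz_def L\<zeta>_def L\<theta>_def D\<zeta>_def mult_ac)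

lemma Dz_comm: "Dz (Q X) = Q (Dz X)" "Dz (H i X) = H i (Dz X)"
  by (simp_all add: Q_def H_def lin_sum DL_commute)

end

lemma Dw_hom2:
  assumes "binomial_family c"
  shows "C.Dw (hom2 c e) = C.sc (- of_int e) (hom2 c (e - 1))"
proof -
  have "of_int (n + 1) * hmono c e m (n + 1) = - of_int e * hmono c (e - 1) m n" for m n
    using binomial_familyD(3)[OF assms, of "n + 1" e] by (auto simp: hmono_def)
  then show ?thesis
    by (simp add: fun_eq_iff C.Dw_def C.sc_apply hom2_def)
qed

text \<open>The even part of Z - W has derivative \<theta>^i - \<zeta>^i, which vanishes against the
  same factor in the product over M. Only the derivative of that factor survives.\<close>

lemma D_W_ZWs:
  assumes c: "binomial_family c" and i: "i \<in> M"
  shows "D_W i (C.ZWs (hom2 c) j M) = C.sc (- pos_sign i M) (C.ZWs (hom2 c) j (M - {i}))"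
proof -
  have D0: "C.D\<zeta> i (hom2 c e) = 0" for e
    by (simp add: pointwise C.D\<zeta>_def hom2_def)
  have "D_W i (C.ZWs (hom2 c) j M) = C.sc (of_int j) (- C.L\<zeta> i (C.ZWs (hom2 c) (j - 1) M)
     - - C.L\<theta> i (C.ZWs (hom2 c) (j - 1) M))
    - (if i \<in> M then C.sc (1 * pos_sign i M) (C.ZWs (hom2 c) j (M - {i})) else 0)"
    unfolding D_W_eq
    by (rule C.D_ZWs[where A = "\<lambda>X. - C.L\<zeta> i X" and A' = "\<lambda>X. - C.L\<theta> i X"])
      (simp_all add: C.lin_plus C.lin_comp C.lin_def C.sc_minus C.Q_L\<zeta> C.Q_L\<theta> C.L\<zeta>_H C.L_Q_power
        C.D\<zeta>_Q C.D\<zeta>_H C.Dw_comm Dw_hom2[OF c] D0 C.sc_add)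
  also have "- C.L\<zeta> i X - - C.L\<theta> i X = C.H i X" for X
    by (simp add: C.H_def)
  finally show ?thesis
    using i by (simp add: C.H_ZWs C.sc_minus)
qed

definition triangle_sign :: "nat \<Rightarrow> complex" where
  "triangle_sign k = (- 1) ^ (k * (k + 1) div 2)"

lemma triangle_sign_Suc: "triangle_sign (Suc k) = triangle_sign k * (- 1) ^ Suc k"
proof -
  have "Suc k * (Suc k + 1) div 2 = k * (k + 1) div 2 + Suc k"
    by simp
  then show ?thesis
    by (simp only: triangle_sign_def power_add)
qed

lemma triangle_sign_square: "triangle_sign k * triangle_sign k = 1"
  by (simp add: triangle_sign_def flip: power_add)

text \<open>The indices of L leave the full product, the largest first. Each removal costs -1, the
  derivative of - \<zeta>^i, and the sign of passing the smaller remaining factors; in total this is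
  \<open>sigma L\<close> times exactly the sign that normalises \<open>D_W_div\<close>.\<close>

lemma D_W_foldr_delta:
  fixes L :: "'n::{finite,linorder} set"
  shows "foldr D_W (sorted_list_of_set L) delta =
    C.sc (triangle_sign (card L) * sigma L) (C.ZWs (hom2 c_delta) (- 1) (- L))"
proof (induction L rule: finite_min_induct)
  case empty
  show ?case
    by (simp add: delta_eq triangle_sign_def sigma_def)
next
  case (insert i L)
  have i: "i \<notin> L"
    using insert.hyps by blast
  have D_sc: "D_W i (C.sc a X) = C.sc a (D_W i X)" for a and X :: "('n, complex) ser2"
    by (simp add: D_W_eq C.sc_add)
  have L: "- L = insert i (- insert i L)"
    using i by auto
  have 1: "sigma (insert i L) = pos_sign i (- insert i L) * shuffle_sign L (- insert i L)"
    unfolding sigma_def using i by (rule shuffle_sign_insert_left)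
  have 2: "sigma L = set_sign L * shuffle_sign L (- insert i L)"
    unfolding sigma_def
    by (subst L) (use shuffle_sign_Un_right[of "{i}" "- insert i L" L] shuffle_sign_to_singleton[OF insert.hyps]
      in simp)
  have 3: "pos_sign i (- L) = pos_sign i (- insert i L)"
    by (subst L) simp
  have 4: "triangle_sign (card (insert i L)) = - (triangle_sign (card L) * set_sign L)"
    using i by (simp add: triangle_sign_Suc set_sign_def)
  have "foldr D_W (sorted_list_of_set (insert i L)) delta =
      C.sc (triangle_sign (card L) * sigma L) (D_W i (C.ZWs (hom2 c_delta) (- 1) (- L)))"
    by (simp only: sorted_list_of_set_insert_min[OF insert.hyps] foldr.simps o_apply insert.IH D_sc)
  also have "\<dots> = C.sc (triangle_sign (card L) * sigma L * - pos_sign i (- L)) (C.ZWs (hom2 c_delta) (- 1) (- L - {i}))"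
    using i by (simp add: D_W_ZWs[OF binomial_family_delta])
  also have "triangle_sign (card L) * sigma L * - pos_sign i (- L) = triangle_sign (card (insert i L)) * sigma (insert i L)"
    unfolding 1 2 3 4 by simp
  also have "- L - {i} = - insert i L"
    by auto
  finally show ?case .
qed

lemma D_W_div_delta:
  "D_W_div k L delta = C.sc (sigma L) (C.ZWs (hom2 c_delta) (- 1 - int k) (- L))"
proof -
  have "(C.Dw ^^ k) (C.sc a (C.ZWs (hom2 c_delta) (- 1) (- L))) =
      C.sc (a * fact k) (C.ZWs (hom2 c_delta) (- 1 - int k) (- L))" for a
  proof (induction k)
    case (Suc k)
    have "C.Dw (C.ZWs (hom2 c_delta) (- 1 - int k) (- L)) =
        C.sc (of_nat (Suc k)) (C.ZWs (hom2 c_delta) (- 1 - int (Suc k)) (- L))"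
      using C.Dw_ZWs[of "hom2 c_delta" "- 1 - int k" "- L", OF Dw_hom2[OF binomial_family_delta]]
      by (simp add: algebra_simps)
    then show ?case
      using Suc by (simp add: mult_ac del: of_nat_Suc)
  qed simp
  moreover have "triangle_sign (card L) / fact k * (triangle_sign (card L) * sigma L * fact k) = sigma L"
    using triangle_sign_square[of "card L"] by simp
  ultimately show ?thesis
    unfolding D_W_div_def d_w_eq D_W_foldr_delta triangle_sign_def[symmetric]
    by (simp add: fun_eq_iff C.sc_apply flip: mult.assoc)
qed

section \<open>Residues\<close>

text \<open>l = e + 1 goes with z^(-1). The expansion in |w| > |z| has no negative powers of z; the
  other is a polynomial for e \<ge> 0 and has only powers of z below -1 for e < -1.\<close>

lemma c_delta_residue: "c_delta e (e + 1) = (if e = - 1 then 1 else 0)"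
proof -
  have "neg_binom e (nat (e + 1)) = 0" if "0 \<le> e"
    using that by (intro neg_binom_eq_0) auto
  then show ?thesis
    by (auto simp: c_delta_def c_wz_def c_zw_def)
qed

context complex_vector_space
begin

lemma mult2_sc_ZWs:
  fixes J :: "'n::{finite,linorder} set"
  assumes "convable c X"
  shows "mult2 scale (C.sc a (C.ZWs (hom2 c) j J)) X = sc a (ZWs (\<lambda>e. conv c e X) j J)"
  by (subst mult2_hmono[where A = "{..card (UNIV :: 'n set)}" and c = c and e = "\<lambda>k. j - int k"
        and G = "\<lambda>k. C.sc a (C.sc (neg_binom j k) ((C.Q ^^ k) (C.HJ J one2)))"])
    (simp_all add: assms ZWs_hom2 gm_sc gm_Q_power gm_HJ gm_one2 ZWs_def sc_sum C.sc_apply sum_distrib_left mult_ac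
      del: C.sc_simps)

definition in_W_at :: "('n, 'v) ser1 \<Rightarrow> ('n, 'v) ser2" where
  "in_W_at c = (\<lambda>m I n K. if m = 0 \<and> I = {} then c n K else 0)"

lemma convable_in_W: "convable c (in_W_at x)"
  unfolding convable_def
proof (intro allI)
  fix e m I n K
  show "finite {l. c e l \<noteq> 0 \<and> in_W_at x (m - e + l) I (n - l) K \<noteq> 0}"
    by (rule finite_subset[of _ "{e - m}"]) (auto simp: in_W_at_def)
qed

lemma conv_delta_in_W:
  "conv c_delta e (in_W_at x) (- 1) I n K = (if e = - 1 \<and> I = {} then x n K else 0)"
proof -
  have "scale (c_delta e l) (in_W_at x (- 1 - e + l) I (n - l) K) =
      (if l = e + 1 then if e = - 1 \<and> I = {} then x n K else 0 else 0)" for l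
    by (auto simp: in_W_at_def c_delta_residue)
  then show ?thesis
    by (simp add: conv_def)
qed

text \<open>Y is free of \<theta>, so every \<theta> comes from a factor, and \<theta>^M arises only
  if each factor contributes its \<theta>^i, already in increasing order.\<close>

lemma HJ_support:
  fixes M :: "'n::{finite,linorder} set"
  assumes "\<And>I n K. I \<noteq> {} \<Longrightarrow> Y m I n K = 0"
  shows "(\<forall>I n K. \<not> I \<subseteq> M \<longrightarrow> HJ M Y m I n K = 0) \<and> (\<forall>n K. HJ M Y m M n K = Y m {} n K)"
proof (induction M rule: finite_min_induct)
  case empty
  then show ?case
    using assms by auto
next
  case (insert i M)
  have i: "i \<notin> M" and pos: "pos_sign i M = 1"
    using insert.hyps by (blast, rule pos_sign_less)
  have HJ: "HJ (insert i M) Y = H i (HJ M Y)"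
    using insert.hyps by (rule HJ_insert_min)
  have "HJ (insert i M) Y m I n K = 0" if "\<not> I \<subseteq> insert i M" for I n K
  proof -
    have "\<not> I - {i} \<subseteq> M" "\<not> I \<subseteq> M"
      using that by auto
    then show ?thesis
      using insert.IH unfolding HJ by (simp add: H_def minus_apply L\<theta>_def L\<zeta>_def)
  qed
  moreover have "HJ (insert i M) Y m (insert i M) n K = Y m {} n K" for n K
    using insert.IH i pos unfolding HJ by (simp add: H_def minus_apply L\<theta>_def L\<zeta>_def)
  ultimately show ?case
    by blast
qed

lemma L_cong0:
  "(\<And>I n K. Y m I n K = 0) \<Longrightarrow> L\<theta> i Y m I n K = 0" "(\<And>I n K. Y m I n K = 0) \<Longrightarrow> L\<zeta> i Y m I n K = 0"
  by (simp_all add: L\<theta>_def L\<zeta>_def)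

lemma Q_HJ_cong0:
  assumes "\<And>I n K. Y m I n K = 0"
  shows "(Q ^^ k) (HJ M Y) m I n K = 0"
proof -
  have "foldr H xs Y m I n K = 0" for xs I n K
    by (induction xs arbitrary: I n K) (simp_all add: assms H_def minus_apply L_cong0)
  then have "HJ M Y m I n K = 0" for I n K
    by (simp add: HJ_def)
  then show ?thesis
  proof (induction k arbitrary: I n K)
    case (Suc k)
    then have "L\<theta> i (L\<zeta> i ((Q ^^ k) (HJ M Y))) m I n K = 0" for i
      by (intro L_cong0) blast
    then show ?case
      by (simp add: Q_def[of "(Q ^^ k) _"] sum_fun_apply)
  qed simp
qed

text \<open>This makes the (Z - W)^(-1-k|N-L) dual to the (Z - W)^(k|L) under the residue, so that a
  residue singles out one term of the OPE.\<close>

lemma ZWs_delta_residue: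
  fixes M :: "'n::{finite,linorder} set"
  shows "ZWs (\<lambda>e. conv c_delta e (in_W_at x)) j M (- 1) UNIV n K = (if j = - 1 \<and> M = UNIV then x n K else 0)"
proof -
  let ?\<Phi> = "\<lambda>e. conv c_delta e (in_W_at x)"
  have "sc (neg_binom j k) ((Q ^^ k) (HJ M (?\<Phi> (j - int k)))) (- 1) UNIV n K =
      (if k = 0 then if j = - 1 \<and> M = UNIV then x n K else 0 else 0)" for k
  proof (cases "j - int k = - 1")
    case True
    show ?thesis
    proof (cases "k = 0")
      case True
      have "HJ M (?\<Phi> (- 1)) (- 1) UNIV n K = (if M = UNIV then x n K else 0)"
        using HJ_support[of "?\<Phi> (- 1)" "- 1" M] by (cases "M = UNIV") (auto simp: conv_delta_in_W)
      then show ?thesis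
        using True \<open>j - int k = - 1\<close> by (simp add: sc_apply)
    next
      case False
      \<comment> \<open>Here j = k - 1 \<ge> 0, and the expansion of (u - x)^j stops before
        x^k.\<close>
      then have "neg_binom j k = 0"
        using True by (intro neg_binom_eq_0) auto
      then show ?thesis
        using False by (simp add: zero_fun_apply)
    qed
  next
    case False
    then have "(Q ^^ k) (HJ M (?\<Phi> (j - int k))) (- 1) UNIV n K = 0"
      by (intro Q_HJ_cong0) (simp add: conv_delta_in_W)
    then show ?thesis
      using False by (auto simp: sc_apply)
  qed
  then show ?thesis
    by (simp add: ZWs_def sum_fun_apply sum.delta)
qed

text \<open>Series all of whose residues \<open>res\<^sub>Z (Z - W)^(j|J) X\<close>, \<open>j \<ge> 0\<close>, vanish.\<close>

definition residue_free :: "('n::{finite,linorder}, 'v) ser2 \<Rightarrow> bool" where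
  "residue_free X \<longleftrightarrow> (\<forall>j J n K. (LZW ^^ j) (HJ J X) (- 1) UNIV n K = 0)"

lemma lin_LZW_power: "lin (LZW ^^ j)"
  by (rule lin_funpow) simp

lemmas LZW_power_simps [simp] = linD[OF lin_LZW_power]

lemma residue_free_add: "residue_free X \<Longrightarrow> residue_free Y \<Longrightarrow> residue_free (X + Y)"
  by (simp add: residue_free_def plus_fun_apply)

lemma residue_free_0: "residue_free 0"
  by (simp add: residue_free_def zero_fun_apply)

lemma residue_free_sum: "(\<And>a. a \<in> A \<Longrightarrow> residue_free (f a)) \<Longrightarrow> residue_free (sum f A)"
  by (induction A rule: infinite_finite_induct) (simp_all add: residue_free_0 residue_free_add)

lemma LZW_power_comm:
  assumes "\<And>X. LZW (T X) = T (LZW X)"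
  shows "(LZW ^^ j) (T X) = T ((LZW ^^ j) X)"
  by (induction j) (simp_all add: assms)

lemma residue_free_L\<zeta>:
  assumes "residue_free X"
  shows "residue_free (L\<zeta> i X)"
  unfolding residue_free_def
proof (intro allI)
  fix j J n K
  have "HJ J (L\<zeta> i X) = sc (set_sign J) (L\<zeta> i (HJ J X))"
    by (simp add: HJ_commute_odd[of "L\<zeta> i"] L\<zeta>_H)
  then have "(LZW ^^ j) (HJ J (L\<zeta> i X)) = sc (set_sign J) (L\<zeta> i ((LZW ^^ j) (HJ J X)))"
    by (simp add: LZW_power_comm[of "L\<zeta> i"] LZW_L\<zeta>)
  then show "(LZW ^^ j) (HJ J (L\<zeta> i X)) (- 1) UNIV n K = 0"
    using assms by (simp add: sc_apply L\<zeta>_def residue_free_def)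
qed

lemma residue_free_H:
  assumes "residue_free X"
  shows "residue_free (H i X)"
  unfolding residue_free_def
proof (intro allI)
  fix j J n K
  have "H i X = HJ {i} X"
    using HJ_insert_min[of "{}" i X] by simp
  then show "(LZW ^^ j) (HJ J (H i X)) (- 1) UNIV n K = 0"
    using assms by (simp add: HJ_HJ sc_apply residue_free_def zero_fun_apply)
qed

lemma residue_free_L\<theta>: "residue_free X \<Longrightarrow> residue_free (L\<theta> i X)"
  using residue_free_add[OF residue_free_H[of X i] residue_free_L\<zeta>[of X i]] by (simp add: H_def)

lemma residue_free_Lzw: "residue_free X \<Longrightarrow> residue_free (Lzw X)"
proof -
  assume X: "residue_free X"
  have "residue_free (LZW X)"
    unfolding residue_free_def
  proof (intro allI)
    fix j J n K
    have "(LZW ^^ Suc j) (HJ J X) (- 1) UNIV n K = 0"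
      using X unfolding residue_free_def by blast
    then show "(LZW ^^ j) (HJ J (LZW X)) (- 1) UNIV n K = 0"
      by (simp only: funpow_Suc_right o_apply LZW_HJ)
  qed
  moreover have "residue_free (Q X)"
    unfolding Q_def by (intro residue_free_sum residue_free_L\<theta> residue_free_L\<zeta> X)
  ultimately have "residue_free (LZW X + Q X)"
    by (rule residue_free_add)
  then show ?thesis
    by (simp add: LZW_def)
qed

text \<open>Multiplication by a missing \<theta>^i preserves the hypothesis and moves the
  coefficient of \<theta>^I one step towards the top degree, where the residue is taken.\<close>

lemma residue_free_coeff:
  fixes I :: "'n::{finite,linorder} set"
  shows "residue_free X \<Longrightarrow> X (- 1) I n K = 0"
proof (induction "card (- I)" arbitrary: I X)
  case 0
  then have "I = UNIV"
    by auto
  moreover have "(LZW ^^ 0) (HJ {} X) (- 1) UNIV n K = 0"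
    using 0(2) unfolding residue_free_def by blast
  ultimately show ?case
    by simp
next
  case (Suc k)
  then obtain i where i: "i \<notin> I"
    by (metis Compl_UNIV_eq UNIV_eq_I card.empty nat.distinct(1))
  then have "- I = insert i (- insert i I)"
    by auto
  then have "card (- I) = Suc (card (- insert i I))"
    by (metis ComplD card_insert_disjoint finite insertI1)
  then have "L\<theta> i X (- 1) (insert i I) n K = 0"
    using Suc by (intro Suc.hyps(1) residue_free_L\<theta>) auto
  then show ?case
    using i by (auto simp: L\<theta>_def pos_sign_def)
qed

text \<open>One factor at a time: if (z - w) X = 0, the coefficients of X are constant on the lines
  m + n = const, each of which meets m = -1, where they vanish.\<close>

lemma residue_free_local_eq_0:
  assumes "residue_free X" "(Lzw ^^ r) X = 0"
  shows "X = 0"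
  using assms
proof (induction r arbitrary: X)
  case (Suc r)
  have "Lzw X = 0"
    by (rule Suc.IH) (use Suc.prems in \<open>simp_all add: residue_free_Lzw funpow_swap1\<close>)
  then have step: "X (m - 1) I n K = X m I (n - 1) K" for m I n K
    unfolding Lzw_def by (metis (no_types, lifting) eq_iff_diff_eq_0 zero_fun_apply)
  have 0: "X (- 1) I n K = 0" for I n K
    using Suc.prems(1) by (rule residue_free_coeff)
  have "X (- 1 + int k) I n K = 0" for k I n K
  proof (induction k arbitrary: n)
    case (Suc k)
    then show ?case
      using step[of "- 1 + int (Suc k)" I "n + 1" K] by simp
  qed (simp add: 0)
  moreover have "X (- 1 - int k) I n K = 0" for k I n K
  proof (induction k arbitrary: n)
    case (Suc k)
    then show ?case
      using step[of "- 1 - int k" I n K] by (simp add: algebra_simps)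
  qed (simp add: 0)
  ultimately have "X m I n K = 0" if "m = - 1 + int (nat (m + 1)) \<or> m = - 1 - int (nat (- 1 - m))" for m I n K
    using that by metis
  then show ?case
    by (simp add: pointwise)
qed simp

text \<open>z - w is the sum of (Z - W)^(1|{}) and \<Sum> \<theta>^i \<zeta>^i, which commute, and
  the latter is nilpotent of order N + 1.\<close>

lemma Lzw_power_0:
  fixes X :: "('n::{finite,linorder}, 'v) ser2"
  assumes "(LZW ^^ k) X = 0"
  shows "(Lzw ^^ (k + Suc (card (UNIV :: 'n set)))) X = 0"
proof -
  have "((\<lambda>X. - Q X) ^^ j) X = sc ((- 1) ^ j) ((Q ^^ j) X)" for j
    by (induction j) (simp_all add: sc_minus)
  then have "((\<lambda>X. - Q X) ^^ Suc (card (UNIV :: 'n set))) X = 0"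
    by (simp only: Q_nilpotent sc_simps)
  moreover have "(Lzw :: ('n, 'v) ser2 \<Rightarrow> _) = (\<lambda>X. LZW X - - Q X)"
    by (simp add: LZW_def fun_eq_iff)
  moreover have "LZW (- Q X) = - Q (LZW X)" for X :: "('n, 'v) ser2"
    by (simp add: LZW_def Q_Lzw)
  ultimately show ?thesis
    using nilpotent_diff[of LZW "\<lambda>X. - Q X" k X "Suc (card (UNIV :: 'n set))"] assms by simp
qed

end

section \<open>Products of fields in components\<close>

lemma c_zw_of_nat_support: "c_zw (int k) l \<noteq> 0 \<Longrightarrow> l \<in> {0..int k}"
proof (rule ccontr)
  assume c: "c_zw (int k) l \<noteq> 0" and "l \<notin> {0..int k}"
  then have "0 \<le> l" "int k < int (nat l)"
    by (auto simp: c_zw_def split: if_splits)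
  then have "c_zw (int k) l = 0"
    by (simp add: c_zw_def neg_binom_eq_0)
  then show False
    using c by contradiction
qed

context complex_vector_space
begin

lemma conv0_zw_of_nat: "conv0 c_zw (int k) x = (diff2 ^^ k) x"
proof (induction k)
  case 0
  show ?case
    using conv0_0[of c_zw x, OF c_zw_0] by simp
next
  case (Suc k)
  have "{l. c_zw (int k) l \<noteq> 0 \<and> x (s + l) (t - l) \<noteq> 0} \<subseteq> {0..int k}" for s t
    using c_zw_of_nat_support by blast
  then have "diff2 (conv0 c_zw (int k) x) = conv0 c_zw (int k + 1) x"
    by (intro diff2_conv0_finite binomial_family_zw) (rule finite_subset[of _ "{0..int k}"], auto)
  then show ?case
    using Suc by (simp add: add.commute)
qed

lemma mult2_hom2:
  assumes "\<And>m I n K. finite {l. c e l \<noteq> 0 \<and> X (m - e + l) I (n - l) K \<noteq> 0}"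
  shows "mult2 scale (hom2 c e) X = conv c e X"
proof -
  \<comment> \<open>Finiteness is known at the single degree e; cutting the family down to it meets
    the demand of \<open>convable\<close> for all degrees.\<close>
  define c' where "c' = (\<lambda>e' l. if e' = e then c e l else 0)"
  have "convable c' X"
    using assms by (auto simp: convable_def c'_def)
  moreover have "hom2 c e m I n K = (\<Sum>k\<in>{()}. hmono c' e m n * one2 0 I 0 K)" for m I n K
    by (simp add: hom2_def one2_def hmono_def c'_def)
  ultimately have "mult2 scale (hom2 c e) X = (\<Sum>k\<in>{()}. gm one2 (conv c' e X))"
    by (intro mult2_hmono) simp_all
  then show ?thesis
    by (simp add: gm_one2 conv_def c'_def)
qed

lemma mult2_exp_zw_of_nat: "mult2 scale (exp_zw (int k)) X m I n K = (diff2 ^^ k) (\<lambda>m n. X m I n K) m n"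
proof -
  have "finite {l. c_zw (int k) l \<noteq> 0 \<and> X (m - int k + l) I (n - l) K \<noteq> 0}" for m I n K
  proof (rule finite_subset[of _ "{0..int k}"])
    show "{l. c_zw (int k) l \<noteq> 0 \<and> X (m - int k + l) I (n - l) K \<noteq> 0} \<subseteq> {0..int k}"
      using c_zw_of_nat_support by blast
  qed simp
  then show ?thesis
    by (simp add: exp_zw_eq mult2_hom2 conv_conv0 conv0_zw_of_nat)
qed

section \<open>(j|J)-products through the operator calculus\<close>

definition superfield :: "('n, 'v \<Rightarrow> 'v) ser1 \<Rightarrow> bool" where
  "superfield a \<longleftrightarrow> (\<forall>I. field (\<lambda>n. a n I))"

lemma is_superfield_superfield: "is_superfield scale a \<Longrightarrow> superfield a"
  unfolding is_superfield_def superfield_def field_def by (blast intro: linear_lop)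

lemma superfieldD: "superfield a \<Longrightarrow> field (\<lambda>n. a n I)"
  by (simp add: superfield_def)

lemma superfield_lop: "superfield a \<Longrightarrow> lop (a n I)"
  using field_lop[OF superfieldD] .

definition ZW_at :: "bit \<Rightarrow> ('n::{finite,linorder}, 'v \<Rightarrow> 'v) ser1 \<Rightarrow> ('n, 'v \<Rightarrow> 'v) ser1 \<Rightarrow> 'v \<Rightarrow> ('n, 'v) ser2" where
  "ZW_at p a b v = (\<lambda>m I n K. prod_ZW scale p a b m I n K v)"

definition WZ_at :: "bit \<Rightarrow> ('n::{finite,linorder}, 'v \<Rightarrow> 'v) ser1 \<Rightarrow> ('n, 'v \<Rightarrow> 'v) ser1 \<Rightarrow> 'v \<Rightarrow> ('n, 'v) ser2" where
  "WZ_at q b a v = (\<lambda>m I n K. prod_WZ scale q b a m I n K v)"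

lemma convable_ZW_at:
  assumes "superfield a" "superfield b"
  shows "convable c_zw (ZW_at p a b v)"
  unfolding convable_convable0 ZW_at_def prod_ZW_def
  by (intro allI convable0_field_zw[where T = "\<lambda>m x. scale _ (a m _ x)"] superfieldD[OF assms(2)])
    (simp add: lopD(3)[OF superfield_lop[OF assms(1)]])

lemma convable_WZ_at:
  assumes "superfield a" "superfield b"
  shows "convable c_wz (WZ_at q b a v)"
  unfolding convable_convable0 WZ_at_def prod_WZ_def
  by (intro allI convable0_field_wz[where T = "\<lambda>n x. scale _ (b n _ x)"] superfieldD[OF assms(1)])
    (simp add: lopD(3)[OF superfield_lop[OF assms(2)]])

lemma nth_product_ZWs:
  assumes "superfield a" "superfield b"
  shows "nth_product scale p q j J a b n K v =
    (ZWs (\<lambda>e. conv c_zw e (ZW_at p a b v)) j J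
     - sc (koszul (p * q)) (ZWs (\<lambda>e. conv c_wz e (WZ_at q b a v)) j J)) (- 1) UNIV n K"
  by (simp add: nth_product_def res_Z_def op_mult2_def ZW_power_eq[OF exp_zw_eq] ZW_power_eq[OF exp_wz_eq]
      ZW_at_def[symmetric] WZ_at_def[symmetric] mult2_ZWs convable_ZW_at[OF assms] convable_WZ_at[OF assms]
      minus_apply sc_apply)

lemma ZWs_diff_sc: "ZWs (\<lambda>e. A e - sc c (B e)) j J = ZWs A j J - sc c (ZWs B j J)"
  by (simp add: ZWs_def sum_subtractf sc_sum sc_diff mult.commute)

definition supercomm_at :: "bit \<Rightarrow> bit \<Rightarrow> ('n::{finite,linorder}, 'v \<Rightarrow> 'v) ser1 \<Rightarrow> ('n, 'v \<Rightarrow> 'v) ser1 \<Rightarrow> 'v \<Rightarrow> ('n, 'v) ser2" where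
  "supercomm_at p q a b v = ZW_at p a b v - sc (koszul (p * q)) (WZ_at q b a v)"

lemma supercomm_at_apply: "supercomm_at p q a b v m I n K = supercomm scale p q a b m I n K v"
  by (simp add: supercomm_at_def supercomm_def ZW_at_def WZ_at_def minus_apply sc_apply)

lemma conv_zero_index:
  assumes "\<And>l. c 0 l = (if l = 0 then 1 else 0)"
  shows "conv c 0 X = X"
  by (simp add: fun_eq_iff conv_conv0 conv0_0[of c, OF assms])

lemma nth_product_of_nat:
  assumes "superfield a" "superfield b"
  shows "nth_product scale p q (int k) J a b n K v = (LZW ^^ k) (HJ J (supercomm_at p q a b v)) (- 1) UNIV n K"
  by (simp add: nth_product_ZWs[OF assms] supercomm_at_def minus_apply sc_apply
      ZWs_of_nat[of "\<lambda>e. conv c_zw e _", OF Lzw_conv[OF binomial_family_zw convable_ZW_at[OF assms]]]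
      ZWs_of_nat[of "\<lambda>e. conv c_wz e _", OF Lzw_conv[OF binomial_family_wz convable_WZ_at[OF assms]]]
      conv_zero_index[of c_zw, OF c_zw_0] conv_zero_index[of c_wz, OF c_wz_0])

lemma ZWs_gm:
  fixes J :: "'n::{finite,linorder} set"
  shows "ZWs \<Phi> j J = (\<Sum>k\<le>card (UNIV :: 'n set).
    gm (C.sc (neg_binom j k) ((C.Q ^^ k) (C.HJ J one2))) (\<Phi> (j - int k)))"
  by (simp add: ZWs_def gm_sc gm_Q_power gm_HJ gm_one2)

end

text \<open>The parity automorphism T anticommutes with \<theta>^i - \<zeta>^i, commutes with Q and
  fixes 1; so the product is an eigenvector with eigenvalue (-1)^#J.\<close>

lemma Grassmann_parity:
  assumes "(C.Q ^^ k) (C.HJ J one2) 0 I 0 K \<noteq> 0"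
  shows "par I + par K = par (J :: 'n::{finite,linorder} set)"
proof -
  define T :: "('n, complex) ser2 \<Rightarrow> ('n, complex) ser2" where
    "T = (\<lambda>X m I n K. set_sign I * set_sign K * X m I n K)"
  have T_lin: "C.lin T"
    by (simp add: C.lin_def T_def pointwise C.sc_apply algebra_simps)
  have T_L: "T (C.L\<theta> i X) = - C.L\<theta> i (T X)" "T (C.L\<zeta> i X) = - C.L\<zeta> i (T X)" for i X
    by (auto simp: pointwise T_def C.L\<theta>_def C.L\<zeta>_def)
  have "T (C.H i X) = - C.H i (T X)" for i X
    by (simp add: C.H_def C.linD[OF T_lin] T_L)
  moreover have "T (C.Q X) = C.Q (T X)" for X
    by (rule C.Q_comm_aux[OF T_lin T_L])
  moreover have "T one2 = one2"
    by (auto simp: T_def one2_def fun_eq_iff)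
  ultimately have "T ((C.Q ^^ k) (C.HJ J one2)) = C.sc (set_sign J) ((C.Q ^^ k) (C.HJ J one2))"
    by (simp add: C.Q_power_comm[of T] C.HJ_commute_odd[of T])
  then have "T ((C.Q ^^ k) (C.HJ J one2)) 0 I 0 K = set_sign J * (C.Q ^^ k) (C.HJ J one2) 0 I 0 K"
    by (simp add: C.sc_apply)
  then have "set_sign I * set_sign K = set_sign J"
    using assms by (simp add: T_def)
  then have "koszul (par I + par K) = koszul (par J)"
    by (simp only: koszul_add koszul_par)
  then show ?thesis
    by (simp only: koszul_eq_iff)
qed

text \<open>The supercommutator of two series becomes, up to one common sign, that of their
  components, of parities p + i and q + k.\<close>

lemma koszul_exchange:
  "koszul (p * q) * koszul ((q + k) * i + k * i) = koszul ((p + i) * k) * koszul ((p + i) * (q + k))"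
  by (cases p; cases q; cases i; cases k) simp_all

section \<open>(j|J)-products as combinations of ordinary products of components\<close>

context complex_vector_space
begin

lemma conv_ZW_at:
  assumes a: "superfield a" and b: "superfield b"
  shows "conv c_zw e (ZW_at p a b v) m I n K =
    scale (koszul ((p + par I) * par K)) (conv0 c_zw e (\<lambda>m n. a m I (b n K v)) m n)"
  unfolding conv_conv0 ZW_at_def prod_ZW_def
  by (rule conv0_scale, rule convable0_field_zw[where T = "\<lambda>m x. a m I x"])
    (simp_all add: superfieldD[OF b] lopD(3)[OF superfield_lop[OF a]])

lemma conv_WZ_at:
  assumes a: "superfield a" and b: "superfield b"
  shows "conv c_wz e (WZ_at q b a v) m I n K =
    scale (koszul ((q + par K) * par I + par K * par I)) (conv0 c_wz e (\<lambda>m n. b n K (a m I v)) m n)"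
  unfolding conv_conv0 WZ_at_def prod_WZ_def
  by (rule conv0_scale, rule convable0_field_wz[where T = "\<lambda>n x. b n K x"])
    (simp_all add: superfieldD[OF a] lopD(3)[OF superfield_lop[OF b]])

lemma conv_diff_nprod:
  assumes a: "superfield a" and b: "superfield b"
  shows "conv c_zw e (ZW_at p a b v) (- 1) I n K
      - scale (koszul (p * q)) (conv c_wz e (WZ_at q b a v) (- 1) I n K) =
    scale (koszul ((p + par I) * par K))
      (nprod (koszul ((p + par I) * (q + par K))) e (\<lambda>n. a n I) (\<lambda>n. b n K) n v)"
  unfolding conv_ZW_at[OF assms] conv_WZ_at[OF assms] nprod_def
  by (simp only: koszul_exchange scale_right_diff_distrib scale_scale)

text \<open>The residue needs all of \<theta>^1 ... \<theta>^N: where (Z - W)^(j|J) supplies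
  \<theta>^I \<zeta>^K', a(Z) supplies the complement of I and b(W) the rest of K. The weights stay
  abstract except for their parity, on which the locality sign depends.\<close>

lemma nth_product_nprod:
  fixes J :: "'n::{finite,linorder} set"
  assumes a: "superfield a" and b: "superfield b"
  shows "\<exists>w. nth_product scale p q j J a b = (\<lambda>n K v. \<Sum>k\<le>card (UNIV :: 'n set). \<Sum>I\<in>UNIV. \<Sum>K'\<in>Pow K.
      scale (w k I K' K) (nprod (koszul ((p + par (- I)) * (q + par (K - K')))) (j - int k)
        (\<lambda>n. a n (- I)) (\<lambda>n. b n (K - K')) n v)) \<and>
    (\<forall>k I K' K. w k I K' K \<noteq> 0 \<longrightarrow> par I + par K' = par J)"
proof (intro exI conjI)
  let ?G = "\<lambda>k. C.sc (neg_binom j k) ((C.Q ^^ k) (C.HJ J one2))"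
  let ?w = "\<lambda>k I K' K. koszul (par K' * par (- I)) * shuffle_sign I (- I) * shuffle_sign K' (K - K') * ?G k 0 I 0 K'
    * koszul ((p + par (- I)) * par (K - K'))"
  show "nth_product scale p q j J a b = (\<lambda>n K v. \<Sum>k\<le>card (UNIV :: 'n set). \<Sum>I\<in>UNIV. \<Sum>K'\<in>Pow K.
      scale (?w k I K' K) (nprod (koszul ((p + par (- I)) * (q + par (K - K')))) (j - int k)
        (\<lambda>n. a n (- I)) (\<lambda>n. b n (K - K')) n v))"
    unfolding fun_eq_iff nth_product_ZWs[OF assms]
    unfolding ZWs_diff_sc[symmetric]
    unfolding ZWs_gm
    by (simp only: sum_fun_apply gm_def minus_apply sc_apply conv_diff_nprod[OF assms] Pow_UNIV
        scale_scale Compl_eq_Diff_UNIV simp_thms)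
  show "\<forall>k I K' K. ?w k I K' K \<noteq> 0 \<longrightarrow> par I + par K' = par J"
  proof (intro allI impI)
    fix k I K' K
    assume "?w k I K' K \<noteq> 0"
    then have "(C.Q ^^ k) (C.HJ J one2) 0 I 0 K' \<noteq> 0"
      by (rule contrapos_nn) (simp only: C.sc_apply mult_zero_left mult_zero_right)
    then show "par I + par K' = par J"
      by (rule Grassmann_parity)
  qed
qed

lemma nth_product_lop:
  assumes "superfield a" "superfield b"
  shows "lop (nth_product scale p q j J a b n K)"
proof -
  obtain w where w: "nth_product scale p q j J a b = (\<lambda>n K v. \<Sum>k\<le>card (UNIV :: 'a set). \<Sum>I\<in>UNIV. \<Sum>K'\<in>Pow K.
      scale (w k I K' K) (nprod (koszul ((p + par (- I)) * (q + par (K - K')))) (j - int k)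
        (\<lambda>n. a n (- I)) (\<lambda>n. b n (K - K')) n v))"
    using nth_product_nprod[OF assms, of p q j J] by blast
  note lop = lopD[OF nprod_lop[OF superfieldD[OF assms(1)] superfieldD[OF assms(2)]]]
  show ?thesis
    unfolding w by (simp add: lop_def lop scale_right_distrib sum.distrib scale_sum_right mult.commute)
qed

text \<open>By Dong's lemma each term is local with h, its sign being the product of those of its
  two factors. The parity of the nonzero weights makes this sign the same for all terms, so that
  they can be added.\<close>

lemma loc_nth_product:
  fixes J :: "'n::{finite,linorder} set"
  assumes a: "superfield a" and b: "superfield b" and h: "field h"
    and ab: "\<And>I K. loc (koszul ((p + par I) * (q + par K))) (\<lambda>n. a n I) (\<lambda>n. b n K)"
    and ah: "\<And>I. loc (koszul ((p + par I) * r)) (\<lambda>n. a n I) h"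
    and bh: "\<And>K. loc (koszul ((q + par K) * r)) (\<lambda>n. b n K) h"
  shows "loc (koszul ((p + q + par (- J) + par K) * r)) (\<lambda>n. nth_product scale p q j J a b n K) h"
proof -
  obtain w where w: "nth_product scale p q j J a b = (\<lambda>n K v. \<Sum>k\<le>card (UNIV :: 'n set). \<Sum>I\<in>UNIV. \<Sum>K'\<in>Pow K.
      scale (w k I K' K) (nprod (koszul ((p + par (- I)) * (q + par (K - K')))) (j - int k)
        (\<lambda>n. a n (- I)) (\<lambda>n. b n (K - K')) n v))"
    and par: "\<And>k I K' K. w k I K' K \<noteq> 0 \<Longrightarrow> par I + par K' = par J"
    using nth_product_nprod[OF a b, of p q j J] by blast
  have bits: "(p + q + (u + x) + (k' + k)) * r = (p + i) * r + (q + k) * r"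
    if "u = i' + i" "x = i' + k'" for u x i i' k k' :: bit
    using that by (cases p; cases q; cases i; cases i'; cases k; cases k'; cases r) simp_all
  have "loc (koszul ((p + q + par (- J) + par K) * r)) (\<lambda>n v. scale (w k I K' K)
      (nprod (koszul ((p + par (- I)) * (q + par (K - K')))) (j - int k) (\<lambda>n. a n (- I)) (\<lambda>n. b n (K - K')) n v)) h"
    if K': "K' \<subseteq> K" for k I K'
  proof (cases "w k I K' K = 0")
    case True
    then show ?thesis
      by (simp add: loc_0 h)
  next
    case False
    have U: "par (UNIV :: 'n set) = par M + par (- M)" for M :: "'n set"
      using par_sub[of M UNIV] by (simp add: Compl_eq_Diff_UNIV)
    have "par (- J) = par (UNIV :: 'n set) + par J"
      unfolding U[of J] by (cases "par J :: bit"; cases "par (- J) :: bit") simp_all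
    then have "(p + q + par (- J) + par K) * r = (p + par (- I)) * r + (q + par (K - K')) * r"
      using bits[OF U[of I] par[OF False, symmetric], of "par (K - K')"] par_sub[OF K'] by simp
    then have "koszul ((p + q + par (- J) + par K) * r) = koszul ((p + par (- I)) * r) * koszul ((q + par (K - K')) * r)"
      by (simp only: koszul_add)
    then show ?thesis
      by (simp only:) (intro loc_scale h Dong superfieldD[OF a] superfieldD[OF b] ab ah bh)
  qed
  then show ?thesis
    unfolding w by (intro loc_sum h) simp_all
qed

end

text \<open>Each i \<in> J contributes \<theta>^i or - \<zeta>^i, and sorting the \<theta> to the
  left of the \<zeta> costs the shuffle sign.\<close>

lemma diff_odd_prod_coeff:
  fixes J :: "'n::{finite,linorder} set"
  shows "C.HJ J one2 0 I 0 K = (if I \<union> K = J \<and> I \<inter> K = {} then set_sign K * shuffle_sign I K else 0)"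
proof (induction J arbitrary: I K rule: finite_min_induct)
  case empty
  show ?case
    by (auto simp: one2_def)
next
  case (insert i J)
  have i: "i \<notin> J"
    using insert.hyps by blast
  have HJ: "C.HJ (insert i J) one2 = C.H i (C.HJ J one2)"
    using insert.hyps by (rule C.HJ_insert_min)
  have step: "C.HJ (insert i J) one2 0 I 0 K = (if i \<in> I then pos_sign i I * C.HJ J one2 0 (I - {i}) 0 K else 0)
      - (if i \<in> K then set_sign I * pos_sign i K * C.HJ J one2 0 I 0 (K - {i}) else 0)"
    unfolding HJ by (simp add: C.H_def minus_apply C.L\<theta>_def C.L\<zeta>_def)
  consider "i \<in> I" "i \<in> K" | "i \<in> I" "i \<notin> K" | "i \<notin> I" "i \<in> K" | "i \<notin> I" "i \<notin> K"
    by blast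
  then show ?case
  proof cases
    case 1
    then have "(I - {i}) \<union> K \<noteq> J" "I \<union> (K - {i}) \<noteq> J"
      using i by auto
    then show ?thesis
      using 1 unfolding step insert.IH by auto
  next
    case 2
    have eq: "(I - {i}) \<union> K = J \<and> (I - {i}) \<inter> K = {} \<longleftrightarrow> I \<union> K = insert i J \<and> I \<inter> K = {}"
      using 2 i by auto
    have "shuffle_sign (I - {i}) K = shuffle_sign I K" "pos_sign i I = 1" if "I \<union> K = insert i J"
    proof -
      have sub: "K \<subseteq> J" "I - {i} \<subseteq> J"
        using that 2 by auto
      then have "pos_sign i K = 1"
        by (intro pos_sign_less insert.hyps) (auto dest: subsetD)
      then show "shuffle_sign (I - {i}) K = shuffle_sign I K"
        using shuffle_sign_insert_left[of i "I - {i}" K] 2 by (simp add: insert_absorb)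
      have "pos_sign i (I - {i}) = 1"
        using sub by (intro pos_sign_less insert.hyps) (auto dest: subsetD)
      then show "pos_sign i I = 1"
        by simp
    qed
    then show ?thesis
      using 2 unfolding step insert.IH eq by auto
  next
    case 3
    have eq: "I \<union> (K - {i}) = J \<and> I \<inter> (K - {i}) = {} \<longleftrightarrow> I \<union> K = insert i J \<and> I \<inter> K = {}"
      using 3 i by auto
    have "shuffle_sign I (K - {i}) = set_sign I * shuffle_sign I K" "pos_sign i K = 1" if "I \<union> K = insert i J"
    proof -
      have sub: "I \<subseteq> J" "K - {i} \<subseteq> J"
        using that 3 by auto
      then have "shuffle_sign I {i} = set_sign I"
        by (intro shuffle_sign_to_singleton insert.hyps) (auto dest: subsetD)
      then show "shuffle_sign I (K - {i}) = set_sign I * shuffle_sign I K"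
        using shuffle_sign_Un_right[of "{i}" "K - {i}" I] 3 by (simp add: insert_absorb)
      have "pos_sign i (K - {i}) = 1"
        using sub by (intro pos_sign_less insert.hyps) (auto dest: subsetD)
      then show "pos_sign i K = 1"
        by simp
    qed
    then show ?thesis
      using 3 unfolding step insert.IH eq by (auto simp: mult_ac)
  next
    case 4
    then show ?thesis
      using i unfolding step by auto
  qed
qed

section \<open>The (-1|N)-product and normal ordering\<close>

context complex_vector_space
begin

text \<open>The product of all \<theta>^i - \<zeta>^i is the delta function of the odd variables:
  its top coefficient against X(\<theta>, \<zeta>) is X(\<zeta>, \<zeta>).\<close>

lemma HJ_UNIV_top:
  fixes X :: "('n::{finite,linorder}, 'v) ser2"
  shows "HJ UNIV X m UNIV n K = (\<Sum>K'\<in>Pow K. scale (shuffle_sign K' (K - K')) (X m K' n (K - K')))"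
proof -
  have "HJ UNIV X = gm (C.HJ UNIV one2) X"
    by (simp add: gm_HJ gm_one2)
  then have "HJ UNIV X m UNIV n K = (\<Sum>I\<in>UNIV. \<Sum>K'\<in>Pow K.
     scale (koszul (par K' * par (- I)) * shuffle_sign I (- I) * shuffle_sign K' (K - K') * C.HJ UNIV one2 0 I 0 K')
       (X m (- I) n (K - K')))"
    by (simp add: gm_def Compl_eq_Diff_UNIV)
  also have "\<dots> = (\<Sum>K'\<in>Pow K. \<Sum>I\<in>UNIV.
     scale (koszul (par K' * par (- I)) * shuffle_sign I (- I) * shuffle_sign K' (K - K') * C.HJ UNIV one2 0 I 0 K')
       (X m (- I) n (K - K')))"
    by (rule sum.swap)
  also have "\<dots> = (\<Sum>K'\<in>Pow K. scale (shuffle_sign K' (K - K')) (X m K' n (K - K')))"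
  proof (rule sum.cong[OF refl])
    fix K'
    have "scale (koszul (par K' * par (- I)) * shuffle_sign I (- I) * shuffle_sign K' (K - K') * C.HJ UNIV one2 0 I 0 K')
       (X m (- I) n (K - K')) = (if I = - K' then scale (shuffle_sign K' (K - K')) (X m K' n (K - K')) else 0)" for I
    proof (cases "I = - K'")
      case True
      have "par K' * par K' = (par K' :: bit)"
        by (cases "par K' :: bit") simp_all
      then have "koszul (par K' * par K') = set_sign K'"
        by (simp only: koszul_par)
      then show ?thesis
        using True by (simp add: diff_odd_prod_coeff mult_ac)
    next
      case False
      then have "\<not> (I \<union> K' = UNIV \<and> I \<inter> K' = {})"
        by blast
      then have "C.HJ UNIV one2 0 I 0 K' = 0"
        by (simp only: diff_odd_prod_coeff if_False)
      then show ?thesis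
        using False by simp
    qed
    then show "(\<Sum>I\<in>UNIV. scale (koszul (par K' * par (- I)) * shuffle_sign I (- I) * shuffle_sign K' (K - K')
        * C.HJ UNIV one2 0 I 0 K') (X m (- I) n (K - K'))) = scale (shuffle_sign K' (K - K')) (X m K' n (K - K'))"
      by (simp add: sum.delta)
  qed
  finally show ?thesis .
qed

text \<open>Geometric series: (z - w)^(-1) is the sum of z^(-1-l) w^l over l \<ge> 0 in |z| > |w|
  and minus that sum over l < 0 in |w| > |z|. The residues select the coefficients of f with m \<ge>
  0 and with m < 0.\<close>

lemma nprod_minus_one:
  assumes f: "field f" and g: "field g"
  shows "nprod \<epsilon> (- 1) f g n v = Sum_any (\<lambda>m. (if 0 \<le> m then f m (g (n - m) v) else 0))
    + scale \<epsilon> (Sum_any (\<lambda>m. g m (if 0 \<le> n - m then 0 else f (n - m) v)))"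
proof -
  have neg: "neg_binom (- 1) k = 1" for k
  proof (induction k)
    case (Suc k)
    then show ?case
      using neg_binom_Suc[of "- 1" k] by (simp add: neg_binom_0_left)
  qed simp
  have 1: "conv0 c_zw (- 1) (\<lambda>m n. f m (g n v)) (- 1) n = Sum_any (\<lambda>m. (if 0 \<le> m then f m (g (n - m) v) else 0))"
    unfolding conv0_def by (rule Sum_any.cong) (simp add: c_zw_def neg)
  have "scale (c_wz (- 1) l) (g (n - l) (f (- 1 - - 1 + l) v)) = - (if l < 0 then g (n - l) (f l v) else 0)" for l
    by (simp add: c_wz_def c_zw_def neg)
  then have "conv0 c_wz (- 1) (\<lambda>m n. g n (f m v)) (- 1) n = Sum_any (\<lambda>l. - (if l < 0 then g (n - l) (f l v) else 0))"
    unfolding conv0_def by simp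
  also have "\<dots> = - Sum_any (\<lambda>l. if l < 0 then g (n - l) (f l v) else 0)"
  proof (rule additive_Sum_any[symmetric])
    obtain n0 where "\<forall>n<n0. f n v = 0"
      using f unfolding field_def by blast
    then have "{l. (if l < 0 then g (n - l) (f l v) else 0) \<noteq> 0} \<subseteq> {n0..0}"
      using field_0[OF g] by (auto simp: not_less[symmetric] split: if_splits)
    then show "finite {l. (if l < 0 then g (n - l) (f l v) else 0) \<noteq> 0}"
      by (rule finite_subset) simp
  qed simp
  also have "Sum_any (\<lambda>l. if l < 0 then g (n - l) (f l v) else 0) =
      Sum_any (\<lambda>m. g m (if 0 \<le> n - m then 0 else f (n - m) v))"
  proof (rule Sum_any.reindex_cong[of "\<lambda>m. n - m"])
    show "bij (\<lambda>m::int. n - m)"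
      by (rule bij_betw_byWitness[of _ "\<lambda>l. n - l"]) auto
  qed (use field_0[OF g] in \<open>auto simp: fun_eq_iff\<close>)
  finally show ?thesis
    by (simp add: nprod_def 1)
qed

lemma koszul_normal_ordered:
  "koszul ((p + i) * k) * koszul ((p + i) * (q + k)) * koszul (i * k) = koszul (p * q) * koszul ((q + k) * i)"
  by (cases p; cases q; cases i; cases k) simp_all

lemma normal_ordered_eq:
  fixes a b :: "('n::{finite,linorder}, 'v \<Rightarrow> 'v) ser1"
  assumes a: "superfield a" and b: "superfield b"
  shows "normal_ordered scale p q a b = nth_product scale p q (- 1) UNIV a b"
proof (intro ext)
  fix n K v
  let ?A = "\<lambda>K' K''. Sum_any (\<lambda>m. (if 0 \<le> m then a m K' (b (n - m) K'' v) else 0))"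
  let ?B = "\<lambda>K' K''. Sum_any (\<lambda>m. b m K'' (if 0 \<le> n - m then 0 else a (n - m) K' v))"
  have "nth_product scale p q (- 1) UNIV a b n K v = (\<Sum>K'\<in>Pow K. scale (shuffle_sign K' (K - K'))
      (scale (koszul ((p + par K') * par (K - K')))
        (nprod (koszul ((p + par K') * (q + par (K - K')))) (- 1) (\<lambda>n. a n K') (\<lambda>n. b n (K - K')) n v)))"
    unfolding nth_product_ZWs[OF assms]
    unfolding ZWs_diff_sc[symmetric]
    unfolding ZWs_UNIV HJ_UNIV_top
    by (simp only: minus_apply sc_apply conv_diff_nprod[OF assms])
  also have "\<dots> = (\<Sum>K'\<in>Pow K. scale (koszul ((p + par K') * par (K - K')) * shuffle_sign K' (K - K')) (?A K' (K - K')))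
    + (\<Sum>K'\<in>Pow K. scale (koszul ((p + par K') * par (K - K')) * koszul ((p + par K') * (q + par (K - K')))
        * shuffle_sign K' (K - K')) (?B K' (K - K')))"
    unfolding nprod_minus_one[OF superfieldD[OF a] superfieldD[OF b]]
    by (simp add: scale_right_distrib sum.distrib mult_ac)
  \<comment> \<open>In the second half of the normally ordered product b stands first, so K' and K -
    K' exchange roles, at the cost given by \<open>shuffle_sign_commute\<close>.\<close>
  also have "(\<Sum>K'\<in>Pow K. scale (koszul ((p + par K') * par (K - K')) * koszul ((p + par K') * (q + par (K - K')))
        * shuffle_sign K' (K - K')) (?B K' (K - K'))) =
     (\<Sum>K'\<in>Pow K. scale (koszul (p * q)) (scale (koszul ((q + par K') * par (K - K')) * shuffle_sign K' (K - K')) (?B (K - K') K')))"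
  proof (rule sum.reindex_bij_witness[of _ "\<lambda>K'. K - K'" "\<lambda>K'. K - K'"])
    fix K' assume "K' \<in> Pow K"
    then have *: "K - (K - K') = K'"
      by auto
    have "shuffle_sign K' (K - K') * shuffle_sign (K - K') K' = koszul (par K' * par (K - K'))"
      by (rule shuffle_sign_commute) auto
    then have s: "shuffle_sign K' (K - K') = koszul (par K' * par (K - K')) * shuffle_sign (K - K') K'"
      by (metis mult.assoc mult.right_neutral shuffle_sign_mult_self(1))
    show "scale (koszul (p * q)) (scale (koszul ((q + par (K - K')) * par (K - (K - K'))) * shuffle_sign (K - K') (K - (K - K')))
        (?B (K - (K - K')) (K - K'))) = scale (koszul ((p + par K') * par (K - K')) * koszul ((p + par K') * (q + par (K - K')))
        * shuffle_sign K' (K - K')) (?B K' (K - K'))"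
      unfolding * s using koszul_normal_ordered[of p "par K'" "par (K - K')" q]
      by (simp add: mult.assoc[symmetric])
  qed auto
  finally show "normal_ordered scale p q a b n K v = nth_product scale p q (- 1) UNIV a b n K v"
    by (simp add: normal_ordered_def prod_ZZ_def ser_plus_def ser_minus_def scale_sum_right if_distrib cong: if_cong)
qed

end

section \<open>SUSY vertex algebras\<close>

context complex_vector_space
begin

text \<open>The sign is that of an odd operator moving to the right past \<theta>^I
  \<zeta>^K.\<close>

definition lin_op :: "('v \<Rightarrow> 'v) \<Rightarrow> ('n, 'v) ser2 \<Rightarrow> ('n, 'v) ser2" where
  "lin_op T X = (\<lambda>m I n K. scale (set_sign I * set_sign K) (T (X m I n K)))"

lemma lin_lin_op: "lop T \<Longrightarrow> lin (lin_op T)"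
  by (simp add: lin_def lin_op_def pointwise sc_apply lopD scale_right_distrib mult.commute)

lemma lin_op_anticommutes:
  assumes "lop T"
  shows "lin_op T (L\<theta> i X) = - L\<theta> i (lin_op T X)" "lin_op T (L\<zeta> i X) = - L\<zeta> i (lin_op T X)"
    "lin_op T (D\<zeta> i X) = - D\<zeta> i (lin_op T X)" "lin_op T (Dw X) = Dw (lin_op T X)"
  by (auto simp: pointwise lin_op_def L\<theta>_def L\<zeta>_def D\<zeta>_def Dw_def lopD[OF assms] mult_ac)

lemma conv_D:
  assumes "convable c X"
  shows "conv c e (D\<theta> i X) = D\<theta> i (conv c e X)" "conv c e (D\<zeta> i X) = D\<zeta> i (conv c e X)"
    "conv c e (L\<theta> i X) = L\<theta> i (conv c e X)" "conv c e (L\<zeta> i X) = L\<zeta> i (conv c e X)"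
proof -
  have X: "convable0 c (\<lambda>m n. X m I n K)" for I K
    using assms by (simp add: convable_convable0)
  have 0: "conv0 c e (\<lambda>m n. 0) = (\<lambda>m n. 0)"
    by (simp add: conv0_def)
  show "conv c e (D\<theta> i X) = D\<theta> i (conv c e X)" "conv c e (D\<zeta> i X) = D\<zeta> i (conv c e X)"
    "conv c e (L\<theta> i X) = L\<theta> i (conv c e X)" "conv c e (L\<zeta> i X) = L\<zeta> i (conv c e X)"
    by (auto simp: fun_eq_iff conv_conv0 D\<theta>_def D\<zeta>_def L\<theta>_def L\<zeta>_def 0 conv0_scale[OF X])
qed

lemma conv_lin_op:
  assumes "lop T" "convable c X"
  shows "conv c e (lin_op T X) = lin_op T (conv c e X)"
proof -
  have X: "convable0 c (\<lambda>m n. X m I n K)" for I K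
    using assms by (simp add: convable_convable0)
  then have TX: "convable0 c (\<lambda>m n. T (X m I n K))" for I K
    by (rule convable0_additive) (rule lopD[OF assms(1)])
  show ?thesis
    by (simp add: fun_eq_iff conv_conv0 lin_op_def conv0_scale[OF TX] conv0_additive[OF X lopD(1,2)[OF assms(1)]])
qed

lemma conv_diff:
  assumes "convable c X" "convable c Y"
  shows "conv c e (X - Y) = conv c e X - conv c e Y"
  using assms by (simp add: pointwise conv_conv0 conv0_diff convable_convable0)

lemma convable_diff: "convable c X \<Longrightarrow> convable c Y \<Longrightarrow> convable c (X - Y)"
  by (simp add: convable_convable0 convable0_diff minus_apply)

lemma conv_add:
  assumes "convable c X" "convable c Y"
  shows "conv c e (X + Y) = conv c e X + conv c e Y"
proof -
  have "convable c (0 - Y)"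
    by (rule convable_diff[OF _ assms(2)]) (simp add: convable_def zero_fun_apply)
  moreover have "conv c e (0 - Y) = - conv c e Y"
    by (subst conv_diff[OF _ assms(2)]) (simp_all add: convable_def conv_0 zero_fun_apply)
  ultimately show ?thesis
    using conv_diff[OF assms(1), of "0 - Y" e] by simp
qed

lemma convable_Dz: "convable c X \<Longrightarrow> convable c (Dz X)"
  unfolding convable_convable0
proof (intro allI)
  fix I K
  assume "\<forall>I K. convable0 c (\<lambda>m n. X m I n K)"
  then have "convable0 c (\<lambda>m n. X m I n K)"
    by blast
  then show "convable0 c (\<lambda>m n. Dz X m I n K)"
    by (rule convable0_subset[where a = 1 and b = 0]) (simp add: Dz_def add.commute add.left_commute del: of_int_add)
qed

lemma convable_Dw: "convable c X \<Longrightarrow> convable c (Dw X)"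
  unfolding convable_convable0
proof (intro allI)
  fix I K
  assume "\<forall>I K. convable0 c (\<lambda>m n. X m I n K)"
  then have "convable0 c (\<lambda>m n. X m I n K)"
    by blast
  then show "convable0 c (\<lambda>m n. Dw X m I n K)"
    by (rule convable0_subset[where a = 0 and b = 1]) (simp add: Dw_def algebra_simps del: of_int_add of_int_diff)
qed

lemma convable_ops:
  assumes "convable c X"
  shows "convable c (D\<theta> i X)" "convable c (D\<zeta> i X)" "convable c (L\<theta> i X)" "convable c (L\<zeta> i X)"
proof -
  have "convable0 c (\<lambda>m n. scale a (X m I n K))" for a I K
    using assms by (auto simp: convable_convable0 intro: convable0_additive[where T = "scale a"])
  moreover have "convable0 c (\<lambda>m n. 0)"
    by (simp add: convable0_def)
  ultimately have "convable0 c (\<lambda>m n. if P then scale a (X m I n K) else 0)"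
    "convable0 c (\<lambda>m n. if P then 0 else scale a (X m I n K))" for P a I K
    by (cases P; simp)+
  then show "convable c (D\<theta> i X)" "convable c (D\<zeta> i X)" "convable c (L\<theta> i X)" "convable c (L\<zeta> i X)"
    unfolding convable_convable0 D\<theta>_def D\<zeta>_def L\<theta>_def L\<zeta>_def by (auto split: if_split)
qed

definition Dbar :: "'n::{finite,linorder} \<Rightarrow> ('n, 'v) ser2 \<Rightarrow> ('n, 'v) ser2" where
  "Dbar i X = (D\<theta> i X - L\<theta> i (Dz X)) + (D\<zeta> i X - L\<zeta> i (Dw X))"

text \<open>\<open>Z - W\<close> and \<open>\<theta>^i - \<zeta>^i\<close> are annihilated by the sum of the two derivations \<open>Dbar\<^sub>Z\<close> and \<open>Dbar\<^sub>W\<close>.\<close>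

lemma lin_op_ZWs:
  assumes T: "lop T" and c: "binomial_family c" and X: "convable c X" and TX: "lin_op T X = Dbar i X"
  shows "lin_op T (ZWs (\<lambda>e. conv c e X) j J) = Dbar i (ZWs (\<lambda>e. conv c e X) j J)"
proof -
  \<comment> \<open>T anticommutes with the odd scalar factors and commutes with Q, so ?D obeys the
    rules of an odd derivation. For it z - w and \<Sum> \<theta>^i \<zeta>^i have the same
    derivative, hence A = A', and \<theta>^i - \<zeta>^i has derivative 0, hence c = 0.\<close>
  let ?D = "\<lambda>X. lin_op T X - Dbar i X"
  have Dbar_lin: "lin (Dbar i)"
    by (simp add: lin_def Dbar_def sc_add sc_diff)
  note TL = linD[OF lin_lin_op[OF T]] and TA = lin_op_anticommutes[OF T]
  have HQ: "lin_op T (Q X) = Q (lin_op T X)" for X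
    by (rule Q_comm_aux[OF lin_lin_op[OF T] TA(1,2)])
  have "?D (ZWs (\<lambda>e. conv c e X) j J) = sc (of_int j) (H i (ZWs (\<lambda>e. conv c e X) (j - 1) J)
     - H i (ZWs (\<lambda>e. conv c e X) (j - 1) J))
    - (if i \<in> J then sc (0 * pos_sign i J) (ZWs (\<lambda>e. conv c e X) j (J - {i})) else 0)"
  proof (rule D_ZWs[where A = "H i" and A' = "H i"])
    show "lin ?D"
      by (intro lin_minus lin_lin_op T Dbar_lin)
    show "H i ((Q ^^ card (UNIV :: 'a set)) X) = 0" for X
      unfolding H_def[of i] L_Q_power by simp
    show "?D (Q X) = Q (?D X) + H i X" for X
      by (simp add: HQ Dbar_def D\<theta>_Q D\<zeta>_Q Dz_comm Dw_comm Q_L\<theta> Q_L\<zeta> H_def)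
    show "?D (H j X) = - H j (?D X) - (if j = i then sc 0 X else 0)" for j X
    proof -
      have "lin_op T (H j X) = - H j (lin_op T X)"
        by (simp add: H_def TL TA)
      then show ?thesis
        by (simp add: Dbar_def D\<theta>_H D\<zeta>_H Dz_comm Dw_comm L\<theta>_H L\<zeta>_H)
    qed
    show "?D (conv c e X) = sc (of_int e) (H i (conv c (e - 1) X))" for e
    proof -
      have "Dbar i (conv c e X) = conv c e (Dbar i X) - sc (of_int e) (H i (conv c (e - 1) X))"
      proof -
        have "conv c e (Dbar i X) = (D\<theta> i (conv c e X) - L\<theta> i (conv c e (Dz X)))
            + (D\<zeta> i (conv c e X) - L\<zeta> i (conv c e (Dw X)))"
          unfolding Dbar_def
          by (simp only: conv_add conv_diff convable_diff convable_ops convable_Dz convable_Dw conv_D X)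
        then show ?thesis
          by (simp add: Dbar_def Dz_conv[OF c X] Dw_conv[OF c X] H_def sc_diff sc_minus)
      qed
      then show ?thesis
        using TX conv_lin_op[OF T X, of e] by simp
    qed
  qed (simp_all add: Q_H H_H[of i])
  then show ?thesis
    by (simp split: if_splits)
qed

text \<open>At \<zeta> = 0 the factors \<theta>^i - \<zeta>^i become \<theta>^i.\<close>

lemma HJ_bottom:
  fixes J :: "'n::{finite,linorder} set"
  shows "HJ J X m I n {} = (if J \<subseteq> I then scale (shuffle_sign J (I - J)) (X m (I - J) n {}) else 0)"
proof (induction J arbitrary: I rule: finite_min_induct)
  case (insert i J)
  have i: "i \<notin> J" and pos: "pos_sign i J = 1"
    using insert.hyps by (blast, rule pos_sign_less)
  have HJ: "HJ (insert i J) X = H i (HJ J X)"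
    using insert.hyps by (rule HJ_insert_min)
  have step: "HJ (insert i J) X m I n {} = (if i \<in> I then scale (pos_sign i I) (HJ J X m (I - {i}) n {}) else 0)"
    unfolding HJ by (simp add: H_def minus_apply L\<theta>_def L\<zeta>_def)
  show ?case
  proof (cases "insert i J \<subseteq> I")
    case True
    then have J: "J \<subseteq> I - {i}" and eq: "I - {i} - J = I - insert i J"
      using i by auto
    have "pos_sign i (I - {i}) = pos_sign i J * pos_sign i (I - {i} - J)"
      using J by (rule pos_sign_split)
    then have "pos_sign i I = pos_sign i (I - insert i J)"
      unfolding pos eq by simp
    then show ?thesis
      unfolding step insert.IH using True J eq i by (simp add: shuffle_sign_insert_left)
  next
    case False
    then show ?thesis
      unfolding step insert.IH by auto
  qed
qed simp

end

sublocale vector_superspace \<subseteq> complex_vector_space scale ..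

context vector_superspace
begin

lemma has_parityD: "has_parity V p T \<Longrightarrow> v \<in> V q \<Longrightarrow> T v \<in> V (p + q)"
  by (simp add: has_parity_def)

end

section \<open>Uniqueness, and covariance of series applied to the vacuum\<close>

context susy_vertex_algebra
begin

lemma S_lop: "lop (S i)"
  by (rule linear_lop, rule S_linear)

lemma Y_superfield: "superfield (Y a)"
  by (rule is_superfield_superfield, rule Y_field)

lemma Y_0: "Y 0 n I v = 0"
  using lopD(3)[OF linear_lop[OF Y_linear[of n I v]]] .

text \<open>The two terms share a sign by \<open>koszul_exchange\<close>, so locality passes to the
  components; one exponent r serves all I, K and v.\<close>

lemma loc_Y:
  assumes "a \<in> V p" "b \<in> V q"
  shows "\<exists>r. (\<forall>I K. loc_upto r (koszul ((p + par I) * (q + par K))) (\<lambda>n. Y a n I) (\<lambda>n. Y b n K)) \<and>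
    (\<forall>v. (Lzw ^^ r) (supercomm_at p q (Y a) (Y b) v) = 0)"
proof -
  obtain r where r: "op_mult2 scale (exp_zw (int r)) (supercomm scale p q (Y a) (Y b)) = (\<lambda>_ _ _ _ _. 0)"
    using locality[OF assms] by blast
  have r: "(diff2 ^^ r) (\<lambda>m n. supercomm scale p q (Y a) (Y b) m I n K v) m n = 0" for m I n K v
    using r by (simp add: fun_eq_iff op_mult2_def mult2_exp_zw_of_nat)
  have "loc_upto r (koszul ((p + par I) * (q + par K))) (\<lambda>n. Y a n I) (\<lambda>n. Y b n K)" for I K
    unfolding loc_upto_def
  proof
    fix v
    let ?x = "\<lambda>m n. Y a m I (Y b n K v) - scale (koszul ((p + par I) * (q + par K))) (Y b n K (Y a m I v))"
    let ?s = "koszul ((p + par I) * par K)"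
    have "lop (scale ?s)"
      by (simp add: lop_def scale_right_distrib mult.commute)
    have "supercomm scale p q (Y a) (Y b) m I n K v = scale ?s (?x m n)" for m n
      unfolding supercomm_def prod_ZW_def prod_WZ_def
      by (simp only: scale_right_diff_distrib scale_scale koszul_exchange)
    note * = this
    have "(diff2 ^^ r) (\<lambda>m n. scale ?s (?x m n)) = (\<lambda>m n. scale ?s ((diff2 ^^ r) ?x m n))"
      by (rule diff2_power_lop) fact
    then have "scale ?s ((diff2 ^^ r) ?x m n) = 0" for m n
      using r[of I K v m n] unfolding * by (simp only:)
    then have "scale ?s (scale ?s ((diff2 ^^ r) ?x m n)) = 0" for m n
      by (simp only: scale_zero_right)
    then show "(diff2 ^^ r) ?x = 0"
      by (simp only: scale_scale koszul_mult_self scale_one fun_eq_iff zero_fun_apply simp_thms)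
  qed
  moreover have "(Lzw ^^ r) (supercomm_at p q (Y a) (Y b) v) = 0" for v
  proof -
    have "(Lzw ^^ k) X m I n K = (diff2 ^^ k) (\<lambda>m n. X m I n K) m n" for k m I n K and X :: "('n, 'v) ser2"
      by (induction k arbitrary: m n) (simp_all add: Lzw_def diff2_def)
    then show ?thesis
      using r by (simp add: pointwise supercomm_at_apply)
  qed
  ultimately show ?thesis
    by blast
qed

lemma loc_Y': "a \<in> V p \<Longrightarrow> b \<in> V q \<Longrightarrow> loc (koszul ((p + par I) * (q + par K))) (\<lambda>n. Y a n I) (\<lambda>n. Y b n K)"
  using loc_Y[of a p b q] unfolding loc_def by blast

lemma Y_mode_parity: "a \<in> V p \<Longrightarrow> b \<in> V q \<Longrightarrow> Y a n I b \<in> V (p + par I + q)"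
  using Y_parity[of a p] unfolding ser_has_parity_def by (blast intro: has_parityD)

text \<open>It is enough to test the components of the Y(c, W) without \<zeta>: their coefficient of
  w^0 already produces c from the vacuum.\<close>

lemma field_unique:
  assumes D: "\<And>n. lop (D n)" and vac: "\<And>n. D n vac = 0"
    and loc: "\<And>c r. c \<in> V r \<Longrightarrow> \<exists>\<epsilon>. loc \<epsilon> D (\<lambda>n. Y c n {})"
  shows "D n v = 0"
proof -
  have homogeneous: "D n c = 0" if c: "c \<in> V r" for c r
  proof -
    obtain \<epsilon> where "loc \<epsilon> D (\<lambda>n. Y c n {})"
      using loc[OF c] by blast
    then have "D n (Y c 0 {} vac) = 0"
      by (rule loc_unique[OF superfieldD[OF Y_superfield] D _ vac vac_regular lopD(3)[OF D]])
    then show ?thesis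
      by (simp add: vac_value)
  qed
  obtain x y where "x \<in> V 0" "y \<in> V 1" "v = x + y"
    using V_sum by blast
  then show ?thesis
    by (simp add: lopD(1)[OF D] homogeneous)
qed

text \<open>\<open>S^i u(W) = Dbar^i u(W)\<close> for a vector-valued series \<open>u\<close>.\<close>

definition vac_covariant :: "('n, 'v) ser1 \<Rightarrow> bool" where
  "vac_covariant u \<longleftrightarrow> (\<forall>i n K. scale (set_sign K) (S i (u n K)) =
     (if i \<in> K then - scale (pos_sign i K * of_int (n + 1)) (u (n + 1) (K - {i}))
      else scale (pos_sign i K) (u n (insert i K))))"

lemma vac_covariantD:
  assumes "vac_covariant u"
  shows "i \<in> K \<Longrightarrow> scale (set_sign K) (S i (u n K)) = - scale (pos_sign i K * of_int (n + 1)) (u (n + 1) (K - {i}))"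
    "i \<notin> K \<Longrightarrow> scale (set_sign K) (S i (u n K)) = scale (pos_sign i K) (u n (insert i K))"
  using assms by (auto simp: vac_covariant_def)

text \<open>For i \<notin> K the equation gives u n (insert i K) from u n K, and for K = {i} it
  gives u (n + 1) {}, up to the factor n + 1, from u n {i}. So u 0 {} determines all coefficients
  with n \<ge> 0.\<close>

lemma vac_covariant_unique:
  assumes u: "vac_covariant u" and neg: "\<And>n K. n < 0 \<Longrightarrow> u n K = 0" and "u 0 {} = 0"
  shows "u n K = 0"
proof -
  note S0 = lopD(3)[OF S_lop]
  have row: "u n K = 0" if "u n {} = 0" for n K
  proof -
    have "finite K" by simp
    then show ?thesis
    proof (induction K rule: finite_induct)
      case (insert i K)
      then have "scale (pos_sign i K) (u n (insert i K)) = 0"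
        using vac_covariantD(2)[OF u, of i K n] by (simp add: S0)
      then show ?case
        by (simp add: pos_sign_def)
    qed (rule that)
  qed
  have "u (int k) {} = 0" for k
  proof (induction k)
    case (Suc k)
    \<comment> \<open>N \<ge> 1 enters here, as \<open>'n\<close> is inhabited: the power of z is
      raised only through an odd variable.\<close>
    fix i :: 'n
    have "scale (of_int (int k + 1)) (u (int k + 1) {}) = 0"
      using vac_covariantD(1)[OF u, of i "{i}" "int k"] row[OF Suc, of "{i}"] by (simp add: S0)
    then have "u (int k + 1) {} = 0"
      by (simp only: scale_eq_0_iff of_int_eq_0_iff) linarith
    then show ?case
      by (simp add: add.commute)
  qed (use assms in simp)
  then show ?thesis
    using row neg by (cases n) auto
qed

lemma vac_covariant_diff:
  assumes u: "vac_covariant u" and v: "vac_covariant v"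
  shows "vac_covariant (\<lambda>n K. u n K - scale c (v n K))"
proof -
  have *: "scale (set_sign K) (S i (u n K - scale c (v n K))) =
      scale (set_sign K) (S i (u n K)) - scale c (scale (set_sign K) (S i (v n K)))" for i n K
    by (simp add: lopD[OF S_lop] scale_right_diff_distrib mult.commute)
  show ?thesis
    unfolding vac_covariant_def *
  proof (intro allI)
    fix i n K
    show "scale (set_sign K) (S i (u n K)) - scale c (scale (set_sign K) (S i (v n K))) =
      (if i \<in> K then - scale (pos_sign i K * of_int (n + 1)) (u (n + 1) (K - {i}) - scale c (v (n + 1) (K - {i})))
       else scale (pos_sign i K) (u n (insert i K) - scale c (v n (insert i K))))"
    proof (cases "i \<in> K")
      case True
      show ?thesis
        unfolding vac_covariantD(1)[OF u True] vac_covariantD(1)[OF v True]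
        using True by (simp add: scale_right_diff_distrib mult.commute del: of_int_add)
    next
      case False
      show ?thesis
        unfolding vac_covariantD(2)[OF u False] vac_covariantD(2)[OF v False]
        using False by (simp add: scale_right_diff_distrib mult.commute)
    qed
  qed
qed

lemma Y_translation:
  assumes "a \<in> V p"
  shows "S i (Y a n I v) = scale (set_sign I) (scale (koszul p) (Y a n I (S i v)) +
    (if i \<in> I then - scale (pos_sign i I * of_int (n + 1)) (Y a (n + 1) (I - {i}) v)
     else scale (pos_sign i I) (Y a n (insert i I) v)))"
proof -
  have "op_supercomm scale 1 p (S i) (Y a) n I v = Dbar_Z scale i (Y a) n I v"
    using translation[OF assms] by (simp only:)
  then have "scale (set_sign I) (S i (Y a n I v)) = scale (koszul p) (Y a n I (S i v)) +
    (if i \<in> I then - scale (pos_sign i I * of_int (n + 1)) (Y a (n + 1) (I - {i}) v)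
     else scale (pos_sign i I) (Y a n (insert i I) v))"
    unfolding op_supercomm_def mult_1_left koszul_par
    by (cases "i \<in> I") (simp_all add: Dbar_Z_def d_theta_def m_theta_def d_z_def
        shuffle_sign_singleton_left koszul_par diff_eq_eq add.commute)
  then have "scale (set_sign I) (scale (set_sign I) (S i (Y a n I v))) = scale (set_sign I) (scale (koszul p) (Y a n I (S i v)) +
    (if i \<in> I then - scale (pos_sign i I * of_int (n + 1)) (Y a (n + 1) (I - {i}) v)
     else scale (pos_sign i I) (Y a n (insert i I) v)))"
    by (simp only:)
  then show ?thesis
    by (simp only: scale_scale set_sign_mult_self scale_one)
qed

lemma Y_vac_covariant:
  assumes "a \<in> V p"
  shows "vac_covariant (\<lambda>n K. Y a n K vac)"
  unfolding vac_covariant_def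
  by (simp add: Y_translation[OF assms] S_vac lopD[OF superfield_lop[OF Y_superfield]])

text \<open>Y(a, Z) on the vacuum has no negative powers of z, and neither has the expansion in |w|
  > |z|, so the second half of the product has no residue.\<close>

lemma nth_product_vac:
  "nth_product scale p q j J (Y a) (Y b) n K vac =
    ZWs (\<lambda>e. conv c_zw e (ZW_at p (Y a) (Y b) vac)) j J (- 1) UNIV n K"
proof -
  have "conv c_wz e (WZ_at q (Y b) (Y a) vac) (- 1) I n K = 0" for e I n K
  proof -
    have "scale (c_wz e l) (WZ_at q (Y b) (Y a) vac (- 1 - e + l) I (n - l) K) = 0" for l
      by (cases "l \<le> e") (simp_all add: WZ_at_def prod_WZ_def vac_regular c_wz_def c_zw_def
          lopD[OF superfield_lop[OF Y_superfield]])
    then show ?thesis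
      by (simp only: conv_def) simp
  qed
  then have "ZWs (\<lambda>e. conv c_wz e (WZ_at q (Y b) (Y a) vac)) j J (- 1) UNIV n K = 0"
    unfolding ZWs_def sum_fun_apply sc_apply by (intro sum.neutral ballI) (simp add: Q_HJ_cong0)
  then show ?thesis
    by (simp add: nth_product_ZWs[OF Y_superfield Y_superfield] minus_apply sc_apply)
qed

text \<open>S^i passes a(Z) and then b(W), which gives the two parts of \<open>Dbar i\<close>, and
  finally kills the vacuum.\<close>

lemma ZW_at_vac_covariant:
  assumes a: "a \<in> V p" and b: "b \<in> V q"
  shows "lin_op (S i) (ZW_at p (Y a) (Y b) vac) = Dbar i (ZW_at p (Y a) (Y b) vac)"
proof (intro ext)
  fix m I n K
  note la = lopD[OF superfield_lop[OF Y_superfield[of a]]]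
  note lb = lopD[OF superfield_lop[OF Y_superfield[of b]]]
  have Sb: "S i (Y b n K vac) = scale (set_sign K)
    (if i \<in> K then - scale (pos_sign i K * of_int (n + 1)) (Y b (n + 1) (K - {i}) vac)
     else scale (pos_sign i K) (Y b n (insert i K) vac))"
    unfolding Y_translation[OF b] by (simp add: S_vac lb)
  define k where "k = (\<lambda>(I :: 'n set) (K :: 'n set). koszul ((p + par I) * par K))"
  have k_insert: "k (insert i I) K = k I K * set_sign K" if "i \<notin> I" for i I K
    unfolding k_def card_insert_disjoint[OF finite that]
    by (simp only: of_nat_Suc distrib_right koszul_add koszul_par mult_1_left) (simp only: mult_ac)
  have k_insert': "k I (insert i K) = k I K * (koszul p * set_sign I)" if "i \<notin> K" for i I K
    unfolding k_def card_insert_disjoint[OF finite that]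
    by (simp only: of_nat_Suc distrib_left koszul_add koszul_par mult_1_right) (simp only: mult_ac)
  have k_remove: "k (I - {i}) K = k I K * set_sign K" if "i \<in> I" for i I K
    using k_insert[of i "I - {i}" K] that by (simp add: insert_absorb mult.assoc)
  have k_remove': "k I (K - {i}) = k I K * (koszul p * set_sign I)" if "i \<in> K" for i I K
    using k_insert'[of i "K - {i}" I] that by (simp add: insert_absorb mult_ac)
  have ZW: "ZW_at p (Y a) (Y b) vac m I n K = scale (k I K) (Y a m I (Y b n K vac))" for m I n K
    by (simp only: ZW_at_def prod_ZW_def k_def)
  let ?dI = "if i \<in> I then - scale (pos_sign i I * of_int (m + 1)) (Y a (m + 1) (I - {i}) (Y b n K vac))
     else scale (pos_sign i I) (Y a m (insert i I) (Y b n K vac))"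
  let ?dK = "if i \<in> K then - scale (pos_sign i K * of_int (n + 1)) (Y a m I (Y b (n + 1) (K - {i}) vac))
     else scale (pos_sign i K) (Y a m I (Y b n (insert i K) vac))"
  have la_minus: "Y a m I (- v) = - Y a m I v" for m I v
    using la(2)[of m I "- 1" v] by simp
  have "S i (Y a m I (Y b n K vac)) = scale (set_sign I) (scale (koszul p) (scale (set_sign K) ?dK) + ?dI)"
    unfolding Y_translation[OF a] Sb by (simp add: la la_minus)
  then have 1: "lin_op (S i) (ZW_at p (Y a) (Y b) vac) m I n K =
      scale (k I K) (scale (koszul p) ?dK + scale (set_sign K) ?dI)"
    by (simp only: lin_op_def ZW lopD[OF S_lop] scale_right_distrib scale_scale) (simp add: mult_ac)
  have 2: "(D\<theta> i (ZW_at p (Y a) (Y b) vac) - L\<theta> i (Dz (ZW_at p (Y a) (Y b) vac))) m I n K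
      = scale (k I K) (scale (set_sign K) ?dI)"
    by (simp add: minus_apply D\<theta>_def L\<theta>_def Dz_def ZW k_insert k_remove mult_ac)
  have 3: "(D\<zeta> i (ZW_at p (Y a) (Y b) vac) - L\<zeta> i (Dw (ZW_at p (Y a) (Y b) vac))) m I n K
      = scale (k I K) (scale (koszul p) ?dK)"
    by (simp add: minus_apply D\<zeta>_def L\<zeta>_def Dw_def ZW k_insert' k_remove' mult_ac)
  show "lin_op (S i) (ZW_at p (Y a) (Y b) vac) m I n K = Dbar i (ZW_at p (Y a) (Y b) vac) m I n K"
    unfolding 1 Dbar_def plus_fun_apply 2 3 by (simp only: scale_right_distrib add.commute)
qed

lemma nth_product_vac_covariant:
  assumes a: "a \<in> V p" and b: "b \<in> V q"
  shows "vac_covariant (\<lambda>n K. nth_product scale p q j J (Y a) (Y b) n K vac)"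
  unfolding vac_covariant_def nth_product_vac
proof (intro allI)
  fix i n K
  let ?F = "ZWs (\<lambda>e. conv c_zw e (ZW_at p (Y a) (Y b) vac)) j J"
  have "lin_op (S i) ?F = Dbar i ?F"
    by (rule lin_op_ZWs[OF S_lop binomial_family_zw convable_ZW_at[OF Y_superfield Y_superfield] ZW_at_vac_covariant[OF a b]])
  then have "lin_op (S i) ?F (- 1) UNIV n K = Dbar i ?F (- 1) UNIV n K"
    by (simp only:)
  \<comment> \<open>The residue annihilates the Z-part of \<open>Dbar i\<close>:
    \<partial>/\<partial>\<theta>^i never reaches the top degree, and \<partial>/\<partial>z has no
    coefficient at z^(-1).\<close>
  then have "scale (set_sign (UNIV :: 'n set)) (scale (set_sign K) (S i (?F (- 1) UNIV n K))) =
     scale (set_sign (UNIV :: 'n set)) (if i \<in> K then - scale (pos_sign i K * of_int (n + 1)) (?F (- 1) UNIV (n + 1) (K - {i}))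
      else scale (pos_sign i K) (?F (- 1) UNIV n (insert i K)))"
    by (simp add: lin_op_def Dbar_def plus_fun_apply minus_apply D\<theta>_def L\<theta>_def Dz_def D\<zeta>_def L\<zeta>_def Dw_def)
  then show "scale (set_sign K) (S i (?F (- 1) UNIV n K)) =
      (if i \<in> K then - scale (pos_sign i K * of_int (n + 1)) (?F (- 1) UNIV (n + 1) (K - {i}))
      else scale (pos_sign i K) (?F (- 1) UNIV n (insert i K)))"
    by (simp only: scale_cancel_left set_sign_ne_0 simp_thms)
qed

end

section \<open>The field of S^i a\<close>

context susy_vertex_algebra
begin

text \<open>This makes the two-variable operator relations available for u(W). The copies of u at
  all powers of z are left apart by the operators in W.\<close>

definition const_Z :: "('n, 'v) ser1 \<Rightarrow> ('n, 'v) ser2" where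
  "const_Z u = (\<lambda>m I n K. if I = {} then u n K else 0)"

lemma vac_covariant_iff:
  "vac_covariant u \<longleftrightarrow> (\<forall>i. lin_op (S i) (const_Z u) = D\<zeta> i (const_Z u) - L\<zeta> i (Dw (const_Z u)))"
proof -
  have "lin_op (S i) (const_Z u) = D\<zeta> i (const_Z u) - L\<zeta> i (Dw (const_Z u)) \<longleftrightarrow>
    (\<forall>n K. scale (set_sign K) (S i (u n K)) =
     (if i \<in> K then - scale (pos_sign i K * of_int (n + 1)) (u (n + 1) (K - {i}))
      else scale (pos_sign i K) (u n (insert i K))))"
    (is "?L = ?R \<longleftrightarrow> _") for i
  proof -
    have "?L m I n K = ?R m I n K \<longleftrightarrow> I \<noteq> {} \<or> scale (set_sign K) (S i (u n K)) =
       (if i \<in> K then - scale (pos_sign i K * of_int (n + 1)) (u (n + 1) (K - {i}))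
        else scale (pos_sign i K) (u n (insert i K)))" for m I n K
      by (simp add: lin_op_def const_Z_def D\<zeta>_def L\<zeta>_def Dw_def minus_apply lopD[OF S_lop])
    then show ?thesis
      by (auto simp: fun_eq_iff)
  qed
  then show ?thesis
    by (simp add: vac_covariant_def)
qed

lemma D_Z_apply:
  "D_Z scale i (Y a) n I v = (if i \<in> I then scale (pos_sign i I * of_int (n + 1)) (Y a (n + 1) (I - {i}) v)
    else scale (pos_sign i I) (Y a n (insert i I) v))"
  by (simp add: D_Z_def d_theta_def m_theta_def d_z_def shuffle_sign_singleton_left)

text \<open>D^i anticommutes with Dbar^j and, both being odd, with S^j.\<close>

lemma vac_covariant_D_Z:
  assumes a: "a \<in> V p"
  shows "vac_covariant (\<lambda>n K. D_Z scale i (Y a) n K vac)"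
  unfolding vac_covariant_iff
proof
  fix j
  let ?u = "const_Z (\<lambda>n K. Y a n K vac)"
  have u: "lin_op (S j) ?u = D\<zeta> j ?u - L\<zeta> j (Dw ?u)"
    using Y_vac_covariant[OF a] by (simp add: vac_covariant_iff)
  have D: "const_Z (\<lambda>n K. D_Z scale i (Y a) n K vac) = D\<zeta> i ?u + L\<zeta> i (Dw ?u)"
    by (auto simp: pointwise const_Z_def D\<zeta>_def L\<zeta>_def Dw_def D_Z_apply)
  note lin = linD[OF lin_lin_op[OF S_lop]] and ac = lin_op_anticommutes[OF S_lop]
  show "lin_op (S j) (const_Z (\<lambda>n K. D_Z scale i (Y a) n K vac)) =
      D\<zeta> j (const_Z (\<lambda>n K. D_Z scale i (Y a) n K vac)) - L\<zeta> j (Dw (const_Z (\<lambda>n K. D_Z scale i (Y a) n K vac)))"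
    unfolding D
    by (simp add: lin ac u DL_commute D\<zeta>_L\<zeta> D\<zeta>_D\<zeta>[of i j] L\<zeta>_L\<zeta>[of i j])
qed

lemma lop_scale_op: "lop T \<Longrightarrow> lop (\<lambda>v. scale c (T v))"
  by (simp add: lop_def scale_right_distrib mult.commute)

lemma lop_diff_op: "lop T \<Longrightarrow> lop U \<Longrightarrow> lop (\<lambda>v. T v - U v)"
  by (simp add: lop_def scale_right_diff_distrib)

lemma Y_S:
  assumes a: "a \<in> V p"
  shows "Y (S i a) = D_Z scale i (Y a)"
proof (intro ext)
  fix n I v
  let ?D = "\<lambda>n v. Y (S i a) n I v - D_Z scale i (Y a) n I v"
  have Sa: "S i a \<in> V (1 + p)"
    using S_odd a by (rule has_parityD)
  note field = superfieldD[OF Y_superfield]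
  have "?D n v = 0"
  proof (rule field_unique[where D = ?D])
    show "lop (?D n)" for n
      unfolding D_Z_apply
      by (cases "i \<in> I") (simp_all only: if_True if_False lop_diff_op lop_scale_op superfield_lop[OF Y_superfield])
    show "\<exists>\<epsilon>. loc \<epsilon> ?D (\<lambda>n. Y c n {})" if c: "c \<in> V r" for c r
    proof (intro exI loc_diff field)
      let ?\<epsilon> = "koszul ((1 + p + par I) * (r + par ({} :: 'n set)))"
      show "loc ?\<epsilon> (\<lambda>n. Y (S i a) n I) (\<lambda>n. Y c n {})"
        using loc_Y'[OF Sa c] .
      show "loc ?\<epsilon> (\<lambda>n. D_Z scale i (Y a) n I) (\<lambda>n. Y c n {})"
      proof (cases "i \<in> I")
        case True
        have "par I = 1 + par (I - {i})"
          using True by (simp only: card.remove[OF finite True] of_nat_Suc)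
        then have "1 + p + par I = p + par (I - {i}) + (1 + 1)"
          by (simp only: add_ac)
        then have "1 + p + par I = p + par (I - {i})"
          by (simp only: bit_add_self add_0_right)
        then have "loc ?\<epsilon> (\<lambda>n. Y a n (I - {i})) (\<lambda>n. Y c n {})"
          using loc_Y'[OF a c, of "I - {i}" "{}"] by (simp only:)
        then have "loc ?\<epsilon> (\<lambda>n v. scale (pos_sign i I) (scale (of_int (n + 1)) (Y a (n + 1) (I - {i}) v))) (\<lambda>n. Y c n {})"
          by (intro loc_scale loc_deriv field)
        then show ?thesis
          using True by (simp add: D_Z_apply[abs_def] del: of_int_add)
      next
        case False
        have "par (insert i I) = 1 + par I"
          by (simp only: card_insert_disjoint[OF finite False] of_nat_Suc)
        then have "1 + p + par I = p + par (insert i I)"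
          by (simp only: add_ac)
        then have "loc ?\<epsilon> (\<lambda>n. Y a n (insert i I)) (\<lambda>n. Y c n {})"
          using loc_Y'[OF a c, of "insert i I" "{}"] by (simp only:)
        then have "loc ?\<epsilon> (\<lambda>n v. scale (pos_sign i I) (Y a n (insert i I) v)) (\<lambda>n. Y c n {})"
          by (intro loc_scale field)
        then show ?thesis
          using False by (simp add: D_Z_apply[abs_def])
      qed
    qed
    have "vac_covariant (\<lambda>n K. Y (S i a) n K vac - scale 1 (D_Z scale i (Y a) n K vac))"
      by (intro vac_covariant_diff Y_vac_covariant[OF Sa] vac_covariant_D_Z[OF a])
    \<comment> \<open>Covariance at n = 0 and K = {} identifies S^i a with the coefficient of
      \<theta>^i, which is the value at Z = 0 of D^i applied to Y(a, Z) on the vacuum.\<close>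
    moreover have "S i a = Y a 0 {i} vac"
      using vac_covariantD(2)[OF Y_vac_covariant[OF a], of i "{}" 0] by (simp add: vac_value)
    then have "Y (S i a) 0 {} vac - scale 1 (D_Z scale i (Y a) 0 {} vac) = 0"
      by (simp add: vac_value D_Z_apply)
    \<comment> \<open>At n = -1 the derivative reaches the coefficient of z^0, but with the factor n
      + 1 = 0.\<close>
    moreover have "Y (S i a) n K vac - scale 1 (D_Z scale i (Y a) n K vac) = 0" if "n < 0" for n K
    proof (cases "n = - 1")
      case False
      then have "n + 1 < 0"
        using that by simp
      then show ?thesis
        using that by (simp add: vac_regular D_Z_apply)
    qed (simp add: vac_regular D_Z_apply)
    ultimately have "Y (S i a) n K vac - scale 1 (D_Z scale i (Y a) n K vac) = 0" for n K
      using vac_covariant_unique[of "\<lambda>n K. Y (S i a) n K vac - scale 1 (D_Z scale i (Y a) n K vac)"] by blast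
    then show "?D n vac = 0" for n
      by simp
  qed
  then show "Y (S i a) n I v = D_Z scale i (Y a) n I v"
    by simp
qed

section \<open>The field of a mode a_(j|J) b\<close>

lemma nth_product_vac_regular:
  assumes "n < 0"
  shows "nth_product scale p q j J (Y a) (Y b) n K vac = 0"
proof -
  \<comment> \<open>Neither the expansion in |z| > |w| nor Y(b, W) on the vacuum has negative powers
    of w.\<close>
  have *: "conv c_zw e (ZW_at p (Y a) (Y b) vac) m I n K = 0" if "n < 0" for e m I n K
  proof -
    have "scale (c_zw e l) (ZW_at p (Y a) (Y b) vac (m - e + l) I (n - l) K) = 0" for l
      using that by (cases "0 \<le> l") (simp_all add: ZW_at_def prod_ZW_def vac_regular c_zw_def
          lopD[OF superfield_lop[OF Y_superfield]])
    then show ?thesis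
      by (simp only: conv_def) simp
  qed
  have H0: "foldr H xs X m I n K = 0" if "\<And>I K. X m I n K = 0" for xs m I K and X :: "('n, 'v) ser2"
    by (induction xs arbitrary: I K) (simp_all add: that H_def minus_apply L\<theta>_def L\<zeta>_def)
  have Q0: "(Q ^^ k) X m I n K = 0" if "\<And>I K. X m I n K = 0" for k m I K and X :: "('n, 'v) ser2"
  proof (induction k arbitrary: I K)
    case (Suc k)
    have "L\<theta> i (L\<zeta> i ((Q ^^ k) X)) m I n K = 0" for i
      using Suc by (simp add: L\<theta>_def L\<zeta>_def)
    then show ?case
      by (simp add: Q_def[of "(Q ^^ k) X"] sum_fun_apply)
  qed (simp add: that)
  show ?thesis
    unfolding nth_product_vac ZWs_def sum_fun_apply sc_apply HJ_def
    by (simp add: Q0 H0 * assms)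
qed

text \<open>At W = 0 the product is the residue of z^j \<theta>^J Y(a, Z) b, and
  \<open>sigma J\<close> comes from \<theta>^J \<theta>^(N-J).\<close>

lemma nth_product_vac_value:
  "nth_product scale p q j J (Y a) (Y b) 0 {} vac = scale (sigma J) (fmode Y a j J b)"
proof -
  let ?\<Phi> = "\<lambda>e. conv c_zw e (ZW_at p (Y a) (Y b) vac)"
  have "nth_product scale p q j J (Y a) (Y b) 0 {} vac =
      (\<Sum>k\<le>card (UNIV :: 'n set). if k = 0 then HJ J (?\<Phi> j) (- 1) UNIV 0 {} else 0)"
    unfolding nth_product_vac ZWs_def sum_fun_apply sc_apply
    by (rule sum.cong) (auto simp: Q_power_support)
  also have "\<dots> = scale (sigma J) (?\<Phi> j (- 1) (- J) 0 {})"
    by (simp add: HJ_bottom sigma_def Compl_eq_Diff_UNIV)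
  also have "?\<Phi> j (- 1) (- J) 0 {} = fmode Y a j J b"
  proof -
    have "scale (c_zw j l) (Y a (- 1 - j + l) (- J) (Y b (0 - l) {} vac)) = (if l = 0 then fmode Y a j J b else 0)" for l
      using lopD(3)[OF superfield_lop[OF Y_superfield[of a]]]
      by (cases "0 < l") (auto simp: vac_regular vac_value fmode_def c_zw_def)
    then show ?thesis
      unfolding conv_ZW_at[OF Y_superfield Y_superfield] by (simp add: conv0_def)
  qed
  finally show ?thesis .
qed

lemma sigma_square: "sigma J * sigma J = 1"
  by (simp add: sigma_def)

lemma Y_mode:
  assumes a: "a \<in> V p" and b: "b \<in> V q"
  shows "Y (fmode Y a j J b) = (\<lambda>n K v. scale (sigma J) (nth_product scale p q j J (Y a) (Y b) n K v))"
proof (intro ext)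
  fix n K v
  let ?c = "fmode Y a j J b"
  let ?N = "nth_product scale p q j J (Y a) (Y b)"
  let ?D = "\<lambda>n v. Y ?c n K v - scale (sigma J) (?N n K v)"
  have c: "?c \<in> V (p + par (- J) + q)"
    unfolding fmode_def using a b by (rule Y_mode_parity)
  note field = superfieldD[OF Y_superfield]
  have "?D n v = 0"
  proof (rule field_unique[where D = ?D])
    show "lop (?D n)" for n
      by (intro lop_diff_op lop_scale_op nth_product_lop superfield_lop Y_superfield)
    show "\<exists>\<epsilon>. loc \<epsilon> ?D (\<lambda>n. Y d n {})" if d: "d \<in> V r" for d r
    proof (intro exI loc_diff loc_scale field)
      show "loc (koszul ((p + q + par (- J) + par K) * (r + par ({} :: 'n set)))) (\<lambda>n. Y ?c n K) (\<lambda>n. Y d n {})"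
        using loc_Y'[OF c d, of K "{}"] by (simp only: add_ac)
      show "loc (koszul ((p + q + par (- J) + par K) * (r + par ({} :: 'n set)))) (\<lambda>n. ?N n K) (\<lambda>n. Y d n {})"
        by (intro loc_nth_product Y_superfield field loc_Y' a b d)
    qed
    have "Y ?c n K vac - scale (sigma J) (?N n K vac) = 0" for n K
    proof (rule vac_covariant_unique)
      show "vac_covariant (\<lambda>n K. Y ?c n K vac - scale (sigma J) (?N n K vac))"
        by (intro vac_covariant_diff Y_vac_covariant[OF c] nth_product_vac_covariant[OF a b])
      show "Y ?c n K vac - scale (sigma J) (?N n K vac) = 0" if "n < 0" for n K
        using that by (simp add: vac_regular nth_product_vac_regular)
      show "Y ?c 0 {} vac - scale (sigma J) (?N 0 {} vac) = 0"
        by (simp add: vac_value nth_product_vac_value sigma_square)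
    qed
    then show "?D n vac = 0" for n .
  qed
  then show "Y ?c n K v = scale (sigma J) (?N n K v)"
    by simp
qed

lemma Y_mode_nth_product:
  assumes "a \<in> V p" "b \<in> V q"
  shows "nth_product scale p q j J (Y a) (Y b) n K v = scale (sigma J) (Y (fmode Y a j J b) n K v)"
  by (simp add: Y_mode[OF assms] sigma_square)

section \<open>The OPE formula\<close>

lemma Lzw_power_mono: "(Lzw ^^ r) X = 0 \<Longrightarrow> r \<le> k \<Longrightarrow> (Lzw ^^ k) X = 0"
proof -
  assume X: "(Lzw ^^ r) X = 0" and "r \<le> k"
  then obtain s where k: "k = s + r"
    using le_Suc_ex by (metis add.commute)
  have "(Lzw ^^ s) 0 = (0 :: ('c, 'v) ser2)"
    by (induction s) simp_all
  then show ?thesis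
    by (simp add: k funpow_add X)
qed

lemma lin_Lzw_power: "lin (Lzw ^^ k)"
  by (rule lin_funpow) simp

lemma OPE:
  assumes a: "a \<in> V p" and b: "b \<in> V q"
  shows "supercomm scale p q (Y a) (Y b) m I n K v = Sum_any (\<lambda>(k::nat, L::'n set). scale (sigma L)
    (op_mult2 scale (D_W_div k L delta) (in_W (Y (fmode Y a (int k) L b))) m I n K v))"
proof -
  let ?N = "card (UNIV :: 'n set)"
  let ?E = "supercomm_at p q (Y a) (Y b) v"
  define x where "x = (\<lambda>k L n K. Y (fmode Y a (int k) L b) n K v)"
  define R where "R = (\<lambda>k L. ZWs (\<lambda>e. conv c_delta e (in_W_at (x k L))) (- 1 - int k) (- L))"
  obtain n0 where n0: "\<forall>n<n0. \<forall>I. Y a n I b = 0"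
    using Y_field[of a] unfolding is_superfield_def by blast
  \<comment> \<open>For k \<ge> k0 the index -1 - k lies below n0, so a_(k|L) b = 0 and the sum is
    finite.\<close>
  define k0 where "k0 = nat (- n0)"
  have x0: "x k L = 0" if "k0 \<le> k" for k L
  proof -
    have "- 1 - int k < n0"
      using that by (simp add: k0_def)
    then have "fmode Y a (int k) L b = 0"
      using n0 by (simp add: fmode_def)
    then show ?thesis
      by (simp add: x_def Y_0 pointwise)
  qed
  have R0: "R k L = 0" if "k0 \<le> k" for k L
  proof -
    have "in_W_at (x k L) = 0"
      by (simp add: x0[OF that] in_W_at_def pointwise)
    then show ?thesis
      by (simp add: R_def conv_0 ZWs_def)
  qed
  have conv_Lzw: "Lzw (conv c_delta e (in_W_at u)) = conv c_delta (e + 1) (in_W_at u)" for e u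
    by (rule Lzw_conv[OF binomial_family_delta convable_in_W])
  \<comment> \<open>Multiplying by (Z - W)^(j|J) gives zero unless J \<subseteq> L, and the residue
    then needs every odd factor, so L \<subseteq> J, and the exponent -1, so k = j.\<close>
  have R_residue: "(LZW ^^ j) (HJ J (R k L)) (- 1) UNIV n K =
      (if k = j \<and> L = J then scale (sigma J) (x j J n K) else 0)" for j J k L n K
  proof -
    have R: "(LZW ^^ j) (HJ J (R k L)) = (if J \<inter> - L = {} then sc (shuffle_sign J (- L))
        (ZWs (\<lambda>e. conv c_delta e (in_W_at (x k L))) (- 1 - int k + int j) (J \<union> - L)) else 0)"
      unfolding R_def HJ_ZWs
      using LZW_power_ZWs[of "\<lambda>e. conv c_delta e (in_W_at (x k L))", OF conv_Lzw] by simp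
    have "J \<inter> - L = {} \<and> J \<union> - L = UNIV \<longleftrightarrow> L = J"
      by blast
    then show ?thesis
      unfolding R by (auto simp: sc_apply ZWs_delta_residue sigma_def zero_fun_apply)
  qed
  define E where "E = ?E - (\<Sum>k<k0. \<Sum>L\<in>UNIV. R k L)"
  have "residue_free E"
    unfolding residue_free_def
  proof (intro allI)
    fix j J n K
    have "(LZW ^^ j) (HJ J (\<Sum>k<k0. \<Sum>L\<in>UNIV. R k L)) (- 1) UNIV n K =
        (\<Sum>k<k0. \<Sum>L\<in>UNIV. if k = j \<and> L = J then scale (sigma J) (x j J n K) else 0)"
      by (simp only: lin_sum[OF lin_HJ] lin_sum[OF lin_LZW_power] sum_fun_apply R_residue)
    also have "\<dots> = (\<Sum>k<k0. if k = j then scale (sigma J) (x j J n K) else 0)"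
      by (rule sum.cong) (auto simp: sum.delta)
    also have "\<dots> = scale (sigma J) (x j J n K)"
      using x0[of j J] by (auto simp: zero_fun_apply)
    finally have "(LZW ^^ j) (HJ J (\<Sum>k<k0. \<Sum>L\<in>UNIV. R k L)) (- 1) UNIV n K = scale (sigma J) (x j J n K)" .
    moreover have "(LZW ^^ j) (HJ J ?E) (- 1) UNIV n K = scale (sigma J) (x j J n K)"
      unfolding x_def Y_mode_nth_product[OF a b, symmetric] nth_product_of_nat[OF Y_superfield Y_superfield] ..
    ultimately show "(LZW ^^ j) (HJ J E) (- 1) UNIV n K = 0"
      by (simp add: E_def minus_apply)
  qed
  moreover have "\<exists>r. (Lzw ^^ r) E = 0"
  proof -
    obtain r where r: "(Lzw ^^ r) ?E = 0"
      using loc_Y[OF a b] by blast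
    \<comment> \<open>r handles the supercommutator. For \<open>R k L\<close> at most k0 factors (Z
      - W)^(1|{}) raise the exponent to 0, where the two expansions agree, and N + 1 more are the
      price of using z - w instead.\<close>
    let ?r = "r + (k0 + Suc ?N)"
    have "(Lzw ^^ ?r) (R k L) = 0" if "k < k0" for k L
    proof -
      have "(LZW ^^ Suc k) (R k L) = ZWs (\<lambda>e. conv c_delta e (in_W_at (x k L))) 0 (- L)"
        unfolding R_def
        by (subst LZW_power_ZWs[of "\<lambda>e. conv c_delta e (in_W_at (x k L))", OF conv_Lzw]) simp
      also have "\<dots> = 0"
      proof -
        have "conv c_delta 0 (in_W_at (x k L)) = 0"
          using c_delta_nonneg[of 0] by (simp add: conv_def pointwise)
        then show ?thesis
          by (simp add: ZWs_0)
      qed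
      finally have "(Lzw ^^ (Suc k + Suc ?N)) (R k L) = 0"
        by (rule Lzw_power_0)
      then show ?thesis
        by (rule Lzw_power_mono) (use that in simp)
    qed
    then have "(Lzw ^^ ?r) (\<Sum>k<k0. \<Sum>L\<in>UNIV. R k L) = 0"
      by (simp only: lin_sum[OF lin_Lzw_power]) (intro sum.neutral ballI, simp only: lessThan_iff)
    moreover have "(Lzw ^^ ?r) ?E = 0"
      using r by (rule Lzw_power_mono) simp
    ultimately have "(Lzw ^^ ?r) E = 0"
      by (simp only: E_def linD(5)[OF lin_Lzw_power] diff_self)
    then show ?thesis ..
  qed
  ultimately have "E = 0"
    using residue_free_local_eq_0 by blast
  then have E: "supercomm scale p q (Y a) (Y b) m I n K v = (\<Sum>k<k0. \<Sum>L\<in>UNIV. R k L m I n K)"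
    by (simp add: E_def sum_fun_apply flip: supercomm_at_apply)
  have RHS: "scale (sigma L) (op_mult2 scale (D_W_div k L delta) (in_W (Y (fmode Y a (int k) L b))) m I n K v) =
      R k L m I n K" for k L
  proof -
    have "(\<lambda>m I n K. in_W (Y (fmode Y a (int k) L b)) m I n K v) = in_W_at (x k L)"
      by (simp add: fun_eq_iff in_W_def in_W_at_def x_def)
    then show ?thesis
      by (simp add: op_mult2_def D_W_div_delta mult2_sc_ZWs[OF convable_in_W] sc_apply R_def sigma_square)
  qed
  have "Sum_any (\<lambda>(k, L). R k L m I n K) = (\<Sum>(k, L)\<in>{..<k0} \<times> UNIV. R k L m I n K)"
  proof (rule Sum_any.expand_superset)
    show "{p. (case p of (k, L) \<Rightarrow> R k L m I n K) \<noteq> 0} \<subseteq> {..<k0} \<times> UNIV"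
      using R0 by (auto simp: not_le[symmetric] zero_fun_apply)
  qed simp
  then show ?thesis
    unfolding RHS E by (simp add: sum.cartesian_product)
qed

end

theorem theorem4p22:
  fixes scale :: "complex \<Rightarrow> 'v::ab_group_add \<Rightarrow> 'v"
    and V :: "bit \<Rightarrow> 'v set"
    and vac :: 'v
    and S :: "'n::{finite,linorder} \<Rightarrow> 'v \<Rightarrow> 'v"
    and Y :: "'v \<Rightarrow> int \<Rightarrow> 'n set \<Rightarrow> 'v \<Rightarrow> 'v"
    and p q :: bit
    and a b :: 'v
    and j :: int
    and J :: "'n set"
    and i :: 'n
  assumes "susy_vertex_algebra scale V vac S Y"
    and "a \<in> V p"
    and "b \<in> V q"
  shows "Y (fmode Y a j J b) =
           (\<lambda>n I v. scale (sigma J) (nth_product scale p q j J (Y a) (Y b) n I v)) \<and>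
         Y (fmode Y a (- 1) UNIV b) = normal_ordered scale p q (Y a) (Y b) \<and>
         Y (S i a) = D_Z scale i (Y a) \<and>
         supercomm scale p q (Y a) (Y b) =
           (\<lambda>m I n K v. Sum_any (\<lambda>(k::nat, L::'n set). scale (sigma L)
              (op_mult2 scale (D_W_div k L delta) (in_W (Y (fmode Y a (int k) L b))) m I n K v)))"
proof -
  interpret susy_vertex_algebra scale V vac S Y
    by (rule assms(1))
  have "sigma (UNIV :: 'n set) = 1"
    by (simp add: sigma_def)
  then have "Y (fmode Y a (- 1) UNIV b) = normal_ordered scale p q (Y a) (Y b)"
    unfolding Y_mode[OF assms(2,3)] normal_ordered_eq[OF Y_superfield Y_superfield] by simp
  then show ?thesis
    using Y_mode[OF assms(2,3)] Y_S[OF assms(2)] OPE[OF assms(2,3)]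
    by (intro conjI ext) simp_all
qed

end
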